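(* Let $N\ge1$, $a\in\{-1/2,1/2\}$, let $E\in C^1[-1,1]$ with $E(1)\ne0$, let $P^{(N),a}$ be the (possibly signed) measure on $\mathbb{J}^{(N),a}$ associated with $E$, and let $\varphi_t(x)=e^{t(x-1)}$. Then for every $t\ge0$, \[P^{(N),a}\,e^{tQ_{N,a}}=P^{(N),a}\,A^{\varphi_t}_{N,a},\] where measures are regarded as row vectors acted on by the matrices from the right.
   Context: Polynomials: for $x=\cos\theta$, $\mathsf{J}^{(-1/2,-1/2)}_s(\cos\theta)=\cos(s\theta)$, $\mathsf{J}^{(1/2,-1/2)}_s(\cos\theta)=\sin((s+\frac12)\theta)/\sin(\theta/2)$; $W^{(-1/2,-1/2)}(0)=1$, $W^{(-1/2,-1/2)}(s)=2$ ($s>0$), $W^{(1/2,-1/2)}(s)=1$. $\mathbb{J}_n$ = integer sequences $\lambda_1\ge\dots\ge\lambda_n\ge0$; $\mathbb{J}_0=\{\emptyset\}$. Dimensions: $\dim_{SO(2n+1)}\lambda=\prod_{i<j}\frac{l_i^2-l_j^2}{m_i^2-m_j^2}\prod_i\frac{l_i}{m_i}$ ($l_i=\lambda_i+n-i+\frac12$, $m_i=n-i+\frac12$), $\dim_{SO(2n)}\lambda=\prod_{i<j}\frac{l_i^2-l_j^2}{m_i^2-m_j^2}$ ($l_i=\lambda_i+n-i$, $m_i=n-i$). Write $SO(2n+1/2+b)$ for $SO(2n+1)$ if $b=1/2$ and $SO(2n)$ if $b=-1/2$. One-level matrices: for $\psi\in C^1[-1,1]$, $I^\psi_b(l,i)=\frac{W^{(b,-1/2)}(i)}{\pi}\int_{-1}^1\mathsf{J}^{(b,-1/2)}_i(x)\mathsf{J}^{(b,-1/2)}_l(x)\psi(x)(1-x)^b(1+x)^{-1/2}dx$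 and, on $\mathbb{J}_n\times\mathbb{J}_n$, $T^\psi_{n,b}(\mu,\lambda)=\det[I^\psi_b(\mu_i-i+n,\lambda_j-j+n)]_{i,j=1}^n\frac{\dim_{SO(2n+1/2+b)}\lambda}{\dim_{SO(2n+1/2+b)}\mu}$ ($T^\psi_{0,1/2}=1$). Link matrices: with $\mathcal{T}(x,y)=0$ if $x<y$, $=1$ if $x\ge y=0$, $=2$ if $x\ge y>0$, and $\phi(x,y)=1$ if $x>y$, $0$ otherwise: $T^{n,+}_{n,-}(\mu,\lambda)=\frac{\dim_{SO(2n)}\lambda}{\dim_{SO(2n+1)}\mu}\det[\mathcal{T}(\mu_i-i+n,\lambda_j-j+n)]_{i,j=1}^n$ for $\mu,\lambda\in\mathbb{J}_n$; $T^{n,-}_{n-1,+}(\mu,\lambda)=\frac{\dim_{SO(2n-1)}\lambda}{\dim_{SO(2n)}\mu}\det[\phi(\mu_i-i+n,\lambda_j-j+n-1)]_{i,j=1}^n$ for $\mu\in\mathbb{J}_n,\lambda\in\mathbb{J}_{n-1}$, with the convention $\lambda_n=0$. Paths: levels $(n,b)$, $n\ge1$, $b\in\{\pm\frac12\}$, ordered by $2n+b$: $\ell_1=(1,-\frac12),\ell_2=(1,\frac12),\ell_3=(2,-\frac12),\dots$; $(N,a)=\ell_M$, $M=2N+a-\frac12$. Interlacing: for $\lambda\in\mathbb{J}_n$ at level $(n,-\frac12)$ and $\mu\in\mathbb{J}_n$ at level $(n,\frac12)$, $\lambda\prec\mu$ iff $0\le\lambda_n\le\mu_n\le\lambda_{n-1}\le\dots\le\lambda_1\le\mu_1$;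 for $\lambda\in\mathbb{J}_n$ at $(n,\frac12)$ and $\mu\in\mathbb{J}_{n+1}$ at $(n+1,-\frac12)$, $\lambda\prec\mu$ iff $\mu_{n+1}\le\lambda_n\le\mu_n\le\dots\le\lambda_1\le\mu_1$. $\mathbb{J}^{(N),a}$ is the set of sequences $\lambda^{\ell_1}\prec\lambda^{\ell_2}\prec\dots\prec\lambda^{\ell_M}$ with $\lambda^{(n,b)}\in\mathbb{J}_n$. For $i\ge2$ let $\Lambda_i=T^{n,+}_{n,-}$ if $\ell_i=(n,\frac12)$ and $\Lambda_i=T^{n,-}_{n-1,+}$ if $\ell_i=(n,-\frac12)$, and $\Delta_i=\Lambda_iT^{\psi}_{\ell_{i-1}}$ (writing $T^\psi_{(n,b)}=T^\psi_{n,b}$). Define $A^\psi_{N,a}(\lambda,\mu)=T^\psi_{\ell_1}(\lambda^{\ell_1},\mu^{\ell_1})\prod_{i=2}^M\frac{T^\psi_{\ell_i}(\lambda^{\ell_i},\mu^{\ell_i})\Lambda_i(\mu^{\ell_i},\mu^{\ell_{i-1}})}{\Delta_i(\lambda^{\ell_i},\mu^{\ell_{i-1}})}$ if all $\Delta_i(\lambda^{\ell_i},\mu^{\ell_{i-1}})\ne0$, and $0$ otherwise. Measure: $P_{N,a}(\lambda)=C_{N,a}E(1)^{-N}\det[f_j^{(N,a)}(\lambda_i-i+N)]_{i,j=1}^N\dim_{SO(2N+1/2+a)}\lambda$, with $f_j^{(N,a)}(k)=\frac{W^{(a,-1/2)}(k)}{\pi}\int_{-1}^1x^{N-j}E(x)\mathsf{J}^{(a,-1/2)}_k(x)(1-x)^a(1+x)^{-1/2}dx$,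 $C_{N,1/2}=2^{N(N-1)/2}$, $C_{N,-1/2}=2^{(N-1)(N-2)/2}$; and $P^{(N),a}(\lambda)=P_{N,a}(\lambda^{\ell_M})\prod_{i=2}^M\Lambda_i(\lambda^{\ell_i},\lambda^{\ell_{i-1}})$. Generator $Q_{N,a}$ on $\mathbb{J}^{(N),a}$: for $\lambda\ne\mu$, $Q_{N,a}(\lambda,\mu)=1$ in Case 1a, $=\frac12$ in Case 1b or Case 2, $=0$ otherwise; diagonal entries make rows sum to $0$. Case 1: there are levels $\ell_p\le\ell_q$ with $\ell_p=(n_0,b_0)$, an index $k\le n_0$ and an integer $c$ such that $\lambda^{\ell}_k=c$, $\mu^{\ell}_k=c+1$ for all levels $\ell_p\le\ell\le\ell_q$, and all other entries of $\lambda$ and $\mu$ coincide. Case 1a: Case 1 with $b_0=-\frac12$, $k=n_0$, $c=0$ (a particle at the wall). Case 1b: Case 1 but not 1a. Case 2: there are levels $\ell_p\le\ell_q$, $\ell_p=(n_0,b_0)$, an index $k\le n_0$ and an integer $c$ such that for every level $\ell_p\le\ell=(n,b)\le\ell_q$, with $d=2(n-n_0)+b-b_0$, $\lambda^{\ell}_{k+d}=c$ and $\mu^{\ell}_{k+d}=c-1$, and all other entries coincide. ($Q_{N,a}$ generates the particle dynamics with independent rate-$\frac12$ left/right jumps, blocking, pushing and reflection at the wall.) *)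

theory Defs
  imports "HOL-Analysis.Analysis"
begin

text \<open>Jacobi-type polynomials J^{(b,-1/2)}_s at x = cos theta (b = 1/2 or b = -1/2).
  At x = 1 the value of sin((s+1/2)theta)/sin(theta/2) is its limit 2s+1.\<close>
definition Jac :: "real \<Rightarrow> nat \<Rightarrow> real \<Rightarrow> real" where
  "Jac b s x = (if b = 1/2
      then (if x = 1 then 2 * real s + 1
            else sin ((real s + 1/2) * arccos x) / sin (arccos x / 2))
      else cos (real s * arccos x))"

definition Wt :: "real \<Rightarrow> nat \<Rightarrow> real" where
  "Wt b s = (if b = 1/2 then 1 else if s = 0 then 1 else 2)"

definition weight :: "real \<Rightarrow> real \<Rightarrow> real" where
  "weight b x = (1 - x) powr b * (1 + x) powr (-1/2)"

definition Iint :: "real \<Rightarrow> (real \<Rightarrow> real) \<Rightarrow> nat \<Rightarrow> nat \<Rightarrow> real" where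
  "Iint b \<psi> l i = Wt b i / pi *
     integral {-1..1} (\<lambda>x. Jac b i x * Jac b l x * \<psi> x * weight b x)"

definition ldet :: "nat \<Rightarrow> (nat \<Rightarrow> nat \<Rightarrow> real) \<Rightarrow> real" where
  "ldet n f = (\<Sum>p\<in>{p. p permutes {..<n}}. of_int (sign p) * (\<Prod>i<n. f i (p i)))"

text \<open>J_n: nonincreasing sequences of n nonnegative integers (0-based lists;
  the paper's lambda_i is lam ! (i-1)).\<close>
definition Jset :: "nat \<Rightarrow> nat list set" where
  "Jset n = {xs. length xs = n \<and> sorted_wrt (\<lambda>x y. x \<ge> y) xs}"

text \<open>dimSO b n lam = dim_{SO(2n+1/2+b)} lam, i.e. SO(2n+1) if b = 1/2, SO(2n) otherwise.\<close>
definition dimSO :: "real \<Rightarrow> nat \<Rightarrow> nat list \<Rightarrow> real" where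
  "dimSO b n lam =
    (let sh = (if b = 1/2 then 1/2 else 1);
         l = (\<lambda>i. real (lam ! i) + real n - real i - sh);
         m = (\<lambda>i. real n - real i - sh)
     in (\<Prod>i<n. \<Prod>j\<in>{i<..<n}. (l i ^ 2 - l j ^ 2) / (m i ^ 2 - m j ^ 2))
        * (if b = 1/2 then (\<Prod>i<n. l i / m i) else 1))"

definition Tpsi :: "nat \<Rightarrow> real \<Rightarrow> (real \<Rightarrow> real) \<Rightarrow> nat list \<Rightarrow> nat list \<Rightarrow> real" where
  "Tpsi n b \<psi> mu lam =
     ldet n (\<lambda>i j. Iint b \<psi> (mu ! i + (n - 1 - i)) (lam ! j + (n - 1 - j)))
     * dimSO b n lam / dimSO b n mu"

definition Tcal :: "int \<Rightarrow> int \<Rightarrow> real" where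
  "Tcal x y = (if x < y then 0 else if y = 0 then 1 else 2)"

definition phi :: "int \<Rightarrow> int \<Rightarrow> real" where
  "phi x y = (if x > y then 1 else 0)"

definition ent :: "nat list \<Rightarrow> nat \<Rightarrow> nat" where
  "ent lam j = (if j < length lam then lam ! j else 0)"

definition rowidx :: "nat \<Rightarrow> nat list \<Rightarrow> nat \<Rightarrow> int" where
  "rowidx n mu i = int (ent mu i) + int n - int i - 1"

definition Tplus :: "nat \<Rightarrow> nat list \<Rightarrow> nat list \<Rightarrow> real" where
  "Tplus n mu lam = dimSO (-1/2) n lam / dimSO (1/2) n mu
     * ldet n (\<lambda>i j. Tcal (rowidx n mu i) (rowidx n lam j))"

text \<open>T^{n,-}_{n-1,+}; column index lambda_j - j + n - 1 with lambda_n = 0\<close>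
definition Tminus :: "nat \<Rightarrow> nat list \<Rightarrow> nat list \<Rightarrow> real" where
  "Tminus n mu lam = dimSO (1/2) (n - 1) lam / dimSO (-1/2) n mu
     * ldet n (\<lambda>i j. phi (rowidx n mu i) (int (ent lam j) + int n - int j - 2))"

text \<open>Level index i (0-based) stands for ell_{i+1}: ell_1 = (1,-1/2), ell_2 = (1,1/2), ...\<close>
definition levn :: "nat \<Rightarrow> nat" where
  "levn i = (i + 2) div 2"

definition levb :: "nat \<Rightarrow> real" where
  "levb i = (if even i then -1/2 else 1/2)"

definition Mlen :: "nat \<Rightarrow> real \<Rightarrow> nat" where
  "Mlen N a = (if a = 1/2 then 2 * N else 2 * N - 1)"

text \<open>prec i lam mu: lam at level ell_{i+1} interlaces with mu at level ell_{i+2}\<close>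
definition prec :: "nat \<Rightarrow> nat list \<Rightarrow> nat list \<Rightarrow> bool" where
  "prec i lam mu =
    (if even i
     then (\<forall>k<levn i. lam ! k \<le> mu ! k) \<and> (\<forall>k. k + 1 < levn i \<longrightarrow> mu ! (k + 1) \<le> lam ! k)
     else (\<forall>k<levn i. mu ! (k + 1) \<le> lam ! k \<and> lam ! k \<le> mu ! k))"

text \<open>The state space J^{(N),a}: lists ls with ls ! i = lambda^{ell_{i+1}}\<close>
definition Paths :: "nat \<Rightarrow> real \<Rightarrow> nat list list set" where
  "Paths N a = {ls. length ls = Mlen N a
      \<and> (\<forall>i<Mlen N a. ls ! i \<in> Jset (levn i))
      \<and> (\<forall>i. i + 1 < Mlen N a \<longrightarrow> prec i (ls ! i) (ls ! (i + 1)))}"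

text \<open>Lambda_{i+1} for level index i \<ge> 1\<close>
definition Lam :: "nat \<Rightarrow> nat list \<Rightarrow> nat list \<Rightarrow> real" where
  "Lam i = (if odd i then Tplus (levn i) else Tminus (levn i))"

definition Tlev :: "(real \<Rightarrow> real) \<Rightarrow> nat \<Rightarrow> nat list \<Rightarrow> nat list \<Rightarrow> real" where
  "Tlev \<psi> i = Tpsi (levn i) (levb i) \<psi>"

definition Delta :: "(real \<Rightarrow> real) \<Rightarrow> nat \<Rightarrow> nat list \<Rightarrow> nat list \<Rightarrow> real" where
  "Delta \<psi> i x y = (\<Sum>\<^sub>\<infinity>z\<in>Jset (levn (i - 1)). Lam i x z * Tlev \<psi> (i - 1) z y)"

definition Amat :: "(real \<Rightarrow> real) \<Rightarrow> nat \<Rightarrow> real \<Rightarrow> nat list list \<Rightarrow> nat list list \<Rightarrow> real" where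
  "Amat \<psi> N a lam mu =
    (let M = Mlen N a in
     if (\<forall>i\<in>{1..<M}. Delta \<psi> i (lam ! i) (mu ! (i - 1)) \<noteq> 0)
     then Tlev \<psi> 0 (lam ! 0) (mu ! 0) *
          (\<Prod>i\<in>{1..<M}. Tlev \<psi> i (lam ! i) (mu ! i) * Lam i (mu ! i) (mu ! (i - 1))
                          / Delta \<psi> i (lam ! i) (mu ! (i - 1)))
     else 0)"

definition fcoef :: "nat \<Rightarrow> real \<Rightarrow> (real \<Rightarrow> real) \<Rightarrow> nat \<Rightarrow> nat \<Rightarrow> real" where
  "fcoef N a E j k = Wt a k / pi *
     integral {-1..1} (\<lambda>x. x ^ (N - j - 1) * E x * Jac a k x * weight a x)"

definition Cconst :: "nat \<Rightarrow> real \<Rightarrow> real" where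
  "Cconst N a = (if a = 1/2 then 2 ^ (N * (N - 1) div 2) else 2 ^ ((N - 1) * (N - 2) div 2))"

definition Pmeas :: "nat \<Rightarrow> real \<Rightarrow> (real \<Rightarrow> real) \<Rightarrow> nat list \<Rightarrow> real" where
  "Pmeas N a E lam = Cconst N a * inverse (E 1 ^ N)
     * ldet N (\<lambda>i j. fcoef N a E j (lam ! i + (N - 1 - i))) * dimSO a N lam"

definition Ppath :: "nat \<Rightarrow> real \<Rightarrow> (real \<Rightarrow> real) \<Rightarrow> nat list list \<Rightarrow> real" where
  "Ppath N a E ls = Pmeas N a E (ls ! (Mlen N a - 1))
     * (\<Prod>i\<in>{1..<Mlen N a}. Lam i (ls ! i) (ls ! (i - 1)))"

text \<open>lam and mu differ exactly on the positions S (level index, 0-based particle index),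
  where lam has value c and mu has value c + delta.\<close>
definition moveset :: "(nat \<times> nat) set \<Rightarrow> int \<Rightarrow> int \<Rightarrow> nat list list \<Rightarrow> nat list list \<Rightarrow> bool" where
  "moveset S \<delta> c lam mu =
    ((\<forall>(i, j)\<in>S. i < length lam \<and> j < length (lam ! i)
                 \<and> int (lam ! i ! j) = c \<and> int (mu ! i ! j) = c + \<delta>)
     \<and> (\<forall>i<length lam. \<forall>j<length (lam ! i). (i, j) \<notin> S \<longrightarrow> lam ! i ! j = mu ! i ! j))"

definition case1 :: "nat \<Rightarrow> real \<Rightarrow> nat list list \<Rightarrow> nat list list \<Rightarrow> bool" where
  "case1 N a lam mu = (\<exists>p q j c. p \<le> q \<and> q < Mlen N a \<and> j < levn p
      \<and> moveset {(i, j) | i. p \<le> i \<and> i \<le> q} 1 c lam mu)"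

definition case1a :: "nat \<Rightarrow> real \<Rightarrow> nat list list \<Rightarrow> nat list list \<Rightarrow> bool" where
  "case1a N a lam mu = (\<exists>p q j c. p \<le> q \<and> q < Mlen N a \<and> j < levn p
      \<and> moveset {(i, j) | i. p \<le> i \<and> i \<le> q} 1 c lam mu
      \<and> levb p = -1/2 \<and> j = levn p - 1 \<and> c = 0)"

definition case2 :: "nat \<Rightarrow> real \<Rightarrow> nat list list \<Rightarrow> nat list list \<Rightarrow> bool" where
  "case2 N a lam mu = (\<exists>p q j c. p \<le> q \<and> q < Mlen N a \<and> j < levn p
      \<and> moveset {(i, j + (i - p)) | i. p \<le> i \<and> i \<le> q} (-1) c lam mu)"

definition Qoff :: "nat \<Rightarrow> real \<Rightarrow> nat list list \<Rightarrow> nat list list \<Rightarrow> real" where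
  "Qoff N a lam mu = (if case1a N a lam mu then 1
      else if (case1 N a lam mu \<and> \<not> case1a N a lam mu) \<or> case2 N a lam mu then 1/2 else 0)"

definition Qgen :: "nat \<Rightarrow> real \<Rightarrow> nat list list \<Rightarrow> nat list list \<Rightarrow> real" where
  "Qgen N a lam mu = (if lam = mu
      then - (\<Sum>\<^sub>\<infinity>\<nu>\<in>Paths N a - {lam}. Qoff N a lam \<nu>)
      else Qoff N a lam mu)"

fun Qpow :: "nat \<Rightarrow> real \<Rightarrow> nat \<Rightarrow> nat list list \<Rightarrow> nat list list \<Rightarrow> real" where
  "Qpow N a 0 lam mu = (if lam = mu then 1 else 0)"
| "Qpow N a (Suc k) lam mu = (\<Sum>\<^sub>\<infinity>\<nu>\<in>Paths N a. Qpow N a k lam \<nu> * Qgen N a \<nu> mu)"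

definition expQ :: "nat \<Rightarrow> real \<Rightarrow> real \<Rightarrow> nat list list \<Rightarrow> nat list list \<Rightarrow> real" where
  "expQ N a t lam mu = (\<Sum>k. t ^ k / fact k * Qpow N a k lam mu)"

end

theory Submission
  imports Defs
begin

text \<open>In \<open>Ppath\<close> and \<open>Amat\<close> the dimension factors telescope, so that \<open>Ppath\<close> is a constant times a bounded
  determinant of moments at the top level times the weight of the path. Multiplication by \<open>cos \<theta> - 1\<close>
  acts on the trigonometric basis as a nearest-neighbour walk. Hence the moment determinants for
  \<open>E x * exp (t * (x - 1))\<close> are bounded solutions of the forward equation of walks on \<open>Jset N\<close> killed upon
  collision. Such solutions are unique by Taylor expansion, which also identifies the one-level matrices
  with the transition kernels of these walks and makes them positive. An induction on the number of
  levels shows that the path generator, weighted over the paths with a fixed top, is the generator of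
  the top level. So the left-hand side is the path measure belonging to \<open>E x * exp (t * (x - 1))\<close>. On the
  right-hand side the denominators \<open>\<Delta>\<close> cancel successively when the levels are summed from the bottom,
  and the same measure appears.\<close>

section \<open>Bounded solutions of a forward equation\<close>

text \<open>Measures are row vectors, so every estimate concerns columns: a matrix with finite
  columns and bounded column sums is a bounded operator on bounded row vectors, signed ones
  included. For one level the column bound is a count of neighbours. For paths it is deduced from
  the intertwining, because every path weight is at least 1.

  Killing upon collision requires no argument about trajectories: a step that makes two particles
  collide produces a determinant with two equal rows. Boundedness holds for t >= 0 because
  \<open>cos \<theta> - 1\<close> is never positive. With the dimensions removed, all jump rates are
  constant away from the wall.

  Positivity of the kernels is needed in two places. It keeps the denominators away from 0 for t >
  0, while at t = 0 the kernels are identity matrices and a vanishing denominator meets a vanishing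
  numerator. It also yields the absolute summability that is required for regrouping the sum over
  paths by their top level, since the measure itself may change sign.\<close>

fun mpow :: "'a set \<Rightarrow> ('a \<Rightarrow> 'a \<Rightarrow> real) \<Rightarrow> nat \<Rightarrow> 'a \<Rightarrow> 'a \<Rightarrow> real" where
  "mpow S G 0 x y = (if x = y then 1 else 0)"
| "mpow S G (Suc k) x y = (\<Sum>\<^sub>\<infinity>z\<in>S. mpow S G k x z * G z y)"

definition mexp :: "'a set \<Rightarrow> ('a \<Rightarrow> 'a \<Rightarrow> real) \<Rightarrow> real \<Rightarrow> 'a \<Rightarrow> 'a \<Rightarrow> real" where
  "mexp S G t x y = (\<Sum>k. t ^ k / fact k * mpow S G k x y)"

definition row_act :: "'a set \<Rightarrow> ('a \<Rightarrow> 'a \<Rightarrow> real) \<Rightarrow> ('a \<Rightarrow> real) \<Rightarrow> 'a \<Rightarrow> real" where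
  "row_act S G u y = (\<Sum>\<^sub>\<infinity>x\<in>S. u x * G x y)"

lemma infsum_eq_sum_support:
  fixes f :: "'a \<Rightarrow> real"
  assumes "finite F" "F \<subseteq> S" "\<And>x. x \<in> S \<Longrightarrow> x \<notin> F \<Longrightarrow> f x = 0"
  shows "infsum f S = sum f F"
proof -
  have "infsum f S = infsum f F"
    by (rule infsum_cong_neutral) (use assms in auto)
  then show ?thesis using assms by simp
qed

text \<open>A bounded row vector u satisfies |uG| <= R sup |u|, hence |u G^k| <= R^k sup |u|, and
  the exponential series converges. Finite columns replace each infinite sum over the states by a
  finite one.\<close>

locale column_bounded =
  fixes S :: "'a set" and G :: "'a \<Rightarrow> 'a \<Rightarrow> real" and R :: real
  assumes finite_column: "y \<in> S \<Longrightarrow> finite {x\<in>S. G x y \<noteq> 0}"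
    and column_sum_le: "y \<in> S \<Longrightarrow> (\<Sum>x\<in>{x\<in>S. G x y \<noteq> 0}. \<bar>G x y\<bar>) \<le> R"
begin

lemma bound_nonneg: "y \<in> S \<Longrightarrow> 0 \<le> R"
  using column_sum_le[of y] by (meson abs_ge_zero dual_order.trans sum_nonneg)

lemma row_act_eq_sum:
  assumes "y \<in> S"
  shows "row_act S G u y = (\<Sum>x\<in>{x\<in>S. G x y \<noteq> 0}. u x * G x y)"
  unfolding row_act_def
  by (rule infsum_eq_sum_support) (use finite_column[OF assms] in auto)

lemma mpow_Suc_eq_sum:
  assumes "y \<in> S"
  shows "mpow S G (Suc k) x y = (\<Sum>z\<in>{z\<in>S. G z y \<noteq> 0}. mpow S G k x z * G z y)"
  unfolding mpow.simps
  by (rule infsum_eq_sum_support) (use finite_column[OF assms] in auto)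

lemma finite_mpow_column:
  "y \<in> S \<Longrightarrow> finite {x\<in>S. mpow S G k x y \<noteq> 0}"
proof (induction k arbitrary: y)
  case 0
  then show ?case by (auto intro: finite_subset[of _ "{y}"])
next
  case (Suc k)
  let ?Z = "{z\<in>S. G z y \<noteq> 0}"
  have "{x\<in>S. mpow S G (Suc k) x y \<noteq> 0} \<subseteq> (\<Union>z\<in>?Z. {x\<in>S. mpow S G k x z \<noteq> 0})"
  proof
    fix x assume x: "x \<in> {x\<in>S. mpow S G (Suc k) x y \<noteq> 0}"
    then have "(\<Sum>z\<in>?Z. mpow S G k x z * G z y) \<noteq> 0"
      using mpow_Suc_eq_sum[OF Suc.prems] by auto
    then obtain z where "z \<in> ?Z" "mpow S G k x z * G z y \<noteq> 0"
      by (meson sum.not_neutral_contains_not_neutral)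
    then show "x \<in> (\<Union>z\<in>?Z. {x\<in>S. mpow S G k x z \<noteq> 0})" using x by auto
  qed
  moreover have "finite (\<Union>z\<in>?Z. {x\<in>S. mpow S G k x z \<noteq> 0})"
    using finite_column[OF Suc.prems] Suc.IH by auto
  ultimately show ?case by (rule finite_subset)
qed

lemma mpow_column_sum_le:
  "y \<in> S \<Longrightarrow> finite X \<Longrightarrow> (\<Sum>x\<in>X. \<bar>mpow S G k x y\<bar>) \<le> R ^ k"
proof (induction k arbitrary: y)
  case 0
  then show ?case by (simp add: if_distrib[of abs] cong: if_cong)
next
  case (Suc k)
  let ?Z = "{z\<in>S. G z y \<noteq> 0}"
  have "(\<Sum>x\<in>X. \<bar>mpow S G (Suc k) x y\<bar>) \<le> (\<Sum>x\<in>X. \<Sum>z\<in>?Z. \<bar>mpow S G k x z\<bar> * \<bar>G z y\<bar>)"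
    unfolding mpow_Suc_eq_sum[OF Suc.prems(1)]
    by (intro sum_mono order.trans[OF sum_abs]) (simp add: abs_mult)
  also have "\<dots> = (\<Sum>z\<in>?Z. (\<Sum>x\<in>X. \<bar>mpow S G k x z\<bar>) * \<bar>G z y\<bar>)"
    by (subst sum.swap) (simp add: sum_distrib_right)
  also have "\<dots> \<le> (\<Sum>z\<in>?Z. R ^ k * \<bar>G z y\<bar>)"
    using Suc by (intro sum_mono mult_right_mono) auto
  also have "\<dots> = R ^ k * (\<Sum>z\<in>?Z. \<bar>G z y\<bar>)"
    by (simp add: sum_distrib_left)
  also have "\<dots> \<le> R ^ k * R"
    using column_sum_le[OF Suc.prems(1)] bound_nonneg[OF Suc.prems(1)]
    by (intro mult_left_mono) auto
  finally show ?case by (simp add: mult.commute)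
qed

lemma abs_mpow_le: "y \<in> S \<Longrightarrow> \<bar>mpow S G k x y\<bar> \<le> R ^ k"
  using mpow_column_sum_le[of y "{x}" k] by simp

text \<open>Associativity of u * G * ... * G, where only finitely many x contribute. X may be any
  finite set containing the support, because the induction step evaluates several columns over one
  common set.\<close>

lemma funpow_row_act:
  assumes "finite X" "y \<in> S" "{x\<in>S. mpow S G k x y \<noteq> 0} \<subseteq> X" "X \<subseteq> S"
  shows "(row_act S G ^^ k) u y = (\<Sum>x\<in>X. u x * mpow S G k x y)"
  using assms
proof (induction k arbitrary: y X)
  case 0
  then show ?case by (auto simp: if_distrib[of "\<lambda>z. u _ * z"] sum.delta cong: if_cong)
next
  case (Suc k)
  let ?Z = "{z\<in>S. G z y \<noteq> 0}"
  define Y where "Y = X \<union> (\<Union>z\<in>?Z. {x\<in>S. mpow S G k x z \<noteq> 0})"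
  have Y: "finite Y" "Y \<subseteq> S" "X \<subseteq> Y"
    unfolding Y_def using finite_column[OF Suc.prems(2)] finite_mpow_column Suc.prems by auto
  have "(row_act S G ^^ Suc k) u y = row_act S G ((row_act S G ^^ k) u) y" by simp
  also have "\<dots> = (\<Sum>z\<in>?Z. (row_act S G ^^ k) u z * G z y)"
    by (rule row_act_eq_sum) fact
  also have "\<dots> = (\<Sum>z\<in>?Z. (\<Sum>x\<in>Y. u x * mpow S G k x z) * G z y)"
    using Y by (intro sum.cong refl arg_cong2[where f = times] Suc.IH) (auto simp: Y_def)
  also have "\<dots> = (\<Sum>x\<in>Y. u x * mpow S G (Suc k) x y)"
    unfolding mpow_Suc_eq_sum[OF Suc.prems(2)]
    by (simp add: sum_distrib_left sum_distrib_right mult.assoc) (rule sum.swap)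
  also have "\<dots> = (\<Sum>x\<in>X. u x * mpow S G (Suc k) x y)"
    using Suc.prems Y by (intro sum.mono_neutral_right) auto
  finally show ?case .
qed

lemma abs_funpow_row_act_le:
  assumes "y \<in> S" "\<And>x. x \<in> S \<Longrightarrow> \<bar>u x\<bar> \<le> K"
  shows "\<bar>(row_act S G ^^ k) u y\<bar> \<le> K * R ^ k"
proof -
  let ?X = "{x\<in>S. mpow S G k x y \<noteq> 0}"
  have K: "0 \<le> K" using assms by (meson abs_ge_zero order.trans)
  have "\<bar>(row_act S G ^^ k) u y\<bar> \<le> (\<Sum>x\<in>?X. \<bar>u x\<bar> * \<bar>mpow S G k x y\<bar>)"
    by (subst funpow_row_act[of ?X])
      (use finite_mpow_column assms in \<open>auto simp: abs_mult intro!: order.trans[OF sum_abs]\<close>)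
  also have "\<dots> \<le> (\<Sum>x\<in>?X. K * \<bar>mpow S G k x y\<bar>)"
    using assms by (intro sum_mono mult_right_mono) auto
  also have "\<dots> \<le> K * R ^ k"
    unfolding sum_distrib_left[symmetric]
    using mpow_column_sum_le finite_mpow_column assms K by (intro mult_left_mono) auto
  finally show ?thesis .
qed

lemma summable_power_bound: "summable (\<lambda>k. K * (t * R) ^ k / fact k :: real)"
  using summable_mult[OF summable_exp[of "t * R"], of K]
  by (simp add: field_simps)

lemma summable_mexp:
  assumes "y \<in> S"
  shows "summable (\<lambda>k. t ^ k / fact k * mpow S G k x y)"
proof (rule summable_comparison_test')
  show "summable (\<lambda>k. 1 * (\<bar>t\<bar> * R) ^ k / fact k)" by (rule summable_power_bound)
  show "norm (t ^ k / fact k * mpow S G k x y) \<le> 1 * (\<bar>t\<bar> * R) ^ k / fact k" if "k \<ge> 0" for k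
    using abs_mpow_le[OF assms, of k x]
    by (auto simp: abs_mult power_abs power_mult_distrib intro!: divide_right_mono mult_left_mono)
qed

text \<open>The estimate behind the exchange of the power series with the sum over the states: the
  terms with power k contribute at most K (tR)^k / k!.\<close>

lemma abs_summable_mexp_terms:
  assumes y: "y \<in> S" and K: "\<And>x. x \<in> S \<Longrightarrow> \<bar>u x\<bar> \<le> K" and t: "t \<ge> 0"
  shows "(\<lambda>p. norm (case p of (k, x) \<Rightarrow> t ^ k / fact k * (u x * mpow S G k x y))) summable_on (UNIV \<times> S)"
proof -
  let ?X = "\<lambda>k. {x\<in>S. mpow S G k x y \<noteq> 0}"
  let ?f = "\<lambda>k x. t ^ k / fact k * (u x * mpow S G k x y)"
  have K0: "0 \<le> K" using assms by (meson abs_ge_zero order.trans)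
  have *: "(\<Sum>\<^sub>\<infinity>x\<in>S. norm (?f k x)) = (\<Sum>x\<in>?X k. norm (?f k x))" for k
    by (rule infsum_eq_sum_support) (use finite_mpow_column[OF y] in auto)
  have le: "(\<Sum>x\<in>?X k. norm (?f k x)) \<le> K * (t * R) ^ k / fact k" for k
  proof -
    have "(\<Sum>x\<in>?X k. norm (?f k x)) \<le> (\<Sum>x\<in>?X k. t ^ k / fact k * (K * \<bar>mpow S G k x y\<bar>))"
      using K t by (intro sum_mono) (auto simp: abs_mult intro!: mult_left_mono mult_right_mono divide_right_mono)
    also have "\<dots> = t ^ k / fact k * (K * (\<Sum>x\<in>?X k. \<bar>mpow S G k x y\<bar>))"
      by (simp add: sum_distrib_left)
    also have "\<dots> \<le> t ^ k / fact k * (K * R ^ k)"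
      using mpow_column_sum_le[OF y] finite_mpow_column[OF y] K0 t
      by (intro mult_left_mono) auto
    finally show ?thesis by (simp add: power_mult_distrib mult_ac)
  qed
  have inner: "(\<lambda>x. norm (?f k x)) summable_on S" for k
    by (rule finite_nonzero_values_imp_summable_on)
       (rule finite_subset[OF _ finite_mpow_column[OF y, of k]], auto)
  have "summable (\<lambda>k. \<Sum>x\<in>?X k. norm (?f k x))"
    by (rule summable_comparison_test'[OF summable_power_bound[of K t], of 0])
       (use le in \<open>auto simp: abs_of_nonneg sum_nonneg\<close>)
  then have "(\<lambda>k. \<Sum>\<^sub>\<infinity>x\<in>S. norm (?f k x)) summable_on UNIV"
    unfolding * by (intro norm_summable_imp_summable_on) (simp add: sum_nonneg)
  then show ?thesis
    by (subst Infinite_Sum.abs_summable_on_Sigma_iff) (use inner in \<open>simp add: abs_of_nonneg infsum_nonneg\<close>)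
qed

lemma mexp_row_sum:
  assumes y: "y \<in> S" and K: "\<And>x. x \<in> S \<Longrightarrow> \<bar>u x\<bar> \<le> K" and t: "t \<ge> 0"
  shows "((\<lambda>x. u x * mexp S G t x y) has_sum (\<Sum>k. t ^ k / fact k * (row_act S G ^^ k) u y)) S"
proof -
  let ?f = "\<lambda>k x. t ^ k / fact k * (u x * mpow S G k x y)"
  have abs: "(\<lambda>p. norm (case p of (k, x) \<Rightarrow> ?f k x)) summable_on (UNIV \<times> S)"
    by (rule abs_summable_mexp_terms[OF assms])
  have sm: "(\<lambda>(k, x). ?f k x) summable_on (UNIV \<times> S)"
    using abs by (rule abs_summable_summable)
  have k_sum: "(\<Sum>\<^sub>\<infinity>k. ?f k x) = u x * mexp S G t x y" for x
  proof -
    have "summable (\<lambda>k. norm (t ^ k / fact k * mpow S G k x y))"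
    proof (rule summable_comparison_test')
      show "summable (\<lambda>k. 1 * (\<bar>t\<bar> * R) ^ k / fact k)" by (rule summable_power_bound)
      show "norm (norm (t ^ k / fact k * mpow S G k x y)) \<le> 1 * (\<bar>t\<bar> * R) ^ k / fact k" if "k \<ge> 0" for k
        using abs_mpow_le[OF y, of k x]
        by (auto simp: abs_mult power_abs power_mult_distrib intro!: divide_right_mono mult_left_mono)
    qed
    then have "((\<lambda>k. t ^ k / fact k * mpow S G k x y) has_sum mexp S G t x y) UNIV"
      unfolding mexp_def
      by (intro norm_summable_imp_has_sum summable_sums summable_mexp y)
    then have "((\<lambda>k. u x * (t ^ k / fact k * mpow S G k x y)) has_sum u x * mexp S G t x y) UNIV"
      by (rule has_sum_cmult_right)
    then show ?thesis by (simp add: infsumI mult_ac)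
  qed
  have x_sum: "(\<Sum>\<^sub>\<infinity>x\<in>S. ?f k x) = t ^ k / fact k * (row_act S G ^^ k) u y" for k
    by (subst infsum_eq_sum_support[of "{x\<in>S. mpow S G k x y \<noteq> 0}"],
        use finite_mpow_column[OF y] in auto,
        subst funpow_row_act[of "{x\<in>S. mpow S G k x y \<noteq> 0}"])
       (use finite_mpow_column[OF y] y in \<open>auto simp: sum_distrib_left sum_divide_distrib\<close>)
  have sw: "(\<lambda>(x, k). ?f k x) summable_on (S \<times> UNIV)"
    using sm by (subst summable_on_swap) (simp add: case_prod_unfold)
  have 1: "(\<lambda>x. u x * mexp S G t x y) summable_on S"
    using summable_on_Sigma_banach[OF sw] by (simp only: k_sum)
  have 2: "(\<lambda>k. t ^ k / fact k * (row_act S G ^^ k) u y) summable_on UNIV"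
    using summable_on_Sigma_banach[OF sm] by (simp only: x_sum)
  have "(\<Sum>\<^sub>\<infinity>x\<in>S. u x * mexp S G t x y) = (\<Sum>\<^sub>\<infinity>x\<in>S. \<Sum>\<^sub>\<infinity>k. ?f k x)"
    by (simp only: k_sum)
  also have "\<dots> = (\<Sum>\<^sub>\<infinity>k. \<Sum>\<^sub>\<infinity>x\<in>S. ?f k x)"
    by (rule infsum_swap_banach[symmetric]) (use sm in auto)
  also have "\<dots> = (\<Sum>\<^sub>\<infinity>k. t ^ k / fact k * (row_act S G ^^ k) u y)"
    by (simp only: x_sum)
  also have "\<dots> = (\<Sum>k. t ^ k / fact k * (row_act S G ^^ k) u y)"
    using 2 has_sum_imp_sums has_sum_infsum sums_unique by blast
  finally show ?thesis using 1 by (metis has_sum_infsum)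
qed

text \<open>Taylor expansion at time 0: the column bound makes the remainders vanish, so a
  bounded solution of the forward equation is unique.\<close>

theorem forward_equation_solution:
  assumes der: "\<And>s y. y \<in> S \<Longrightarrow> ((\<lambda>s. u s y) has_real_derivative row_act S G (u s) y) (at s)"
    and K: "\<And>s y. 0 \<le> s \<Longrightarrow> s \<le> t \<Longrightarrow> y \<in> S \<Longrightarrow> \<bar>u s y\<bar> \<le> K"
    and y: "y \<in> S" and t: "t \<ge> 0"
  shows "((\<lambda>x. u 0 x * mexp S G t x y) has_sum u t y) S"
proof -
  let ?d = "\<lambda>k s. (row_act S G ^^ k) (u s) y"
  have K0: "0 \<le> K" using K[of 0 y] y t by (meson abs_ge_zero order.trans order_refl)
  \<comment> \<open>Each value of the k-th iterate is a finite combination of values of u, so it can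
    be differentiated term by term; the forward equation supplies one more application of the
    generator.\<close>
  have derk: "(?d k has_real_derivative ?d (Suc k) s) (at s)" for k s
  proof -
    let ?X = "{x\<in>S. mpow S G k x y \<noteq> 0}"
    have eq: "(row_act S G ^^ k) v y = (\<Sum>x\<in>?X. v x * mpow S G k x y)" for v
      by (rule funpow_row_act) (use finite_mpow_column[OF y] y in auto)
    have "((\<lambda>s. \<Sum>x\<in>?X. u s x * mpow S G k x y) has_real_derivative
        (\<Sum>x\<in>?X. row_act S G (u s) x * mpow S G k x y)) (at s)"
      by (intro DERIV_sum DERIV_cmult_right der) auto
    then show ?thesis
      unfolding funpow_Suc_right comp_def eq[symmetric] .
  qed
  have "(\<lambda>n. \<Sum>k<n. t ^ k / fact k * ?d k 0) \<longlonglongrightarrow> u t y"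
  \<comment> \<open>\<open>Maclaurin\<close> needs a positive time.\<close>
  proof (cases "t = 0")
    case True
    have "(\<Sum>k<n. t ^ k / fact k * ?d k 0) = u t y" if "n \<ge> 1" for n
    proof -
      have "(\<Sum>k<n. t ^ k / fact k * ?d k 0) = (\<Sum>k\<in>{0}. t ^ k / fact k * ?d k 0)"
        using that True by (intro sum.mono_neutral_right) auto
      then show ?thesis using True by simp
    qed
    then show ?thesis
      by (metis (no_types, lifting) LIMSEQ_def dist_self)
  next
    case False
    then have t0: "t > 0" using t by auto
    have bd: "norm ((\<Sum>k<n. t ^ k / fact k * ?d k 0) - u t y) \<le> K * (t * R) ^ n / fact n"
      if n: "n > 0" for n
    proof -
      \<comment> \<open>The remainder is taken at a time s between 0 and t, where the bound K is
        still available.\<close>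
      obtain s where s: "0 < s" "s < t"
        "u t y = (\<Sum>m<n. ?d m 0 / fact m * t ^ m) + ?d n s / fact n * t ^ n"
        using Maclaurin[of t n ?d "\<lambda>s. u s y"] t0 n derk by auto
      have "norm ((\<Sum>k<n. t ^ k / fact k * ?d k 0) - u t y) = \<bar>?d n s\<bar> / fact n * t ^ n"
        using s t0 by (simp add: mult_ac abs_mult)
      also have "\<dots> \<le> K * R ^ n / fact n * t ^ n"
        using abs_funpow_row_act_le[OF y, of "u s" K n] K s t0
        by (intro mult_right_mono divide_right_mono) auto
      finally show ?thesis by (simp add: power_mult_distrib mult_ac)
    qed
    have "(\<lambda>n. (\<Sum>k<n. t ^ k / fact k * ?d k 0) - u t y) \<longlonglongrightarrow> 0"
      by (rule Lim_null_comparison[OF _ summable_LIMSEQ_zero[OF summable_power_bound[of K t]]])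
         (use bd in \<open>auto simp: eventually_sequentially intro!: exI[of _ 1]\<close>)
    then show ?thesis by (rule LIM_zero_cancel)
  qed
  then have "(\<Sum>k. t ^ k / fact k * ?d k 0) = u t y"
    by (intro sums_unique[symmetric]) (simp add: sums_def)
  with mexp_row_sum[OF y, of "u 0" K t] K t show ?thesis by auto
qed

lemma mpow_nonneg:
  assumes "\<And>x y. x \<in> S \<Longrightarrow> y \<in> S \<Longrightarrow> G x y \<ge> 0" "x \<in> S" "y \<in> S"
  shows "mpow S G k x y \<ge> 0"
  using assms(3)
proof (induction k arbitrary: y)
  case (Suc k)
  then show ?case unfolding mpow.simps using assms(1) by (intro infsum_nonneg) auto
qed simp

text \<open>With nonnegative entries the exponential series has no cancellation, so one positive
  power suffices, and a chain of positive entries yields one. A generator has negative diagonal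
  entries, so this applies only after its diagonal has been shifted.\<close>

lemma mexp_pos:
  assumes G: "\<And>x y. x \<in> S \<Longrightarrow> y \<in> S \<Longrightarrow> G x y \<ge> 0" and "x \<in> S" "y \<in> S" "t > 0"
    and path: "(\<lambda>x y. x \<in> S \<and> y \<in> S \<and> G x y > 0)\<^sup>*\<^sup>* x y"
  shows "mexp S G t x y > 0"
proof -
  have "\<exists>k. mpow S G k x y > 0"
    using path
  proof (induction rule: rtranclp_induct)
    case base
    show ?case by (rule exI[of _ 0]) simp
  next
    case (step y z)
    then obtain k where k: "mpow S G k x y > 0" by auto
    have nn: "mpow S G k x w \<ge> 0" if "w \<in> S" for w
      using mpow_nonneg[OF G \<open>x \<in> S\<close> that, of k] by auto
    have "0 < mpow S G k x y * G y z" using k step by auto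
    also have "\<dots> \<le> mpow S G (Suc k) x z"
      unfolding mpow_Suc_eq_sum[OF step(2)[THEN conjunct2, THEN conjunct1]]
      by (rule member_le_sum) (use step nn G finite_column in auto)
    finally show ?case by blast
  qed
  then obtain k where k: "mpow S G k x y > 0" by auto
  show ?thesis unfolding mexp_def
    by (rule suminf_pos2[of _ k])
       (use k assms mpow_nonneg[OF G \<open>x \<in> S\<close> \<open>y \<in> S\<close>] summable_mexp[of y] in auto)
qed

end

section \<open>Moments against the trigonometric basis\<close>

text \<open>The denominator \<open>sin (\<theta> / 2)\<close> of \<open>Jac\<close> is dropped:
  after the substitution the weight supplies its square, which removes the singularity at 0.\<close>

definition osc :: "real \<Rightarrow> nat \<Rightarrow> real \<Rightarrow> real" where
  "osc b k \<theta> = (if b = 1/2 then sin ((real k + 1/2) * \<theta>) else cos (real k * \<theta>))"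

text \<open>The common form of the entries of \<open>Iint\<close> and \<open>fcoef\<close> after x =
  cos \<theta>: u collects what depends neither on the time nor on the index k.\<close>

definition moment :: "real \<Rightarrow> (real \<Rightarrow> real) \<Rightarrow> real \<Rightarrow> nat \<Rightarrow> real" where
  "moment b u t k =
     Wt b k / pi * integral {0..pi} (\<lambda>\<theta>. u \<theta> * exp (t * (cos \<theta> - 1)) * osc b k \<theta>)"

lemma continuous_on_osc [continuous_intros]: "continuous_on A (osc b k)"
  by (cases "b = 1/2") (auto simp: osc_def[abs_def] intro!: continuous_intros)

lemma abs_osc_le: "\<bar>osc b k \<theta>\<bar> \<le> 1"
  by (simp add: osc_def)

lemma Jac_cos:
  assumes "\<theta> \<in> {0<..<pi}"
  shows "Jac b k (cos \<theta>) * (if b = 1/2 then sin (\<theta> / 2) else 1) = osc b k \<theta>"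
proof -
  have "cos \<theta> \<noteq> 1" using assms cos_monotone_0_pi[of 0 \<theta>] by auto
  moreover have "sin (\<theta> / 2) > 0" using assms by (intro sin_gt_zero) auto
  ultimately show ?thesis using assms by (simp add: Jac_def osc_def arccos_cos)
qed

text \<open>Half-angle formulas. The Jacobian \<open>sin \<theta>\<close> cancels the singular
  factor \<open>(1 + x) powr (-1/2)\<close>, and for b = -1/2 also
  \<open>(1 - x) powr b\<close>.\<close>

lemma weight_cos:
  assumes "\<theta> \<in> {0<..<pi}" "b \<in> {-1/2, 1/2}"
  shows "sin \<theta> * weight b (cos \<theta>) = (if b = 1/2 then 2 * (sin (\<theta> / 2))\<^sup>2 else 1)"
proof -
  let ?s = "sin (\<theta> / 2)" and ?c = "cos (\<theta> / 2)"
  have s: "?s > 0" using assms by (intro sin_gt_zero) auto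
  have c: "?c > 0" using assms by (intro cos_gt_zero) auto
  have 1: "1 - cos \<theta> = 2 * ?s\<^sup>2" using cos_double_sin[of "\<theta> / 2"] by simp
  have 2: "1 + cos \<theta> = 2 * ?c\<^sup>2" using cos_double_cos[of "\<theta> / 2"] by simp
  have 3: "sin \<theta> = 2 * ?s * ?c" using sin_double[of "\<theta> / 2"] by simp
  have p: "(2 * x\<^sup>2) powr (1/2) = sqrt 2 * x" if "x > 0" for x :: real
    using that by (simp add: powr_half_sqrt real_sqrt_mult)
  have m: "(2 * x\<^sup>2) powr (- 1/2) = inverse (sqrt 2 * x)" if "x > 0" for x :: real
    using p[OF that] by (metis divide_minus_left powr_minus)
  show ?thesis
  proof (cases "b = 1/2")
    case True
    show ?thesis unfolding weight_def 1 2 unfolding True 3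
      using p[OF s] m[OF c] s c by (simp add: field_simps power2_eq_square)
  next
    case False
    then have b: "b = - 1/2" using assms by auto
    show ?thesis unfolding weight_def 1 2 unfolding b 3 m[OF s] m[OF c]
      using s c by (simp add: field_simps)
  qed
qed

lemma cos_image_open_interval: "cos ` {0<..<pi} = {-1<..<1}"
proof (intro equalityI subsetI)
  fix x assume "x \<in> cos ` {0<..<pi}"
  then obtain \<theta> where "x = cos \<theta>" "0 < \<theta>" "\<theta> < pi" by auto
  then show "x \<in> {-1<..<1}"
    using cos_monotone_0_pi[of 0 \<theta>] cos_monotone_0_pi[of \<theta> pi] by auto
next
  fix x :: real assume "x \<in> {-1<..<1}"
  then show "x \<in> cos ` {0<..<pi}"
    using arccos_lt_bounded[of x] by (intro image_eqI[of _ _ "arccos x"]) auto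
qed

text \<open>The integrand g may be singular at the endpoints, so the substitution is made on the
  open interval, where cos is injective. Integrability of g comes from the continuous function
  h.\<close>

lemma integral_cos_substitution:
  assumes h: "continuous_on {0..pi} h"
    and gh: "\<And>\<theta>. \<theta> \<in> {0<..<pi} \<Longrightarrow> sin \<theta> * g (cos \<theta>) = h \<theta>"
  shows "integral {-1..1} g = integral {0..pi} h"
proof -
  have inj: "inj_on cos {0<..<pi}"
    by (rule inj_onI, rule cos_inj_pi) auto
  have der: "(cos has_real_derivative - sin \<theta>) (at \<theta> within {0<..<pi})" for \<theta>
    by (auto intro!: derivative_eq_intros)
  have eq: "\<bar>- sin \<theta>\<bar> * g (cos \<theta>) = h \<theta>" if "\<theta> \<in> {0<..<pi}" for \<theta>
    using gh[OF that] sin_gt_zero[of \<theta>] that by auto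
  have "h absolutely_integrable_on {0..pi}"
    by (rule absolutely_integrable_continuous_real) fact
  then have "h absolutely_integrable_on {0<..<pi}"
    by (rule set_integrable_subset) auto
  then have "(\<lambda>\<theta>. \<bar>- sin \<theta>\<bar> * g (cos \<theta>)) absolutely_integrable_on {0<..<pi}"
    by (rule iffD1[OF set_integrable_cong, rotated -1]) (use eq in auto)
  moreover have "integral {0<..<pi} (\<lambda>\<theta>. \<bar>- sin \<theta>\<bar> * g (cos \<theta>)) = integral {0<..<pi} h"
    by (rule integral_cong) (use eq in auto)
  ultimately have "integral (cos ` {0<..<pi}) g = integral {0<..<pi} h"
    using has_absolute_integral_change_of_variables_1'[of "{0<..<pi}" cos "\<lambda>\<theta>. - sin \<theta>" g, OF _ der inj, of "integral {0<..<pi} h"]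
    by simp
  then show ?thesis
    unfolding cos_image_open_interval by (simp add: integral_open_interval_real)
qed

lemma exp_osc_integrable:
  assumes "continuous_on {0..pi} u"
  shows "(\<lambda>\<theta>. u \<theta> * exp (t * (cos \<theta> - 1)) * osc b k \<theta>) integrable_on {0..pi}"
  by (intro integrable_continuous_real continuous_intros assms)

lemma Iint_eq_moment:
  assumes b: "b \<in> {-1/2, 1/2}"
  shows "Iint b (\<lambda>x. exp (t * (x - 1))) l i =
    moment b (\<lambda>\<theta>. (if b = 1/2 then 2 else 1) * osc b l \<theta>) t i"
proof -
  have "integral {-1..1} (\<lambda>x. Jac b i x * Jac b l x * exp (t * (x - 1)) * weight b x) =
    integral {0..pi} (\<lambda>\<theta>. (if b = 1/2 then 2 else 1) * osc b l \<theta> * exp (t * (cos \<theta> - 1)) * osc b i \<theta>)"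
  proof (rule integral_cos_substitution)
    fix \<theta> assume \<theta>: "\<theta> \<in> {0<..<pi}"
    have "sin \<theta> * (Jac b i (cos \<theta>) * Jac b l (cos \<theta>) * exp (t * (cos \<theta> - 1)) * weight b (cos \<theta>))
      = (sin \<theta> * weight b (cos \<theta>)) * Jac b i (cos \<theta>) * Jac b l (cos \<theta>) * exp (t * (cos \<theta> - 1))"
      by (simp add: mult_ac)
    then show "sin \<theta> * (Jac b i (cos \<theta>) * Jac b l (cos \<theta>) * exp (t * (cos \<theta> - 1)) * weight b (cos \<theta>)) =
       (if b = 1/2 then 2 else 1) * osc b l \<theta> * exp (t * (cos \<theta> - 1)) * osc b i \<theta>"
      unfolding weight_cos[OF \<theta> b] using Jac_cos[OF \<theta>, of b i, symmetric] Jac_cos[OF \<theta>, of b l, symmetric]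
      by (auto simp: power2_eq_square mult_ac)
  qed (intro continuous_intros)
  then show ?thesis by (simp add: Iint_def moment_def)
qed

lemma fcoef_eq_moment:
  assumes b: "a \<in> {-1/2, 1/2}" and E: "continuous_on {-1..1} E"
  shows "fcoef N a (\<lambda>x. E x * exp (t * (x - 1))) j k =
    moment a (\<lambda>\<theta>. cos \<theta> ^ (N - j - 1) * E (cos \<theta>) * (if a = 1/2 then 2 * sin (\<theta> / 2) else 1)) t k"
proof -
  have "integral {-1..1} (\<lambda>x. x ^ (N - j - 1) * (E x * exp (t * (x - 1))) * Jac a k x * weight a x) =
    integral {0..pi} (\<lambda>\<theta>. cos \<theta> ^ (N - j - 1) * E (cos \<theta>) * (if a = 1/2 then 2 * sin (\<theta> / 2) else 1)
      * exp (t * (cos \<theta> - 1)) * osc a k \<theta>)"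
  proof (rule integral_cos_substitution)
    fix \<theta> assume \<theta>: "\<theta> \<in> {0<..<pi}"
    have "sin \<theta> * (cos \<theta> ^ (N - j - 1) * (E (cos \<theta>) * exp (t * (cos \<theta> - 1))) * Jac a k (cos \<theta>) * weight a (cos \<theta>))
      = (sin \<theta> * weight a (cos \<theta>)) * Jac a k (cos \<theta>) * cos \<theta> ^ (N - j - 1) * E (cos \<theta>) * exp (t * (cos \<theta> - 1))"
      by (simp add: mult_ac)
    then show "sin \<theta> * (cos \<theta> ^ (N - j - 1) * (E (cos \<theta>) * exp (t * (cos \<theta> - 1))) * Jac a k (cos \<theta>) * weight a (cos \<theta>))
      = cos \<theta> ^ (N - j - 1) * E (cos \<theta>) * (if a = 1/2 then 2 * sin (\<theta> / 2) else 1)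
      * exp (t * (cos \<theta> - 1)) * osc a k \<theta>"
      unfolding weight_cos[OF \<theta> b] using Jac_cos[OF \<theta>, of a k, symmetric]
      by (auto simp: power2_eq_square mult_ac)
  next
    have "continuous_on {0..pi} (\<lambda>\<theta>. E (cos \<theta>))"
      by (rule continuous_on_compose2[OF E]) (auto intro: continuous_intros)
    then show "continuous_on {0..pi} (\<lambda>\<theta>. cos \<theta> ^ (N - j - 1) * E (cos \<theta>) * (if a = 1/2 then 2 * sin (\<theta> / 2) else 1)
      * exp (t * (cos \<theta> - 1)) * osc a k \<theta>)"
      by (cases "a = 1/2") (auto intro!: continuous_intros)
  qed
  then show ?thesis by (simp add: fcoef_def moment_def)
qed

text \<open>For t >= 0 the exponential is at most 1, so the bound depends neither on the time nor on
  k. The factor 2 is the largest value of \<open>Wt\<close>.\<close>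

lemma abs_moment_le:
  assumes u: "continuous_on {0..pi} u" and K: "\<And>\<theta>. \<theta> \<in> {0..pi} \<Longrightarrow> \<bar>u \<theta>\<bar> \<le> K" and t: "t \<ge> 0"
  shows "\<bar>moment b u t k\<bar> \<le> 2 * K"
proof -
  have K0: "0 \<le> K" using K[of 0] by auto
  have "norm (integral {0..pi} (\<lambda>\<theta>. u \<theta> * exp (t * (cos \<theta> - 1)) * osc b k \<theta>)) \<le> K * (pi - 0)"
  proof (rule integral_bound)
    fix \<theta> :: real assume \<theta>: "\<theta> \<in> {0..pi}"
    have "t * (cos \<theta> - 1) \<le> 0" using t by (simp add: mult_nonneg_nonpos)
    then have "\<bar>exp (t * (cos \<theta> - 1))\<bar> \<le> 1" by simp
    then have "\<bar>u \<theta>\<bar> * \<bar>exp (t * (cos \<theta> - 1))\<bar> * \<bar>osc b k \<theta>\<bar> \<le> K * 1 * 1"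
      using K[OF \<theta>] K0 abs_osc_le by (intro mult_mono) auto
    then show "norm (u \<theta> * exp (t * (cos \<theta> - 1)) * osc b k \<theta>) \<le> K" by (simp add: abs_mult)
  qed (auto intro!: continuous_intros u)
  then have "\<bar>Wt b k\<bar> / pi * \<bar>integral {0..pi} (\<lambda>\<theta>. u \<theta> * exp (t * (cos \<theta> - 1)) * osc b k \<theta>)\<bar>
      \<le> 2 / pi * (K * pi)"
    using K0 by (intro mult_mono divide_right_mono) (auto simp: Wt_def)
  then show ?thesis by (simp add: moment_def abs_mult)
qed

text \<open>Coefficient of the moment with index k - 1 in the derivative of the moment with index k,
  hence the rate of the jump from k - 1 up to k. For b = -1/2 it is 1 at k = 1, because
  \<open>Wt\<close> is 1 at index 0 and 2 elsewhere; this is the reflection at the wall.\<close>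

definition down_rate :: "real \<Rightarrow> nat \<Rightarrow> real" where
  "down_rate b k = (if k = 0 then 0 else if k = 1 \<and> b \<noteq> 1/2 then 1 else 1/2)"

text \<open>For b = 1/2 the left neighbour of site 0 would carry
  \<open>sin (- \<theta> / 2) = - sin (\<theta> / 2)\<close>: it folds back to site 0 with a minus
  sign and raises the rate from 1 to 3/2.\<close>

definition exit_rate :: "real \<Rightarrow> nat \<Rightarrow> real" where
  "exit_rate b k = (if k = 0 \<and> b = 1/2 then 3/2 else 1)"

lemma osc_recurrence:
  "Wt b k * ((cos \<theta> - 1) * osc b k \<theta>) =
     1/2 * (Wt b (Suc k) * osc b (Suc k) \<theta>) + down_rate b k * (Wt b (k - 1) * osc b (k - 1) \<theta>)
     - exit_rate b k * (Wt b k * osc b k \<theta>)"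
proof (cases "b = 1/2")
  case True
  have "2 * (cos \<theta> * sin ((real k + 1/2) * \<theta>)) = sin ((real k + 3/2) * \<theta>) + sin ((real k - 1/2) * \<theta>)"
    using sin_add[of "(real k + 1/2) * \<theta>" \<theta>] sin_diff[of "(real k + 1/2) * \<theta>" \<theta>]
    by (simp add: algebra_simps)
  moreover have "sin (- \<theta> / 2) = - sin (\<theta> / 2)" by simp
  ultimately show ?thesis
    using True by (cases k) (auto simp: osc_def Wt_def down_rate_def exit_rate_def algebra_simps)
next
  case False
  have "2 * (cos \<theta> * cos (real k * \<theta>)) = cos ((real k + 1) * \<theta>) + cos ((real k - 1) * \<theta>)"
    using cos_add[of "real k * \<theta>" \<theta>] cos_diff[of "real k * \<theta>" \<theta>]
    by (simp add: algebra_simps)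
  then show ?thesis
    using False
    by (cases k) (auto simp: osc_def Wt_def down_rate_def exit_rate_def algebra_simps)
qed

text \<open>Differentiating the exponential under the integral inserts
  \<open>cos \<theta> - 1\<close>, which \<open>osc_recurrence\<close> expands. At k = 0 the index
  \<open>k - 1\<close> is 0 by truncated subtraction, but its coefficient \<open>down_rate\<close>
  vanishes.\<close>

lemma DERIV_moment:
  assumes u: "continuous_on {0..pi} u"
  shows "((\<lambda>t. moment b u t k) has_real_derivative
    1/2 * moment b u t (Suc k) + down_rate b k * moment b u t (k - 1)
      - exit_rate b k * moment b u t k) (at t)"
proof -
  let ?I = "\<lambda>k. integral {0..pi} (\<lambda>\<theta>. u \<theta> * exp (t * (cos \<theta> - 1)) * osc b k \<theta>)"
  let ?g = "\<lambda>t \<theta>. u \<theta> * ((cos \<theta> - 1) * exp (t * (cos \<theta> - 1))) * osc b k \<theta>"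
  have "((\<lambda>t. integral (cbox 0 pi) (\<lambda>\<theta>. u \<theta> * exp (t * (cos \<theta> - 1)) * osc b k \<theta>)) has_real_derivative
      integral (cbox 0 pi) (?g t)) (at t within UNIV)"
  proof (rule leibniz_rule_field_derivative)
    fix s \<theta> :: real
    show "((\<lambda>t. u \<theta> * exp (t * (cos \<theta> - 1)) * osc b k \<theta>) has_real_derivative ?g s \<theta>) (at s within UNIV)"
      by (auto intro!: derivative_eq_intros)
  next
    show "(\<lambda>\<theta>. u \<theta> * exp (s * (cos \<theta> - 1)) * osc b k \<theta>) integrable_on cbox 0 pi" for s
      using exp_osc_integrable[OF u] by simp
    have us: "continuous_on (UNIV \<times> {0..pi}) (\<lambda>p :: real \<times> real. u (snd p))"
      by (rule continuous_on_compose2[OF u]) (auto intro: continuous_intros)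
    have os: "continuous_on (UNIV \<times> {0..pi}) (\<lambda>p :: real \<times> real. osc b k (snd p))"
      by (rule continuous_on_compose2[OF continuous_on_osc[of "{0..pi}"]]) (auto intro: continuous_intros)
    show "continuous_on (UNIV \<times> cbox 0 pi) (\<lambda>(s, \<theta>). ?g s \<theta>)"
      unfolding case_prod_unfold cbox_interval by (intro continuous_intros us os)
  qed auto
  then have D: "((\<lambda>t. moment b u t k) has_real_derivative Wt b k / pi * integral {0..pi} (?g t)) (at t)"
    unfolding moment_def by (intro DERIV_cmult) simp
  have "Wt b k * integral {0..pi} (?g t) =
     integral {0..pi} (\<lambda>\<theta>. u \<theta> * exp (t * (cos \<theta> - 1)) * (Wt b k * ((cos \<theta> - 1) * osc b k \<theta>)))"
    unfolding integral_mult_right[symmetric] by (rule integral_cong) (simp add: mult_ac)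
  also have "\<dots> = integral {0..pi} (\<lambda>\<theta>.
     (1/2 * Wt b (Suc k)) * (u \<theta> * exp (t * (cos \<theta> - 1)) * osc b (Suc k) \<theta>)
     + (down_rate b k * Wt b (k - 1)) * (u \<theta> * exp (t * (cos \<theta> - 1)) * osc b (k - 1) \<theta>)
     - (exit_rate b k * Wt b k) * (u \<theta> * exp (t * (cos \<theta> - 1)) * osc b k \<theta>))"
    unfolding osc_recurrence by (rule integral_cong) (simp add: algebra_simps)
  also have "\<dots> = (1/2 * Wt b (Suc k)) * ?I (Suc k) + (down_rate b k * Wt b (k - 1)) * ?I (k - 1)
      - (exit_rate b k * Wt b k) * ?I k"
    by (intro integral_unique has_integral_diff has_integral_add has_integral_mult_right
        integrable_integral exp_osc_integrable u)
  finally have e: "Wt b k * integral {0..pi} (?g t) = (1/2 * Wt b (Suc k)) * ?I (Suc k)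
      + (down_rate b k * Wt b (k - 1)) * ?I (k - 1) - (exit_rate b k * Wt b k) * ?I k" .
  have alg: "((1/2 * w1) * x1 + (d * w2) * x2 - (r * w) * x) / p =
      1/2 * (w1 / p * x1) + d * (w2 / p * x2) - r * (w / p * x)" for w1 x1 d w2 x2 r w x p :: real
    by (simp add: add_divide_distrib diff_divide_distrib)
  have "Wt b k / pi * integral {0..pi} (?g t) = Wt b k * integral {0..pi} (?g t) / pi" by simp
  also have "\<dots> = 1/2 * moment b u t (Suc k) + down_rate b k * moment b u t (k - 1)
      - exit_rate b k * moment b u t k"
    unfolding e moment_def by (rule alg)
  finally have "Wt b k / pi * integral {0..pi} (?g t) =
     1/2 * moment b u t (Suc k) + down_rate b k * moment b u t (k - 1) - exit_rate b k * moment b u t k" .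
  with D show ?thesis by simp
qed

lemma integral_cos_int:
  "integral {0..pi} (\<lambda>\<theta>. cos (of_int m * \<theta>)) = (if m = 0 then pi else 0)"
proof (cases "m = 0")
  case False
  have "((\<lambda>\<theta>. cos (of_int m * \<theta>)) has_integral
     (sin (of_int m * pi) / of_int m - sin (of_int m * 0) / of_int m)) {0..pi}"
    using False
    by (intro fundamental_theorem_of_calculus)
       (auto simp: has_real_derivative_iff_has_vector_derivative[symmetric] intro!: derivative_eq_intros)
  then show ?thesis using False
    by (simp add: integral_unique sin_int_times_real sin_integer_2pi mult.commute[of _ pi])
qed simp

text \<open>Product-to-sum formulas reduce this to cosines with integer frequencies m1 and m2. The
  frequency m2 vanishes only if b differs from 1/2 and k = l = 0; there the doubled integral is
  offset by \<open>Wt b 0 = 1\<close>.\<close>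

lemma moment_orthonormal:
  "moment b (\<lambda>\<theta>. (if b = 1/2 then 2 else 1) * osc b l \<theta>) 0 k = (if k = l then 1 else 0)"
proof -
  define m1 m2 where "m1 = int k - int l" and "m2 = int k + int l + (if b = 1/2 then 1 else 0)"
  define c where "c = (if b = 1/2 then 1 else 1/2 :: real)"
  define e where "e = (if b = 1/2 then -1 else 1/2 :: real)"
  have eq: "(if b = 1/2 then 2 else 1) * osc b l \<theta> * osc b k \<theta> =
      c * cos (of_int m1 * \<theta>) + e * cos (of_int m2 * \<theta>)" for \<theta>
  proof (cases "b = 1/2")
    case True
    have "cos (of_int m1 * \<theta>) = cos ((real k + 1/2) * \<theta> - (real l + 1/2) * \<theta>)"
      "cos (of_int m2 * \<theta>) = cos ((real k + 1/2) * \<theta> + (real l + 1/2) * \<theta>)"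
      using True by (auto simp: m1_def m2_def algebra_simps)
    then show ?thesis using True by (simp add: osc_def c_def e_def cos_add cos_diff)
  next
    case False
    have "cos (of_int m1 * \<theta>) = cos (real k * \<theta> - real l * \<theta>)"
      "cos (of_int m2 * \<theta>) = cos (real k * \<theta> + real l * \<theta>)"
      using False by (auto simp: m1_def m2_def algebra_simps)
    then show ?thesis using False by (simp add: osc_def c_def e_def cos_add cos_diff field_simps)
  qed
  have "integral {0..pi} (\<lambda>\<theta>. (if b = 1/2 then 2 else 1) * osc b l \<theta> * osc b k \<theta>) =
      c * integral {0..pi} (\<lambda>\<theta>. cos (of_int m1 * \<theta>)) + e * integral {0..pi} (\<lambda>\<theta>. cos (of_int m2 * \<theta>))"
    unfolding eq
    by (subst integral_add) (auto intro!: integrable_continuous_real continuous_intros)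
  also have "\<dots> = c * (if m1 = 0 then pi else 0) + e * (if m2 = 0 then pi else 0)"
    unfolding integral_cos_int ..
  finally show ?thesis
    by (auto simp: moment_def m1_def m2_def c_def e_def Wt_def split: if_splits)
qed

section \<open>Determinants of moments\<close>

lemma ldet_cong:
  assumes "\<And>i j. i < n \<Longrightarrow> j < n \<Longrightarrow> f i j = g i j"
  shows "ldet n f = ldet n g"
  unfolding ldet_def
proof (rule sum.cong[OF refl])
  fix p assume "p \<in> {p. p permutes {..<n}}"
  then have "p i < n" if "i < n" for i using permutes_in_image[of p "{..<n}" i] that by auto
  then show "of_int (sign p) * (\<Prod>i<n. f i (p i)) = of_int (sign p) * (\<Prod>i<n. g i (p i))"
    using assms by simp
qed

lemma ldet_transpose: "ldet n (\<lambda>i j. f j i) = ldet n f"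
proof -
  let ?P = "{p. p permutes {..<n}}"
  have pr: "(\<Prod>i<n. f (inv p i) i) = (\<Prod>i<n. f i (p i))" if p: "p permutes {..<n}" for p
    using prod.permute[OF p, of "\<lambda>i. f (inv p i) i"] by (simp add: permutes_inverses(2)[OF p])
  have sg: "sign (inv p) = sign p" if p: "p permutes {..<n}" for p
    by (rule sign_inverse) (use p permutation_permutes finite_lessThan in blast)
  have "ldet n (\<lambda>i j. f j i) = (\<Sum>p\<in>?P. of_int (sign (inv p)) * (\<Prod>i<n. f (inv p i) i))"
    unfolding ldet_def by (rule sum_permutations_inverse)
  also have "\<dots> = ldet n f"
    unfolding ldet_def by (rule sum.cong[OF refl]) (simp add: pr sg)
  finally show ?thesis .
qed

text \<open>Composition with the transposition of r and s preserves every product and flips every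
  sign, so the determinant equals its own negative.\<close>

lemma ldet_identical_rows:
  assumes rs: "r < n" "s < n" "r \<noteq> s" and eq: "\<And>j. j < n \<Longrightarrow> f r j = f s j"
  shows "ldet n f = 0"
proof -
  let ?\<tau> = "Transposition.transpose r s" and ?P = "{p. p permutes {..<n}}"
  have \<tau>: "?\<tau> permutes {..<n}" using rs by (intro permutes_swap_id) auto
  have "of_int (sign (p \<circ> ?\<tau>)) * (\<Prod>i<n. f i ((p \<circ> ?\<tau>) i)) = - (of_int (sign p) * (\<Prod>i<n. f i (p i)))"
    if p: "p permutes {..<n}" for p
  proof -
    have pp: "permutation p" "permutation ?\<tau>"
      using p \<tau> permutation_permutes finite_lessThan by blast+
    have "sign (p \<circ> ?\<tau>) = - sign p"
      unfolding sign_compose[OF pp] using rs by (simp add: sign_swap_id)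
    moreover have "(\<Prod>i<n. f i ((p \<circ> ?\<tau>) i)) = (\<Prod>i<n. f i (p i))"
    proof -
      have "(\<Prod>i<n. f i ((p \<circ> ?\<tau>) i)) = (\<Prod>i<n. f (?\<tau> i) (p i))"
        using prod.permute[OF \<tau>, of "\<lambda>i. f (?\<tau> i) (p i)"] by (simp add: comp_def)
      also have "\<dots> = (\<Prod>i<n. f i (p i))"
        using eq rs permutes_in_image[OF p]
        by (intro prod.cong refl) (auto simp: Transposition.transpose_def)
      finally show ?thesis .
    qed
    ultimately show ?thesis by simp
  qed
  then have "(\<Sum>p\<in>?P. of_int (sign (p \<circ> ?\<tau>)) * (\<Prod>i<n. f i ((p \<circ> ?\<tau>) i))) = - ldet n f"
    unfolding ldet_def sum_negf[symmetric] by (intro sum.cong refl) simp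
  then have "ldet n f = - ldet n f"
    using sum_permutations_compose_right[OF \<tau>, of "\<lambda>p. of_int (sign p) * (\<Prod>i<n. f i (p i)) :: real"]
    by (simp only: ldet_def)
  then show ?thesis by simp
qed

lemma ldet_identical_columns:
  assumes "r < n" "s < n" "r \<noteq> s" "\<And>i. i < n \<Longrightarrow> f i r = f i s"
  shows "ldet n f = 0"
  by (subst ldet_transpose[symmetric], rule ldet_identical_rows[of r n s]) (use assms in auto)

lemma ldet_zero_row:
  assumes "r < n" "\<And>j. j < n \<Longrightarrow> f r j = 0"
  shows "ldet n f = 0"
  unfolding ldet_def
proof (rule sum.neutral, rule ballI)
  fix p assume "p \<in> {p. p permutes {..<n}}"
  then have "p r < n" using permutes_in_image[of p "{..<n}" r] assms by auto
  then show "of_int (sign p) * (\<Prod>i<n. f i (p i)) = 0"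
    using assms by (auto intro!: prod_zero)
qed

lemma ldet_zero_column:
  assumes "r < n" "\<And>i. i < n \<Longrightarrow> f i r = 0"
  shows "ldet n f = 0"
  by (subst ldet_transpose[symmetric], rule ldet_zero_row[of r n]) (use assms in auto)

text \<open>A permutation other than the identity has an index i with \<open>p i < i\<close> and
  meets a zero there.\<close>

lemma ldet_upper_unitriangular:
  assumes "\<And>i. i < n \<Longrightarrow> f i i = 1" "\<And>i j. j < i \<Longrightarrow> i < n \<Longrightarrow> f i j = 0"
  shows "ldet n f = 1"
proof -
  have "ldet n f = (\<Sum>p\<in>{id}. of_int (sign p) * (\<Prod>i<n. f i (p i)))"
    unfolding ldet_def
  proof (rule sum.mono_neutral_right)
    show "\<forall>p\<in>{p. p permutes {..<n}} - {id}. of_int (sign p) * (\<Prod>i<n. f i (p i)) = 0"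
    proof
      fix p assume p: "p \<in> {p. p permutes {..<n}} - {id}"
      then have "\<not> (\<forall>i\<in>{..<n}. i \<le> p i)"
        using permutes_natset_ge[of p "{..<n}"] by auto
      then obtain i where i: "i < n" "p i < i" by (auto simp: not_le)
      then show "of_int (sign p) * (\<Prod>i<n. f i (p i)) = 0"
        using assms(2) by (auto intro!: prod_zero)
    qed
  qed (auto simp: finite_permutations permutes_id)
  then show ?thesis using assms(1) by (simp add: sign_id)
qed

lemma abs_ldet_le:
  assumes "\<And>i j. i < n \<Longrightarrow> j < n \<Longrightarrow> \<bar>f i j\<bar> \<le> K"
  shows "\<bar>ldet n f\<bar> \<le> fact n * K ^ n"
proof -
  have "\<bar>of_int (sign p) * (\<Prod>i<n. f i (p i))\<bar> \<le> K ^ n" if p: "p permutes {..<n}" for p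
  proof -
    have "(\<Prod>i<n. \<bar>f i (p i)\<bar>) \<le> (\<Prod>i<n. K)"
      using assms permutes_in_image[OF p] by (intro prod_mono) auto
    moreover have "\<bar>of_int (sign p) :: real\<bar> = 1" by (simp add: sign_def)
    ultimately show ?thesis by (simp add: abs_mult abs_prod)
  qed
  then have "\<bar>ldet n f\<bar> \<le> (\<Sum>p\<in>{p. p permutes {..<n}}. K ^ n)"
    unfolding ldet_def by (intro order.trans[OF sum_abs] sum_mono) auto
  then show ?thesis by (simp add: card_permutations)
qed

lemma DERIV_ldet:
  assumes "\<And>i j. i < n \<Longrightarrow> j < n \<Longrightarrow> ((\<lambda>s. f i j s) has_real_derivative f' i j) (at t)"
  shows "((\<lambda>s. ldet n (\<lambda>i j. f i j s)) has_real_derivative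
    (\<Sum>r<n. ldet n (\<lambda>i j. if i = r then f' i j else f i j t))) (at t)"
proof -
  have in_range: "p i < n" if "p \<in> {p. p permutes {..<n}}" "i \<in> {..<n}" for p i
    using permutes_in_image[of p "{..<n}" i] that by auto
  have "((\<lambda>s. \<Sum>p\<in>{p. p permutes {..<n}}. of_int (sign p) * (\<Prod>i<n. f i (p i) s)) has_real_derivative
    (\<Sum>p\<in>{p. p permutes {..<n}}. of_int (sign p) *
      (\<Sum>r<n. f' r (p r) * (\<Prod>i\<in>{..<n} - {r}. f i (p i) t)))) (at t)"
    by (intro DERIV_sum DERIV_cmult has_field_derivative_prod assms[OF _ in_range]) auto
  also have "(\<Sum>p\<in>{p. p permutes {..<n}}. of_int (sign p) *
      (\<Sum>r<n. f' r (p r) * (\<Prod>i\<in>{..<n} - {r}. f i (p i) t))) =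
      (\<Sum>p\<in>{p. p permutes {..<n}}. \<Sum>r<n. of_int (sign p) *
       (\<Prod>i<n. if i = r then f' i (p i) else f i (p i) t))"
    unfolding sum_distrib_left by (intro sum.cong refl) (simp add: prod.remove)
  finally show ?thesis unfolding ldet_def by (subst sum.swap)
qed

lemma ldet_row_linear:
  assumes r: "r < n"
  shows "ldet n (\<lambda>i j. if i = r then \<alpha> * A j + \<beta> * B j - \<gamma> * C j else f i j) =
     \<alpha> * ldet n (\<lambda>i j. if i = r then A j else f i j) + \<beta> * ldet n (\<lambda>i j. if i = r then B j else f i j)
     - \<gamma> * ldet n (\<lambda>i j. if i = r then C j else f i j)"
proof -
  have *: "(\<Prod>i<n. if i = r then g (p i) else f i (p i)) = g (p r) * (\<Prod>i\<in>{..<n} - {r}. f i (p i))"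
    for g :: "nat \<Rightarrow> real" and p
    using r by (simp add: prod.remove)
  show ?thesis
    unfolding ldet_def *[of "\<lambda>j. \<alpha> * A j + \<beta> * B j - \<gamma> * C j"] *[of A] *[of B] *[of C]
    by (simp add: sum_distrib_left sum.distrib[symmetric] sum_subtractf[symmetric] algebra_simps)
qed

section \<open>Determinants of moments and their time derivative\<close>

definition mdet :: "nat \<Rightarrow> real \<Rightarrow> (nat \<Rightarrow> real \<Rightarrow> real) \<Rightarrow> real \<Rightarrow> (nat \<Rightarrow> nat) \<Rightarrow> real" where
  "mdet n b u t l = ldet n (\<lambda>i j. moment b (u j) t (l i))"

lemma mdet_cong: "(\<And>i. i < n \<Longrightarrow> l i = l' i) \<Longrightarrow> mdet n b u t l = mdet n b u t l'"
  unfolding mdet_def by (rule ldet_cong) auto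

lemma mdet_collision:
  "r < n \<Longrightarrow> s < n \<Longrightarrow> r \<noteq> s \<Longrightarrow> l r = l s \<Longrightarrow> mdet n b u t l = 0"
  unfolding mdet_def by (rule ldet_identical_rows[of r n s]) auto

lemma ldet_moment_row:
  "ldet n (\<lambda>i j. if i = r then moment b (u j) t m else moment b (u j) t (l i)) = mdet n b u t (l(r := m))"
  unfolding mdet_def by (rule ldet_cong) simp

text \<open>Product rule by rows: the determinant evolves as for independent walks, one row moving
  at a time. The positions l are arbitrary, so that vectors with coinciding positions may occur on
  the right.\<close>

lemma DERIV_mdet:
  assumes u: "\<And>j. j < n \<Longrightarrow> continuous_on {0..pi} (u j)"
  shows "((\<lambda>t. mdet n b u t l) has_real_derivative
    (\<Sum>r<n. 1/2 * mdet n b u t (l(r := Suc (l r))) + down_rate b (l r) * mdet n b u t (l(r := l r - 1))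
       - exit_rate b (l r) * mdet n b u t l)) (at t)"
proof -
  let ?f = "\<lambda>i j. moment b (u j) t (l i)"
  let ?f' = "\<lambda>i j. 1/2 * moment b (u j) t (Suc (l i)) + down_rate b (l i) * moment b (u j) t (l i - 1)
      - exit_rate b (l i) * moment b (u j) t (l i)"
  have "((\<lambda>t. mdet n b u t l) has_real_derivative
      (\<Sum>r<n. ldet n (\<lambda>i j. if i = r then ?f' i j else ?f i j))) (at t)"
    unfolding mdet_def by (rule DERIV_ldet) (rule DERIV_moment[OF u])
  moreover have "ldet n (\<lambda>i j. if i = r then ?f' i j else ?f i j) =
      1/2 * mdet n b u t (l(r := Suc (l r))) + down_rate b (l r) * mdet n b u t (l(r := l r - 1))
       - exit_rate b (l r) * mdet n b u t l" if r: "r < n" for r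
  proof -
    have "ldet n (\<lambda>i j. if i = r then ?f' i j else ?f i j) = ldet n (\<lambda>i j. if i = r then ?f' r j else ?f i j)"
      by (rule ldet_cong) simp
    also have "\<dots> = 1/2 * mdet n b u t (l(r := Suc (l r))) + down_rate b (l r) * mdet n b u t (l(r := l r - 1))
       - exit_rate b (l r) * mdet n b u t (l(r := l r))"
      by (rule ldet_row_linear[OF r, of "1/2" "\<lambda>j. moment b (u j) t (Suc (l r))" "down_rate b (l r)"
            "\<lambda>j. moment b (u j) t (l r - 1)" "exit_rate b (l r)" "\<lambda>j. moment b (u j) t (l r)" ?f,
            unfolded ldet_moment_row])
    finally show ?thesis by simp
  qed
  ultimately show ?thesis by simp
qed

section \<open>Configurations, moves of single particles, and the walk killed upon collision\<close>

definition up :: "nat list \<Rightarrow> nat \<Rightarrow> nat list" where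
  "up x k = x[k := Suc (x ! k)]"

definition dn :: "nat list \<Rightarrow> nat \<Rightarrow> nat list" where
  "dn x k = x[k := x ! k - 1]"

text \<open>The distinct particle sites that belong to a weakly decreasing sequence, with the shift
  used in the determinant of \<open>Tpsi\<close>.\<close>

definition pos :: "nat \<Rightarrow> nat list \<Rightarrow> nat \<Rightarrow> nat" where
  "pos n y i = y ! i + (n - 1 - i)"

lemma Jset_iff: "x \<in> Jset n \<longleftrightarrow> length x = n \<and> (\<forall>i. Suc i < n \<longrightarrow> x ! Suc i \<le> x ! i)"
  by (auto simp: Jset_def sorted_wrt_iff_nth_Suc_transp transp_def)

lemma Jset_mono: "x \<in> Jset n \<Longrightarrow> i \<le> j \<Longrightarrow> j < n \<Longrightarrow> x ! j \<le> x ! i"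
  by (cases "i = j") (auto simp: Jset_def sorted_wrt_iff_nth_less)

lemma Jset_length: "x \<in> Jset n \<Longrightarrow> length x = n"
  by (simp add: Jset_def)

lemma length_up [simp]: "length (up x k) = length x" and length_dn [simp]: "length (dn x k) = length x"
  by (simp_all add: up_def dn_def)

lemma nth_up: "i < length x \<Longrightarrow> up x k ! i = (if i = k then Suc (x ! k) else x ! i)"
  by (auto simp: up_def nth_list_update)

lemma nth_dn: "i < length x \<Longrightarrow> dn x k ! i = (if i = k then x ! k - 1 else x ! i)"
  by (auto simp: dn_def nth_list_update)

lemma up_in_Jset: "x \<in> Jset n \<Longrightarrow> k < n \<Longrightarrow> up x k \<in> Jset n \<longleftrightarrow> k = 0 \<or> x ! k < x ! (k - 1)"
  unfolding Jset_iff by (cases k) (auto simp: nth_up le_Suc_eq split: if_splits)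

lemma dn_in_Jset:
  "x \<in> Jset n \<Longrightarrow> k < n \<Longrightarrow> 0 < x ! k \<Longrightarrow> dn x k \<in> Jset n \<longleftrightarrow> Suc k = n \<or> x ! Suc k < x ! k"
  unfolding Jset_iff by (auto simp: nth_dn split: if_splits)

lemma up_dn: "k < length x \<Longrightarrow> 0 < x ! k \<Longrightarrow> up (dn x k) k = x"
  by (simp add: up_def dn_def)

lemma dn_up: "k < length x \<Longrightarrow> dn (up x k) k = x"
  by (simp add: up_def dn_def)

text \<open>Columns list the sources of the jumps into a configuration; on \<open>Jset n\<close> this is the
  generator of \<open>n\<close> independent walks killed upon collision.\<close>

definition level_gen :: "nat \<Rightarrow> real \<Rightarrow> nat list \<Rightarrow> nat list \<Rightarrow> real" where
  "level_gen n b x y =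
     (\<Sum>k<n. if x = up y k then 1/2 else 0)
     + (\<Sum>k<n. if 0 < y ! k \<and> x = dn y k then down_rate b (pos n y k) else 0)
     - (if x = y then \<Sum>k<n. exit_rate b (pos n y k) else 0)"

text \<open>A finite superset of the sources of jumps: \<open>dn y k\<close> is y itself when
  \<open>y ! k = 0\<close>, and members may lie outside \<open>Jset n\<close>.\<close>

definition neighbours :: "nat \<Rightarrow> nat list \<Rightarrow> nat list set" where
  "neighbours n y = insert y (up y ` {..<n} \<union> dn y ` {..<n})"

lemma finite_neighbours: "finite (neighbours n y)"
  by (simp add: neighbours_def)

lemma level_gen_outside:
  assumes "x \<notin> neighbours n y"
  shows "level_gen n b x y = 0"
proof -
  have ne: "x \<noteq> up y k" "x \<noteq> dn y k" if "k < n" for k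
    using assms that by (auto simp: neighbours_def)
  have "(\<Sum>k<n. if x = up y k then 1/2 else 0 :: real) = 0"
    "(\<Sum>k<n. if 0 < y ! k \<and> x = dn y k then down_rate b (pos n y k) else 0) = 0"
    by (rule sum.neutral; use ne in auto)+
  then show ?thesis using assms by (simp add: level_gen_def neighbours_def)
qed

lemma sum_delta_guard:
  fixes u :: "'a \<Rightarrow> real"
  assumes "finite T"
  shows "(\<Sum>x\<in>T. u x * (if P \<and> x = a then w else 0)) = (if P \<and> a \<in> T then u a * w else 0)"
proof -
  have "(\<Sum>x\<in>T. u x * (if P \<and> x = a then w else 0)) = (\<Sum>x\<in>T. if x = a then (if P then u a * w else 0) else 0)"
    by (rule sum.cong) auto
  then show ?thesis using assms by (simp add: sum.delta)
qed

lemma row_act_level_gen: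
  assumes y: "y \<in> Jset n"
  shows "row_act (Jset n) (level_gen n b) u y =
     (\<Sum>k<n. if up y k \<in> Jset n then 1/2 * u (up y k) else 0)
     + (\<Sum>k<n. if 0 < y ! k \<and> dn y k \<in> Jset n then down_rate b (pos n y k) * u (dn y k) else 0)
     - (\<Sum>k<n. exit_rate b (pos n y k)) * u y"
proof -
  let ?T = "neighbours n y \<inter> Jset n"
  have fin: "finite ?T" by (simp add: finite_neighbours)
  have 1: "(\<Sum>x\<in>?T. u x * (\<Sum>k<n. if x = up y k then 1/2 else 0)) =
    (\<Sum>k<n. if up y k \<in> Jset n then 1/2 * u (up y k) else 0)"
    unfolding sum_distrib_left using sum_delta_guard[OF fin, of u True]
    by (subst sum.swap) (auto intro!: sum.cong simp: neighbours_def)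
  have 2: "(\<Sum>x\<in>?T. u x * (\<Sum>k<n. if 0 < y ! k \<and> x = dn y k then down_rate b (pos n y k) else 0)) =
    (\<Sum>k<n. if 0 < y ! k \<and> dn y k \<in> Jset n then down_rate b (pos n y k) * u (dn y k) else 0)"
    unfolding sum_distrib_left
    by (subst sum.swap, unfold sum_delta_guard[OF fin]) (auto intro!: sum.cong simp: neighbours_def)
  have 3: "(\<Sum>x\<in>?T. u x * (if x = y then \<Sum>k<n. exit_rate b (pos n y k) else 0)) =
    (\<Sum>k<n. exit_rate b (pos n y k)) * u y"
    using sum_delta_guard[OF fin, of u True y] y by (simp add: neighbours_def)
  have "row_act (Jset n) (level_gen n b) u y = (\<Sum>x\<in>?T. u x * level_gen n b x y)"
    unfolding row_act_def by (rule infsum_eq_sum_support[OF fin]) (auto simp: level_gen_outside)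
  also have "\<dots> = (\<Sum>x\<in>?T. u x * (\<Sum>k<n. if x = up y k then 1/2 else 0))
     + (\<Sum>x\<in>?T. u x * (\<Sum>k<n. if 0 < y ! k \<and> x = dn y k then down_rate b (pos n y k) else 0))
     - (\<Sum>x\<in>?T. u x * (if x = y then \<Sum>k<n. exit_rate b (pos n y k) else 0))"
    unfolding level_gen_def by (simp only: distrib_left right_diff_distrib sum.distrib sum_subtractf)
  finally show ?thesis unfolding 1 2 3 .
qed

lemma down_rate_bounds: "0 \<le> down_rate b k" "down_rate b k \<le> 1" "k > 0 \<Longrightarrow> 0 < down_rate b k"
  by (auto simp: down_rate_def)

lemma exit_rate_bounds: "0 \<le> exit_rate b k" "exit_rate b k \<le> 3/2"
  by (auto simp: exit_rate_def)

text \<open>The entries at \<open>up y k\<close> add up to at most n/2, those at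
  \<open>dn y k\<close> to at most n, and the diagonal to at most 3n/2.\<close>

lemma column_bounded_level_gen:
  "column_bounded (Jset n) (level_gen n b) (3 * real n)"
proof
  fix y assume y: "y \<in> Jset n"
  have sub: "{x \<in> Jset n. level_gen n b x y \<noteq> 0} \<subseteq> neighbours n y"
    using level_gen_outside by blast
  then show "finite {x \<in> Jset n. level_gen n b x y \<noteq> 0}"
    using finite_neighbours finite_subset by blast
  let ?T = "neighbours n y"
  note delta = sum_delta_guard[OF finite_neighbours, of "\<lambda>_. 1", simplified]
  have "(\<Sum>x\<in>{x \<in> Jset n. level_gen n b x y \<noteq> 0}. \<bar>level_gen n b x y\<bar>) \<le> (\<Sum>x\<in>?T. \<bar>level_gen n b x y\<bar>)"
    using sub finite_neighbours by (intro sum_mono2) auto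
  also have "\<dots> \<le> (\<Sum>x\<in>?T. (\<Sum>k<n. if x = up y k then 1/2 else 0)
     + (\<Sum>k<n. if 0 < y ! k \<and> x = dn y k then down_rate b (pos n y k) else 0)
     + (if x = y then \<Sum>k<n. exit_rate b (pos n y k) else 0))"
  proof (rule sum_mono)
    fix x
    have "0 \<le> (\<Sum>k<n. if x = up y k then 1/2 else 0 :: real)"
      "0 \<le> (\<Sum>k<n. if 0 < y ! k \<and> x = dn y k then down_rate b (pos n y k) else 0)"
      "0 \<le> (\<Sum>k<n. exit_rate b (pos n y k))"
      by (intro sum_nonneg; simp add: down_rate_bounds exit_rate_bounds)+
    then show "\<bar>level_gen n b x y\<bar> \<le> (\<Sum>k<n. if x = up y k then 1/2 else 0)
     + (\<Sum>k<n. if 0 < y ! k \<and> x = dn y k then down_rate b (pos n y k) else 0)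
     + (if x = y then \<Sum>k<n. exit_rate b (pos n y k) else 0)"
      unfolding level_gen_def by auto
  qed
  also have "\<dots> = (\<Sum>x\<in>?T. \<Sum>k<n. if x = up y k then 1/2 else 0)
     + (\<Sum>x\<in>?T. \<Sum>k<n. if 0 < y ! k \<and> x = dn y k then down_rate b (pos n y k) else 0)
     + (\<Sum>x\<in>?T. if x = y then \<Sum>k<n. exit_rate b (pos n y k) else 0)"
    by (simp add: sum.distrib)
  also have "(\<Sum>x\<in>?T. \<Sum>k<n. if x = up y k then 1/2 else 0 :: real) \<le> (\<Sum>k<n. 1/2)"
    by (subst sum.swap, intro sum_mono) (use delta[of True] in simp)
  also have "(\<Sum>x\<in>?T. \<Sum>k<n. if 0 < y ! k \<and> x = dn y k then down_rate b (pos n y k) else 0) \<le> (\<Sum>k<n. 1)"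
    by (subst sum.swap, intro sum_mono) (simp add: delta down_rate_bounds)
  also have "(\<Sum>x\<in>?T. if x = y then \<Sum>k<n. exit_rate b (pos n y k) else 0) = (\<Sum>k<n. exit_rate b (pos n y k))"
    using finite_neighbours by (simp add: sum.delta neighbours_def)
  also have "(\<Sum>k<n. exit_rate b (pos n y k)) \<le> (\<Sum>k<n. 3/2)"
    by (intro sum_mono exit_rate_bounds)
  finally show "(\<Sum>x\<in>{x \<in> Jset n. level_gen n b x y \<noteq> 0}. \<bar>level_gen n b x y\<bar>) \<le> 3 * real n"
    by simp
qed

text \<open>A step out of \<open>Jset n\<close> puts two particles on one site, so the determinant
  has two equal rows and vanishes: the equation of independent walks closes up on
  \<open>Jset n\<close>. The last particle cannot pass below 0 because the coefficient is 0
  there.\<close>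

lemma DERIV_mdet_level:
  assumes u: "\<And>j. j < n \<Longrightarrow> continuous_on {0..pi} (u j)" and y: "y \<in> Jset n"
  shows "((\<lambda>t. mdet n b u t (pos n y)) has_real_derivative
     row_act (Jset n) (level_gen n b) (\<lambda>y. mdet n b u t (pos n y)) y) (at t)"
proof (rule DERIV_cong, rule DERIV_mdet, rule u, assumption)
  let ?l = "pos n y" and ?h = "\<lambda>y. mdet n b u t (pos n y)"
  have len: "length y = n" using y by (rule Jset_length)
  have up: "mdet n b u t (?l(r := Suc (?l r))) = (if up y r \<in> Jset n then ?h (up y r) else 0)"
    if r: "r < n" for r
  proof (cases "up y r \<in> Jset n")
    case True
    have "mdet n b u t (?l(r := Suc (?l r))) = ?h (up y r)"
      by (rule mdet_cong) (use len r in \<open>auto simp: pos_def nth_up\<close>)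
    then show ?thesis using True by simp
  next
    case False
    then have "r \<noteq> 0" "y ! (r - 1) \<le> y ! r" using up_in_Jset[OF y r] by auto
    then obtain k where k: "r = Suc k" "y ! k \<le> y ! r" by (cases r) auto
    have "y ! k = y ! r" using Jset_mono[OF y, of k r] r k by auto
    then have "mdet n b u t (?l(r := Suc (?l r))) = 0"
      using r k(1) by (intro mdet_collision[of r n k]) (auto simp: pos_def)
    then show ?thesis using False by simp
  qed
  have dn: "down_rate b (?l r) * mdet n b u t (?l(r := ?l r - 1)) =
     (if 0 < y ! r \<and> dn y r \<in> Jset n then down_rate b (?l r) * ?h (dn y r) else 0)"
    if r: "r < n" for r
  proof (cases "0 < y ! r \<and> dn y r \<in> Jset n")
    case True
    have "mdet n b u t (?l(r := ?l r - 1)) = ?h (dn y r)"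
      by (rule mdet_cong) (use len r True in \<open>simp add: pos_def nth_dn\<close>)
    then show ?thesis using True by simp
  next
    case False
    show ?thesis
    proof (cases "Suc r = n")
      case True
      with False have "y ! r = 0" using dn_in_Jset[OF y r] by auto
      then show ?thesis using True by (simp add: pos_def down_rate_def)
    next
      case nlast: False
      then have r': "Suc r < n" using r by auto
      \<comment> \<open>Either \<open>y ! r\<close> is 0, and then so is the next entry, or lowering
        it breaks the order. In both cases the lowered particle lands on the next one.\<close>
      have "y ! Suc r = y ! r"
        using False dn_in_Jset[OF y r] Jset_mono[OF y _ r', of r] nlast by (cases "y ! r = 0") auto
      then have "mdet n b u t (?l(r := ?l r - 1)) = 0"
        using r r' by (intro mdet_collision[of r n "Suc r"]) (auto simp: pos_def)
      then show ?thesis using False by auto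
    qed
  qed
  show "(\<Sum>r<n. 1/2 * mdet n b u t (?l(r := Suc (?l r))) + down_rate b (?l r) * mdet n b u t (?l(r := ?l r - 1))
       - exit_rate b (?l r) * mdet n b u t ?l) = row_act (Jset n) (level_gen n b) ?h y"
  proof -
    have "(\<Sum>r<n. 1/2 * mdet n b u t (?l(r := Suc (?l r)))) =
       (\<Sum>r<n. if up y r \<in> Jset n then 1/2 * ?h (up y r) else 0)"
      by (rule sum.cong[OF refl]) (simp add: up del: fun_upd_apply)
    moreover have "(\<Sum>r<n. down_rate b (?l r) * mdet n b u t (?l(r := ?l r - 1))) =
       (\<Sum>r<n. if 0 < y ! r \<and> dn y r \<in> Jset n then down_rate b (?l r) * ?h (dn y r) else 0)"
      by (rule sum.cong[OF refl], rule dn) simp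
    ultimately show ?thesis
      unfolding row_act_level_gen[OF y] sum_subtractf sum.distrib sum_distrib_right by simp
  qed
qed

lemma mdet_bounded:
  assumes u: "\<And>j. j < n \<Longrightarrow> continuous_on {0..pi} (u j)"
  shows "\<exists>K. \<forall>t\<ge>0. \<forall>l. \<bar>mdet n b u t l\<bar> \<le> K"
proof -
  have "\<exists>K. \<forall>\<theta>\<in>{0..pi}. \<bar>u j \<theta>\<bar> \<le> K" if "j < n" for j
  proof -
    have "bounded (u j ` {0..pi})"
      using compact_continuous_image[OF u[OF that]] compact_imp_bounded by blast
    then show ?thesis unfolding bounded_iff by auto
  qed
  then obtain K where K: "\<And>j \<theta>. j < n \<Longrightarrow> \<theta> \<in> {0..pi} \<Longrightarrow> \<bar>u j \<theta>\<bar> \<le> K j" by metis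
  define K' where "K' = (\<Sum>j<n. \<bar>K j\<bar>)"
  have "\<bar>u j \<theta>\<bar> \<le> K'" if "j < n" "\<theta> \<in> {0..pi}" for j \<theta>
  proof -
    have "\<bar>u j \<theta>\<bar> \<le> \<bar>K j\<bar>" using K[OF that] by auto
    also have "\<dots> \<le> K'" unfolding K'_def using that by (intro member_le_sum) auto
    finally show ?thesis .
  qed
  then have "\<bar>mdet n b u t l\<bar> \<le> fact n * (2 * K') ^ n" if "t \<ge> 0" for t l
    unfolding mdet_def using that by (intro abs_ldet_le abs_moment_le u) auto
  then show ?thesis by blast
qed

theorem mdet_evolution:
  assumes u: "\<And>j. j < n \<Longrightarrow> continuous_on {0..pi} (u j)" and y: "y \<in> Jset n" and t: "t \<ge> 0"
  shows "((\<lambda>x. mdet n b u 0 (pos n x) * mexp (Jset n) (level_gen n b) t x y) has_sum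
    mdet n b u t (pos n y)) (Jset n)"
proof -
  interpret column_bounded "Jset n" "level_gen n b" "3 * real n" by (rule column_bounded_level_gen)
  obtain K where "\<And>t l. t \<ge> 0 \<Longrightarrow> \<bar>mdet n b u t l\<bar> \<le> K" using mdet_bounded[of n u b] u by blast
  then show ?thesis
    using forward_equation_solution[of "\<lambda>s y. mdet n b u s (pos n y)" t K y, OF DERIV_mdet_level[OF u] _ y t]
    by blast
qed

section \<open>Transition kernels of the killed walks\<close>

definition level_kernel :: "nat \<Rightarrow> real \<Rightarrow> real \<Rightarrow> nat list \<Rightarrow> nat list \<Rightarrow> real" where
  "level_kernel n b t x y = ldet n (\<lambda>i j. Iint b (\<lambda>x. exp (t * (x - 1))) (pos n x i) (pos n y j))"

text \<open>The factor 2 for b = 1/2 is the one in \<open>weight_cos\<close>. With it the kernel is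
  a determinant of moments whose functions are given by the starting configuration x.\<close>

definition kernel_osc :: "nat \<Rightarrow> real \<Rightarrow> nat list \<Rightarrow> nat \<Rightarrow> real \<Rightarrow> real" where
  "kernel_osc n b x j \<theta> = (if b = 1/2 then 2 else 1) * osc b (pos n x j) \<theta>"

lemma continuous_on_kernel_osc: "continuous_on A (kernel_osc n b x j)"
  unfolding kernel_osc_def[abs_def] by (intro continuous_intros)

lemma level_kernel_eq_mdet:
  "b \<in> {-1/2, 1/2} \<Longrightarrow> level_kernel n b t x y = mdet n b (kernel_osc n b x) t (pos n y)"
  unfolding level_kernel_def mdet_def kernel_osc_def[abs_def]
  by (subst ldet_transpose[symmetric]) (simp only: Iint_eq_moment)

lemma pos_strict_decreasing: "x \<in> Jset n \<Longrightarrow> i < j \<Longrightarrow> j < n \<Longrightarrow> pos n x j < pos n x i"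
  using Jset_mono[of x n i j] by (auto simp: pos_def)

lemma moment_kernel_osc: "moment b (kernel_osc n b x j) 0 k = (if k = pos n x j then 1 else 0)"
  unfolding kernel_osc_def[abs_def] by (rule moment_orthonormal)

text \<open>By orthonormality the entries are 0 or 1. If x and y differ, then at the first index
  where they do, the larger one has a particle on a site that the other does not occupy, which gives
  a zero row or a zero column.\<close>

lemma level_kernel_0:
  assumes b: "b \<in> {-1/2, 1/2}" and x: "x \<in> Jset n" and y: "y \<in> Jset n"
  shows "level_kernel n b 0 x y = (if x = y then 1 else 0)"
proof -
  have eq: "level_kernel n b 0 x y = ldet n (\<lambda>i j. if pos n y i = pos n x j then 1 else 0)"
    by (simp only: level_kernel_eq_mdet[OF b] mdet_def moment_kernel_osc)
  show ?thesis
  proof (cases "x = y")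
    case True
    have "pos n x i \<noteq> pos n x j" if "j < i" "i < n" for i j
      using pos_strict_decreasing[OF x that] by simp
    then show ?thesis unfolding eq using True by (auto intro!: ldet_upper_unitriangular)
  next
    case False
    have len: "length x = n" "length y = n" using x y by (auto intro: Jset_length)
    with False have "\<exists>i. i < n \<and> x ! i \<noteq> y ! i" by (metis nth_equalityI)
    then obtain i where i: "i < n" "x ! i \<noteq> y ! i" and min: "\<And>k. k < i \<Longrightarrow> x ! k = y ! k"
      unfolding exists_least_iff[of "\<lambda>i. i < n \<and> x ! i \<noteq> y ! i"] by fastforce
    \<comment> \<open>Particles before i sit on the same sites in z and w and are strictly further
      right; from i on, the particles of w lie strictly to the left of the i-th one of z.\<close>
    have *: "pos n z i \<noteq> pos n w j"
      if z: "z \<in> Jset n" and w: "w \<in> Jset n" and "w ! i < z ! i" and m: "\<And>k. k < i \<Longrightarrow> z ! k = w ! k" and j: "j < n"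
      for z w j
    proof (cases "j < i")
      case True
      have "pos n z i < pos n z j" using pos_strict_decreasing[OF z True i(1)] .
      also have "\<dots> = pos n w j" using m[OF True] by (simp add: pos_def)
      finally show ?thesis by simp
    next
      case False
      then have "w ! j \<le> w ! i" using Jset_mono[OF w _ j] by simp
      then show ?thesis using False that(3) i(1) j by (simp add: pos_def)
    qed
    show ?thesis
    proof (cases "x ! i < y ! i")
      case True
      then show ?thesis unfolding eq using *[OF y x True] min i False
        by (auto intro!: ldet_zero_row[of i])
    next
      case nl: False
      then have "y ! i < x ! i" using i by auto
      then show ?thesis unfolding eq using *[OF x y] min i False
        by (auto intro!: ldet_zero_column[of i]) metis
    qed
  qed
qed

text \<open>As a function of y the kernel solves the forward equation, and it starts from the unit
  mass at x, so the sum in \<open>mdet_evolution\<close> has a single term. This is a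
  Karlin-McGregor formula.\<close>

theorem level_kernel_eq_mexp:
  assumes b: "b \<in> {-1/2, 1/2}" and x: "x \<in> Jset n" and y: "y \<in> Jset n" and t: "t \<ge> 0"
  shows "level_kernel n b t x y = mexp (Jset n) (level_gen n b) t x y"
proof -
  have "((\<lambda>z. mdet n b (kernel_osc n b x) 0 (pos n z) * mexp (Jset n) (level_gen n b) t z y) has_sum
    mdet n b (kernel_osc n b x) t (pos n y)) (Jset n)"
    by (rule mdet_evolution[OF continuous_on_kernel_osc y t])
  then have "((\<lambda>z. level_kernel n b 0 x z * mexp (Jset n) (level_gen n b) t z y) has_sum
    level_kernel n b t x y) (Jset n)"
    unfolding level_kernel_eq_mdet[OF b] .
  then have "level_kernel n b t x y =
      (\<Sum>\<^sub>\<infinity>z\<in>Jset n. level_kernel n b 0 x z * mexp (Jset n) (level_gen n b) t z y)"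
    by (simp add: infsumI)
  also have "\<dots> = (\<Sum>z\<in>{x}. level_kernel n b 0 x z * mexp (Jset n) (level_gen n b) t z y)"
    by (rule infsum_eq_sum_support) (use x level_kernel_0[OF b x] in auto)
  finally show ?thesis using level_kernel_0[OF b x x] by simp
qed

section \<open>Positivity of the kernels and the link matrices\<close>

lemma level_gen_offdiag_nonneg: "x \<noteq> y \<Longrightarrow> 0 \<le> level_gen n b x y"
  unfolding level_gen_def by (auto intro!: add_nonneg_nonneg sum_nonneg simp: down_rate_bounds)

lemma level_gen_diag_ge: "- (3/2 * real n) \<le> level_gen n b x x"
proof -
  have "(\<Sum>k<n. exit_rate b (pos n x k)) \<le> (\<Sum>k<n. 3/2)" by (intro sum_mono exit_rate_bounds)
  moreover have "0 \<le> (\<Sum>k<n. if x = up x k then 1/2 else 0 :: real)"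
    "0 \<le> (\<Sum>k<n. if 0 < x ! k \<and> x = dn x k then down_rate b (pos n x k) else 0)"
    by (intro sum_nonneg; simp add: down_rate_bounds)+
  ultimately show ?thesis unfolding level_gen_def by simp
qed

lemma level_gen_up_pos:
  assumes "length x = n" "k < n" "0 < x ! k"
  shows "0 < level_gen n b x (dn x k)" and "0 < level_gen n b (dn x k) x"
proof -
  have ne: "x \<noteq> dn x k" using assms nth_dn[of k x k] by force
  have x: "x = up (dn x k) k" using assms by (simp add: up_dn)
  have "0 < (if x = up (dn x k) k then 1/2 else 0 :: real)" using x by simp
  also have "\<dots> \<le> (\<Sum>k'<n. if x = up (dn x k) k' then 1/2 else 0)"
    by (rule member_le_sum) (use assms in auto)
  finally show "0 < level_gen n b x (dn x k)"
    unfolding level_gen_def using ne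
    by (auto intro!: add_pos_nonneg sum_nonneg simp: down_rate_bounds)
  have "0 < down_rate b (pos n x k)" using assms by (intro down_rate_bounds) (simp add: pos_def)
  also have "\<dots> = (if 0 < x ! k \<and> dn x k = dn x k then down_rate b (pos n x k) else 0)" using assms by simp
  also have "\<dots> \<le> (\<Sum>k'<n. if 0 < x ! k' \<and> dn x k = dn x k' then down_rate b (pos n x k') else 0)"
    by (rule member_le_sum) (use assms in \<open>auto simp: down_rate_bounds\<close>)
  finally show "0 < level_gen n b (dn x k) x"
    unfolding level_gen_def using ne
    by (auto intro!: add_nonneg_pos sum_nonneg)
qed

lemma Jset_remove_box:
  assumes x: "x \<in> Jset n" and nz: "x \<noteq> replicate n 0"
  obtains k where "k < n" "0 < x ! k" "dn x k \<in> Jset n"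
proof -
  have len: "length x = n" using x by (rule Jset_length)
  then have "\<exists>k. k < n \<and> 0 < x ! k"
    using nz by (metis gr0I length_replicate nth_equalityI nth_replicate)
  then have ex: "{k. k < n \<and> 0 < x ! k} \<noteq> {}" by auto
  have fin: "finite {k. k < n \<and> 0 < x ! k}" by auto
  \<comment> \<open>The last nonzero entry can be lowered without breaking the order.\<close>
  define k where "k = Max {k. k < n \<and> 0 < x ! k}"
  have k: "k < n" "0 < x ! k" using Max_in[OF fin ex] by (auto simp: k_def)
  have "Suc k = n \<or> x ! Suc k = 0"
    using Max_ge[OF fin, of "Suc k"] k(1) unfolding k_def[symmetric] by force
  then have "dn x k \<in> Jset n" using dn_in_Jset[OF x k] k by auto
  with k show thesis by (rule that)
qed

text \<open>All configurations communicate through the zero configuration, which is reached by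
  removing boxes one at a time; B allows each removal in both directions.\<close>

lemma Jset_connected:
  assumes x: "x \<in> Jset n" and y: "y \<in> Jset n"
    and B: "\<And>x k. x \<in> Jset n \<Longrightarrow> k < n \<Longrightarrow> 0 < x ! k \<Longrightarrow> dn x k \<in> Jset n \<Longrightarrow> B x (dn x k) \<and> B (dn x k) x"
  shows "(\<lambda>x y. x \<in> Jset n \<and> y \<in> Jset n \<and> B x y)\<^sup>*\<^sup>* x y"
proof -
  let ?R = "\<lambda>x y. x \<in> Jset n \<and> y \<in> Jset n \<and> B x y"
  let ?z = "replicate n 0"
  have "?R\<^sup>*\<^sup>* x ?z \<and> ?R\<^sup>*\<^sup>* ?z x" if "x \<in> Jset n" for x
    using that
  proof (induction "sum_list x" arbitrary: x rule: less_induct)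
    case less
    show ?case
    proof (cases "x = ?z")
      case False
      then obtain k where k: "k < n" "0 < x ! k" "dn x k \<in> Jset n"
        using Jset_remove_box[OF less.prems] by blast
      have kl: "k < length x" using k less.prems by (simp add: Jset_length)
      have "sum_list (dn x k) < sum_list x"
        unfolding dn_def sum_list_update[OF kl] using elem_le_sum_list[OF kl] k by simp
      then have IH: "?R\<^sup>*\<^sup>* (dn x k) ?z" "?R\<^sup>*\<^sup>* ?z (dn x k)" using less.hyps k by auto
      have "?R x (dn x k)" "?R (dn x k) x" using B[OF less.prems k] less.prems k by auto
      with IH show ?thesis
        using converse_rtranclp_into_rtranclp[of ?R x "dn x k" ?z] rtranclp.rtrancl_into_rtrancl[of ?R ?z "dn x k" x]
        by blast
    qed simp
  qed
  with x y show ?thesis by (meson rtranclp_trans)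
qed

text \<open>Adding a constant to the diagonal makes the generator nonnegative, and it multiplies the solutions
  of the forward equation by an exponential factor.\<close>

theorem level_kernel_pos:
  assumes b: "b \<in> {-1/2, 1/2}" and x: "x \<in> Jset n" and y: "y \<in> Jset n" and t: "t > 0"
  shows "0 < level_kernel n b t x y"
proof -
  \<comment> \<open>\<open>level_gen_diag_ge\<close> bounds the diagonal from below by -c, so the
    shifted matrix B is nonnegative.\<close>
  define c where "c = 3/2 * real n"
  define B where "B x y = level_gen n b x y + (if x = y then c else 0)" for x y
  interpret G: column_bounded "Jset n" "level_gen n b" "3 * real n" by (rule column_bounded_level_gen)
  have c: "c \<ge> 0" by (simp add: c_def)
  interpret B: column_bounded "Jset n" B "3 * real n + c"
  proof
    fix y assume y: "y \<in> Jset n"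
    let ?T = "insert y {x \<in> Jset n. level_gen n b x y \<noteq> 0}"
    have fin: "finite ?T" using G.finite_column[OF y] by auto
    have sub: "{x \<in> Jset n. B x y \<noteq> 0} \<subseteq> ?T" by (auto simp: B_def)
    show "finite {x \<in> Jset n. B x y \<noteq> 0}" by (rule finite_subset[OF sub fin])
    have "(\<Sum>x\<in>{x \<in> Jset n. B x y \<noteq> 0}. \<bar>B x y\<bar>) \<le> (\<Sum>x\<in>?T. \<bar>B x y\<bar>)"
      by (rule sum_mono2[OF fin sub]) simp
    also have "\<dots> \<le> (\<Sum>x\<in>?T. \<bar>level_gen n b x y\<bar> + (if x = y then c else 0))"
      using c by (intro sum_mono) (auto simp: B_def)
    also have "\<dots> = (\<Sum>x\<in>?T. \<bar>level_gen n b x y\<bar>) + c"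
      using fin by (simp add: sum.distrib sum.delta)
    also have "(\<Sum>x\<in>?T. \<bar>level_gen n b x y\<bar>) = (\<Sum>x\<in>{x \<in> Jset n. level_gen n b x y \<noteq> 0}. \<bar>level_gen n b x y\<bar>)"
      using fin y by (intro sum.mono_neutral_right) auto
    also have "\<dots> \<le> 3 * real n" by (rule G.column_sum_le[OF y])
    finally show "(\<Sum>x\<in>{x \<in> Jset n. B x y \<noteq> 0}. \<bar>B x y\<bar>) \<le> 3 * real n + c" by simp
  qed
  have nonneg: "0 \<le> B x y" for x y
    using level_gen_offdiag_nonneg[of x y n b] level_gen_diag_ge[of n b x] by (auto simp: B_def c_def)
  let ?u = "\<lambda>s y. exp (c * s) * mdet n b (kernel_osc n b x) s (pos n y)"
  have act: "row_act (Jset n) B v y = row_act (Jset n) (level_gen n b) v y + c * v y"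
    if y: "y \<in> Jset n" for v y
  proof -
    let ?T = "insert y {x \<in> Jset n. level_gen n b x y \<noteq> 0}"
    have fin: "finite ?T" "?T \<subseteq> Jset n" using G.finite_column[OF y] y by auto
    have "row_act (Jset n) B v y = (\<Sum>x\<in>?T. v x * B x y)"
      unfolding row_act_def by (rule infsum_eq_sum_support[OF fin]) (auto simp: B_def)
    also have "\<dots> = (\<Sum>x\<in>?T. v x * level_gen n b x y) + (\<Sum>x\<in>?T. if x = y then c * v y else 0)"
      unfolding sum.distrib[symmetric] by (rule sum.cong) (auto simp: B_def algebra_simps)
    also have "(\<Sum>x\<in>?T. v x * level_gen n b x y) = row_act (Jset n) (level_gen n b) v y"
      unfolding row_act_def by (rule infsum_eq_sum_support[OF fin, symmetric]) auto
    finally show ?thesis using fin by (simp add: sum.delta)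
  qed
  obtain K where K: "\<And>t l. t \<ge> 0 \<Longrightarrow> \<bar>mdet n b (kernel_osc n b x) t l\<bar> \<le> K"
    using mdet_bounded[of n "kernel_osc n b x" b] continuous_on_kernel_osc by blast
  have K0: "0 \<le> K" using K[of 0 "\<lambda>_. 0"] by simp
  have "((\<lambda>z. ?u 0 z * mexp (Jset n) B t z y) has_sum ?u t y) (Jset n)"
  proof (rule B.forward_equation_solution)
    fix s y assume y: "y \<in> Jset n"
    show "((\<lambda>s. ?u s y) has_real_derivative row_act (Jset n) B (?u s) y) (at s)"
      unfolding act[OF y]
      by (auto intro!: derivative_eq_intros DERIV_mdet_level[OF continuous_on_kernel_osc y]
          simp: row_act_def infsum_cmult_right' mult.assoc)
  next
    fix s y assume s: "0 \<le> s" "s \<le> t" and y: "y \<in> Jset n"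
    have "exp (c * s) \<le> exp (c * t)" using s c by (simp add: mult_left_mono)
    then have "exp (c * s) * \<bar>mdet n b (kernel_osc n b x) s (pos n y)\<bar> \<le> exp (c * t) * K"
      using K[OF s(1)] K0 by (intro mult_mono) auto
    then show "\<bar>?u s y\<bar> \<le> exp (c * t) * K" by (simp add: abs_mult)
  qed (use y t in auto)
  then have "((\<lambda>z. level_kernel n b 0 x z * mexp (Jset n) B t z y) has_sum exp (c * t) * level_kernel n b t x y) (Jset n)"
    unfolding level_kernel_eq_mdet[OF b] by simp
  then have "exp (c * t) * level_kernel n b t x y =
      (\<Sum>\<^sub>\<infinity>z\<in>Jset n. level_kernel n b 0 x z * mexp (Jset n) B t z y)"
    by (simp add: infsumI)
  also have "\<dots> = (\<Sum>z\<in>{x}. level_kernel n b 0 x z * mexp (Jset n) B t z y)"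
    by (rule infsum_eq_sum_support) (use x level_kernel_0[OF b x] in auto)
  also have "\<dots> = mexp (Jset n) B t x y" using level_kernel_0[OF b x x] by simp
  also have "\<dots> > 0"
  proof (rule B.mexp_pos[OF nonneg x y t], rule Jset_connected[OF x y])
    fix x k assume "x \<in> Jset n" "k < n" "0 < x ! k"
    then have "0 < level_gen n b x (dn x k)" "0 < level_gen n b (dn x k) x"
      using level_gen_up_pos[of x n k b] by (auto simp: Jset_length)
    then show "0 < B x (dn x k) \<and> 0 < B (dn x k) x" using c by (auto simp: B_def)
  qed
  finally show ?thesis by (simp add: zero_less_mult_iff)
qed

text \<open>If x and y interlace, the matrix is upper triangular with unit diagonal. Otherwise the
  first index k that violates the pattern makes the matrix singular: if the diagonal entry fails,
  column k equals column k - 1, or is zero when k = 0; if the entry below it fails, rows k and k + 1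
  coincide.\<close>

lemma ldet_interlacing:
  fixes x y :: "nat \<Rightarrow> int"
  assumes x: "\<And>i j. i < j \<Longrightarrow> j < n \<Longrightarrow> x j < x i" and y: "\<And>i j. i < j \<Longrightarrow> j < n \<Longrightarrow> y j < y i"
  shows "ldet n (\<lambda>i j. if y j < x i then 1 else 0) =
    (if (\<forall>k<n. y k < x k) \<and> (\<forall>k. Suc k < n \<longrightarrow> x (Suc k) \<le> y k) then 1 else 0)"
proof -
  have xm: "x j \<le> x i" if "i \<le> j" "j < n" for i j using x[of i j] that by (cases "i = j") auto
  have ym: "y j \<le> y i" if "i \<le> j" "j < n" for i j using y[of i j] that by (cases "i = j") auto
  let ?f = "\<lambda>i j. if y j < x i then 1 else 0 :: real"
  show ?thesis
  proof (cases "(\<forall>k<n. y k < x k) \<and> (\<forall>k. Suc k < n \<longrightarrow> x (Suc k) \<le> y k)")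
    case True
    have "ldet n ?f = 1"
    proof (rule ldet_upper_unitriangular)
      fix i j assume ij: "j < i" "i < n"
      then have "x i \<le> x (Suc j)" by (intro xm) auto
      also have "\<dots> \<le> y j" using True ij by auto
      finally show "?f i j = 0" by auto
    qed (use True in auto)
    then show ?thesis unfolding if_P[OF True] .
  next
    case False
    define bad where "bad k \<longleftrightarrow> k < n \<and> (x k \<le> y k \<or> (Suc k < n \<and> y k < x (Suc k)))" for k
    have "\<exists>k. bad k" using False unfolding bad_def by (meson Suc_lessD not_le)
    then obtain k where k: "bad k" and min: "\<And>j. j < k \<Longrightarrow> \<not> bad j"
      unfolding exists_least_iff[of bad] by blast
    have "ldet n ?f = 0"
    proof (cases "x k \<le> y k")
      case xy: True
      show ?thesis
      proof (cases k)
        case 0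
        then show ?thesis using k xy xm[of 0] unfolding bad_def
          by (intro ldet_zero_column[of 0]) force+
      next
        case (Suc m)
        have m: "y m < x m" using min[of m] k Suc unfolding bad_def by auto
        show ?thesis
        proof (rule ldet_identical_columns[of m n k])
          fix i assume i: "i < n"
          show "?f i m = ?f i k"
          proof (cases "i \<le> m")
            case True
            then have "x m \<le> x i" "y k < y m" using xm y k Suc unfolding bad_def by auto
            then show ?thesis using m by auto
          next
            case False
            then have "x i \<le> x k" "y k < y m" using xm[of k i] y[of m k] k Suc i unfolding bad_def by auto
            then show ?thesis using xy by auto
          qed
        qed (use k Suc in \<open>auto simp: bad_def\<close>)
      qed
    next
      case xy: False
      then have k': "Suc k < n" "y k < x (Suc k)" using k unfolding bad_def by auto
      show ?thesis
      proof (rule ldet_identical_rows[of k n "Suc k"])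
        fix j assume j: "j < n"
        have lt: "x (Suc k) < x k" using x k' by simp
        show "?f k j = ?f (Suc k) j"
        proof (cases "k \<le> j")
          case True
          then have "y j \<le> y k" using ym j by auto
          then show ?thesis using lt k' by auto
        next
          case False
          then have "x (Suc j) \<le> y j" "x k \<le> x (Suc j)"
            using min[of j] xm[of "Suc j" k] k' unfolding bad_def by auto
          then show ?thesis using lt by auto
        qed
      qed (use k' in auto)
    qed
    then show ?thesis unfolding if_not_P[OF False] .
  qed
qed

lemma ldet_scale_columns: "ldet n (\<lambda>i j. c j * f i j) = (\<Prod>j<n. c j) * ldet n f"
proof -
  have "(\<Prod>i<n. c (p i) * f i (p i)) = (\<Prod>j<n. c j) * (\<Prod>i<n. f i (p i))" if "p permutes {..<n}" for p
    using prod.permute[OF that, of c] by (simp add: prod.distrib comp_def)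
  then show ?thesis
    unfolding ldet_def sum_distrib_left by (intro sum.cong refl) simp
qed

lemma rowidx_eq_pos: "length x = n \<Longrightarrow> i < n \<Longrightarrow> rowidx n x i = int (pos n x i)"
  by (simp add: rowidx_def ent_def pos_def of_nat_diff)

lemma levn_simps: "levn (2 * m) = Suc m" "levn (Suc (2 * m)) = Suc m"
  by (simp_all add: levn_def)

lemma levb_simps: "levb (2 * m) = -1/2" "levb (Suc (2 * m)) = 1/2"
  by (simp_all add: levb_def)

text \<open>What is left of \<open>Lam\<close> without dimensions and constants: an indicator of
  interlacing. The factor 2 for odd i comes from \<open>Tcal\<close> and records that the lowest
  particle of z is off the wall.\<close>

definition link :: "nat \<Rightarrow> nat list \<Rightarrow> nat list \<Rightarrow> real" where
  "link i x z =
    (if prec (i - 1) z x then if odd i \<and> 0 < z ! (levn (i - 1) - 1) then 2 else 1 else 0)"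

definition level_dim :: "nat \<Rightarrow> nat list \<Rightarrow> real" where
  "level_dim i x = dimSO (levb i) (levn i) x"

text \<open>All particles of the lower configuration except the last occupy positive sites, so each
  of them gives a factor 2 in \<open>Tcal\<close>, whatever the configuration.\<close>

definition link_const :: "nat \<Rightarrow> real" where
  "link_const i = (if odd i then 2 ^ (levn i - 1) else 1)"

text \<open>Both link determinants reduce to \<open>ldet_interlacing\<close>: for odd i after taking
  the column factors of \<open>Tcal\<close> out, for even i with an additional virtual
  particle.\<close>

lemma Lam_eq_link:
  assumes i: "i \<ge> 1" and x: "x \<in> Jset (levn i)" and z: "z \<in> Jset (levn (i - 1))"
  shows "Lam i x z = link_const i * (level_dim (i - 1) z / level_dim i x) * link i x z"
proof (cases "odd i")
  case True
  then obtain m where m: "i = Suc (2 * m)" by (metis oddE Suc_eq_plus1)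
  let ?n = "Suc m"
  have xz: "x \<in> Jset ?n" "z \<in> Jset ?n" using x z m by (simp_all add: levn_simps)
  then have len: "length x = ?n" "length z = ?n" by (auto intro: Jset_length)
  \<comment> \<open>\<open>Tcal\<close> is this column factor times a weak inequality between
    integers, which becomes strict after subtracting 1.\<close>
  let ?c = "\<lambda>j. if pos ?n z j = 0 then 1 else 2 :: real"
  have "ldet ?n (\<lambda>r j. Tcal (rowidx ?n x r) (rowidx ?n z j)) =
    ldet ?n (\<lambda>r j. ?c j * (if int (pos ?n z j) - 1 < int (pos ?n x r) then 1 else 0))"
    by (rule ldet_cong) (auto simp: Tcal_def rowidx_eq_pos len)
  also have "\<dots> = (\<Prod>j<?n. ?c j) * ldet ?n (\<lambda>r j. if int (pos ?n z j) - 1 < int (pos ?n x r) then 1 else 0)"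
    by (rule ldet_scale_columns)
  also have "ldet ?n (\<lambda>r j. if int (pos ?n z j) - 1 < int (pos ?n x r) then 1 else 0) =
     (if (\<forall>k<?n. int (pos ?n z k) - 1 < int (pos ?n x k)) \<and>
         (\<forall>k. Suc k < ?n \<longrightarrow> int (pos ?n x (Suc k)) \<le> int (pos ?n z k) - 1) then 1 else 0)"
    using pos_strict_decreasing[OF xz(1)] pos_strict_decreasing[OF xz(2)]
    by (intro ldet_interlacing) auto
  also have "((\<forall>k<?n. int (pos ?n z k) - 1 < int (pos ?n x k)) \<and>
         (\<forall>k. Suc k < ?n \<longrightarrow> int (pos ?n x (Suc k)) \<le> int (pos ?n z k) - 1)) \<longleftrightarrow> prec (i - 1) z x"
    by (auto simp: prec_def m levn_simps pos_def; force)
  also have "(\<Prod>j<?n. ?c j) = 2 ^ m * (if 0 < z ! m then 2 else 1)"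
  proof -
    have "(\<Prod>j<m. ?c j) = (\<Prod>j<m. 2)" by (rule prod.cong) (auto simp: pos_def)
    then show ?thesis by (simp add: pos_def)
  qed
  finally show ?thesis
    using True m by (simp add: Lam_def Tplus_def link_def level_dim_def link_const_def levn_simps levb_simps)
next
  case False
  then obtain k where k: "i = 2 * k" by (auto elim: evenE)
  define m where "m = k - 1"
  have m: "i = Suc (Suc (2 * m))" using k i by (cases k) (simp_all add: m_def)
  let ?n = "Suc (Suc m)"
  have lv: "levn i = ?n" "levn (i - 1) = Suc m" "levb i = -1/2" "levb (i - 1) = 1/2"
    using levn_simps(1)[of "Suc m"] levb_simps(1)[of "Suc m"] by (simp_all add: m levn_simps levb_simps)
  have xz: "x \<in> Jset ?n" "z \<in> Jset (Suc m)" using x z lv by simp_all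
  then have len: "length x = ?n" "length z = Suc m" by (auto intro: Jset_length)
  \<comment> \<open>The lower configuration has one entry less; the value 0 that \<open>ent\<close>
    assigns to the missing one puts the virtual particle at -1, below every site.\<close>
  let ?y = "\<lambda>j. int (ent z j) + int ?n - int j - 2"
  have "ldet ?n (\<lambda>r j. phi (rowidx ?n x r) (?y j)) =
     ldet ?n (\<lambda>r j. if ?y j < int (pos ?n x r) then 1 else 0)"
    by (rule ldet_cong) (simp add: phi_def rowidx_eq_pos len)
  also have "\<dots> = (if (\<forall>k<?n. ?y k < int (pos ?n x k)) \<and>
         (\<forall>k. Suc k < ?n \<longrightarrow> int (pos ?n x (Suc k)) \<le> ?y k) then 1 else 0)"
  proof (rule ldet_interlacing)
    show "?y j < ?y i" if "i < j" "j < ?n" for i j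
      using Jset_mono[OF xz(2), of i j] that by (auto simp: ent_def len)
  qed (use pos_strict_decreasing[OF xz(1)] in auto)
  also have "((\<forall>k<?n. ?y k < int (pos ?n x k)) \<and>
         (\<forall>k. Suc k < ?n \<longrightarrow> int (pos ?n x (Suc k)) \<le> ?y k)) \<longleftrightarrow> prec (i - 1) z x"
  proof -
    have a: "?y k < int (pos ?n x k) \<longleftrightarrow> z ! k \<le> x ! k" if "k < Suc m" for k
      using that by (auto simp: ent_def len pos_def)
    have b: "?y (Suc m) < int (pos ?n x (Suc m))" by (simp add: ent_def len pos_def)
    have c: "int (pos ?n x (Suc k)) \<le> ?y k \<longleftrightarrow> x ! Suc k \<le> z ! k" if "k < Suc m" for k
      using that by (auto simp: ent_def len pos_def)
    have "prec (i - 1) z x \<longleftrightarrow> (\<forall>k<Suc m. x ! Suc k \<le> z ! k \<and> z ! k \<le> x ! k)"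
      unfolding prec_def lv(2) by (simp add: m)
    moreover have "(\<forall>k<?n. ?y k < int (pos ?n x k)) \<longleftrightarrow> (\<forall>k<Suc m. z ! k \<le> x ! k)"
      using a b less_Suc_eq[of _ "Suc m"] by metis
    moreover have "(\<forall>k. Suc k < ?n \<longrightarrow> int (pos ?n x (Suc k)) \<le> ?y k) \<longleftrightarrow> (\<forall>k<Suc m. x ! Suc k \<le> z ! k)"
      using c by (metis Suc_less_eq)
    ultimately show ?thesis by blast
  qed
  finally have "ldet ?n (\<lambda>r j. phi (rowidx ?n x r) (?y j)) = (if prec (i - 1) z x then 1 else 0)" .
  then show ?thesis
    using False by (simp add: Lam_def Tminus_def link_def level_dim_def link_const_def lv
      lv[unfolded One_nat_def])
qed

text \<open>The shifted entries l, like the m, are nonnegative and strictly decreasing, so all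
  quotients of differences of squares are positive.\<close>

lemma dimSO_pos:
  assumes x: "x \<in> Jset n"
  shows "0 < dimSO b n x"
proof -
  define sh where "sh = (if b = 1/2 then 1/2 else 1 :: real)"
  define l where "l = (\<lambda>i. real (x ! i) + real n - real i - sh)"
  define m where "m = (\<lambda>i. real n - real i - sh)"
  have sh: "1/2 \<le> sh" "sh \<le> 1" "b = 1/2 \<longrightarrow> sh = 1/2" by (auto simp: sh_def)
  have pos: "0 < (l i ^ 2 - l j ^ 2) / (m i ^ 2 - m j ^ 2)" if ij: "i < j" "j < n" for i j
  proof -
    have "x ! j \<le> x ! i" using Jset_mono[OF x, of i j] ij by simp
    then have "0 \<le> l j" "l j < l i" "0 \<le> m j" "m j < m i"
      using ij sh by (auto simp: l_def m_def)
    then have "l j ^ 2 < l i ^ 2" "m j ^ 2 < m i ^ 2" by (auto intro: power_strict_mono)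
    then show ?thesis by simp
  qed
  have "0 < l i / m i" if "i < n" "b = 1/2" for i
    using that sh by (auto simp: l_def m_def intro!: divide_pos_pos)
  then have "0 < (\<Prod>i<n. \<Prod>j\<in>{i<..<n}. (l i ^ 2 - l j ^ 2) / (m i ^ 2 - m j ^ 2))
        * (if b = 1/2 then (\<Prod>i<n. l i / m i) else 1)"
    using pos by (auto intro!: mult_pos_pos prod_pos)
  then show ?thesis by (simp only: dimSO_def Let_def l_def m_def sh_def)
qed

lemma level_dim_0: "level_dim 0 x = 1"
  by (simp add: level_dim_def dimSO_def levb_def levn_def Let_def)

section \<open>Jumps of interlacing paths\<close>

text \<open>Indexed by the number of levels alone, so that induction can run through both kinds of
  levels.\<close>

definition paths :: "nat \<Rightarrow> nat list list set" where
  "paths M = {ls. length ls = M \<and> (\<forall>i<M. ls ! i \<in> Jset (levn i))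
      \<and> (\<forall>i. i + 1 < M \<longrightarrow> prec i (ls ! i) (ls ! (i + 1)))}"

text \<open>The data of the move are arguments instead of being hidden by quantifiers, so that one
  and the same move can be followed when a level is appended.\<close>

definition right_move :: "nat \<Rightarrow> nat \<Rightarrow> nat \<Rightarrow> int \<Rightarrow> nat list list \<Rightarrow> nat list list \<Rightarrow> bool" where
  "right_move p q j c lam mu \<longleftrightarrow>
     p \<le> q \<and> j < levn p \<and> moveset {(i, j) | i. p \<le> i \<and> i \<le> q} 1 c lam mu"

definition left_move :: "nat \<Rightarrow> nat \<Rightarrow> nat \<Rightarrow> int \<Rightarrow> nat list list \<Rightarrow> nat list list \<Rightarrow> bool" where
  "left_move p q j c lam mu \<longleftrightarrow>
     p \<le> q \<and> j < levn p \<and> moveset {(i, j + (i - p)) | i. p \<le> i \<and> i \<le> q} (-1) c lam mu"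

definition wall_move :: "nat \<Rightarrow> nat \<Rightarrow> int \<Rightarrow> bool" where
  "wall_move p j c \<longleftrightarrow> levb p = -1/2 \<and> j = levn p - 1 \<and> c = 0"

definition jump :: "nat \<Rightarrow> nat list list \<Rightarrow> nat list list \<Rightarrow> real" where
  "jump M lam mu =
    (if \<exists>p q j c. q < M \<and> right_move p q j c lam mu \<and> wall_move p j c then 1
     else if (\<exists>p q j c. q < M \<and> right_move p q j c lam mu) \<or> (\<exists>p q j c. q < M \<and> left_move p q j c lam mu)
     then 1/2 else 0)"

lemma Paths_eq: "Paths N a = paths (Mlen N a)"
  by (simp add: Paths_def paths_def)

lemma Qoff_eq_jump: "Qoff N a = jump (Mlen N a)"
proof (intro ext)
  fix lam mu
  have 1: "case1 N a lam mu \<longleftrightarrow> (\<exists>p q j c. q < Mlen N a \<and> right_move p q j c lam mu)"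
    unfolding case1_def right_move_def by blast
  have 2: "case2 N a lam mu \<longleftrightarrow> (\<exists>p q j c. q < Mlen N a \<and> left_move p q j c lam mu)"
    unfolding case2_def left_move_def by blast
  have 3: "case1a N a lam mu \<longleftrightarrow>
      (\<exists>p q j c. q < Mlen N a \<and> right_move p q j c lam mu \<and> wall_move p j c)"
    unfolding case1a_def right_move_def wall_move_def by blast
  show "Qoff N a lam mu = jump (Mlen N a) lam mu"
    unfolding Qoff_def jump_def 1 2 3 by auto
qed

section \<open>Jumps of a path after a level has been appended\<close>

definition shaped :: "nat \<Rightarrow> nat list list \<Rightarrow> bool" where
  "shaped M ls \<longleftrightarrow> length ls = M \<and> (\<forall>i<M. length (ls ! i) = levn i)"

lemma paths_shaped: "ls \<in> paths M \<Longrightarrow> shaped M ls"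
  by (auto simp: paths_def shaped_def Jset_def)

lemma shaped_snoc: "shaped (Suc M) (\<beta> @ [x]) \<longleftrightarrow> shaped M \<beta> \<and> length x = levn M"
  by (auto simp: shaped_def nth_append less_Suc_eq)

lemma shaped_last: "shaped (Suc M) \<beta> \<Longrightarrow> length (last \<beta>) = levn M"
  by (cases \<beta> rule: rev_cases) (auto simp: shaped_snoc, simp add: shaped_def)

lemma shaped_eqI:
  assumes "shaped M \<beta>" "shaped M \<pi>" "\<And>i j. i < M \<Longrightarrow> j < levn i \<Longrightarrow> \<beta> ! i ! j = \<pi> ! i ! j"
  shows "\<beta> = \<pi>"
  by (rule nth_equalityI) (use assms in \<open>auto simp: shaped_def intro!: nth_equalityI\<close>)

lemma levn_mono: "i \<le> j \<Longrightarrow> levn i \<le> levn j"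
  by (simp add: levn_def div_le_mono)

lemma moveset_iff:
  "moveset S \<delta> c lam mu \<longleftrightarrow>
    (\<forall>i j. (i, j) \<in> S \<longrightarrow> i < length lam \<and> j < length (lam ! i) \<and> int (lam ! i ! j) = c \<and> int (mu ! i ! j) = c + \<delta>)
    \<and> (\<forall>i j. i < length lam \<longrightarrow> j < length (lam ! i) \<longrightarrow> (i, j) \<notin> S \<longrightarrow> lam ! i ! j = mu ! i ! j)"
  unfolding moveset_def by (simp only: Ball_def split_paired_All prod.case) blast

lemma moveset_snoc:
  assumes "length \<beta> = M" "length \<pi> = M"
  shows "moveset S \<delta> c (\<beta> @ [x]) (\<pi> @ [y]) \<longleftrightarrow>
    moveset {s\<in>S. fst s < M} \<delta> c \<beta> \<pi> \<and> (\<forall>i j. (i, j) \<in> S \<longrightarrow> i \<le> M)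
    \<and> (\<forall>j. (M, j) \<in> S \<longrightarrow> j < length x \<and> int (x ! j) = c \<and> int (y ! j) = c + \<delta>)
    \<and> (\<forall>j<length x. (M, j) \<notin> S \<longrightarrow> x ! j = y ! j)"
proof -
  have top: "(\<beta> @ [x]) ! M = x" "(\<pi> @ [y]) ! M = y" using assms by (auto simp: nth_append)
  have low: "(\<beta> @ [x]) ! i = \<beta> ! i" "(\<pi> @ [y]) ! i = \<pi> ! i" if "i < M" for i
    using assms that by (auto simp: nth_append)
  have len: "length (\<beta> @ [x]) = Suc M" using assms by simp
  have mem: "(i, j) \<in> {s\<in>S. fst s < M} \<longleftrightarrow> (i, j) \<in> S \<and> i < M" for i j by simp
  let ?P = "\<lambda>lam mu i j. j < length (lam ! i) \<and> int (lam ! i ! j) = c \<and> int (mu ! i ! j) = c + \<delta>"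
  let ?Q = "\<lambda>lam mu i j. j < length (lam ! i) \<longrightarrow> (i, j) \<notin> S \<longrightarrow> lam ! i ! j = mu ! i ! (j :: nat)"
  have split1: "(\<forall>i j. (i, j) \<in> S \<longrightarrow> i < Suc M \<and> P i j) \<longleftrightarrow>
      (\<forall>i j. (i, j) \<in> S \<longrightarrow> i \<le> M) \<and> (\<forall>j. (M, j) \<in> S \<longrightarrow> P M j) \<and> (\<forall>i j. (i, j) \<in> S \<and> i < M \<longrightarrow> P i j)" for P
    by (metis less_Suc_eq less_Suc_eq_le)
  have split2: "(\<forall>i j. i < Suc M \<longrightarrow> Q i j) \<longleftrightarrow> (\<forall>j. Q M j) \<and> (\<forall>i j. i < M \<longrightarrow> Q i j)" for Q
    by (metis less_Suc_eq)
  have P: "?P (\<beta> @ [x]) (\<pi> @ [y]) i j \<longleftrightarrow> ?P \<beta> \<pi> i j" and Q: "?Q (\<beta> @ [x]) (\<pi> @ [y]) i j \<longleftrightarrow> ?Q \<beta> \<pi> i j"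
    if "i < M" for i j using low[OF that] by simp_all
  have "moveset S \<delta> c (\<beta> @ [x]) (\<pi> @ [y]) \<longleftrightarrow>
     (\<forall>i j. (i, j) \<in> S \<longrightarrow> i < Suc M \<and> ?P (\<beta> @ [x]) (\<pi> @ [y]) i j)
     \<and> (\<forall>i j. i < Suc M \<longrightarrow> ?Q (\<beta> @ [x]) (\<pi> @ [y]) i j)"
    unfolding moveset_iff len ..
  also have "\<dots> \<longleftrightarrow> ((\<forall>i j. (i, j) \<in> S \<longrightarrow> i \<le> M) \<and> (\<forall>j. (M, j) \<in> S \<longrightarrow> ?P (\<beta> @ [x]) (\<pi> @ [y]) M j)
      \<and> (\<forall>i j. (i, j) \<in> S \<and> i < M \<longrightarrow> ?P \<beta> \<pi> i j))
     \<and> ((\<forall>j. ?Q (\<beta> @ [x]) (\<pi> @ [y]) M j) \<and> (\<forall>i j. i < M \<longrightarrow> ?Q \<beta> \<pi> i j))"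
    unfolding split1 split2 using P Q by simp
  also have "\<dots> \<longleftrightarrow> moveset {s\<in>S. fst s < M} \<delta> c \<beta> \<pi> \<and> (\<forall>i j. (i, j) \<in> S \<longrightarrow> i \<le> M)
    \<and> (\<forall>j. (M, j) \<in> S \<longrightarrow> j < length x \<and> int (x ! j) = c \<and> int (y ! j) = c + \<delta>)
    \<and> (\<forall>j<length x. (M, j) \<notin> S \<longrightarrow> x ! j = y ! j)"
    unfolding moveset_iff top assms mem by blast
  finally show ?thesis .
qed

lemma moveset_empty:
  assumes "shaped M \<beta>" "shaped M \<pi>"
  shows "moveset {} \<delta> c \<beta> \<pi> \<longleftrightarrow> \<beta> = \<pi>"
  using shaped_eqI[OF assms] assms by (auto simp: moveset_iff shaped_def)

lemma eq_up_iff: "length x = n \<Longrightarrow> length y = n \<Longrightarrow> j < n \<Longrightarrow>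
    y = up x j \<longleftrightarrow> y ! j = Suc (x ! j) \<and> (\<forall>i<n. i \<noteq> j \<longrightarrow> x ! i = y ! i)"
  by (auto simp: nth_up intro!: nth_equalityI)

lemma eq_dn_iff: "length x = n \<Longrightarrow> length y = n \<Longrightarrow> j < n \<Longrightarrow> 0 < x ! j \<Longrightarrow>
    y = dn x j \<longleftrightarrow> x ! j = Suc (y ! j) \<and> (\<forall>i<n. i \<noteq> j \<longrightarrow> x ! i = y ! i)"
  by (auto simp: nth_dn intro!: nth_equalityI)

text \<open>One particle moves on each level of a chain, and f selects its index: constant for right
  moves, growing with the level for left moves. A chain that reaches the new level either starts
  there, leaving the lower levels unchanged, or extends a chain that ends one level below.\<close>

lemma moveset_chain_snoc:
  fixes f :: "nat \<Rightarrow> nat"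
  defines "S \<equiv> \<lambda>p q. {(i, f i) | i. p \<le> i \<and> i \<le> q}"
  assumes sh: "shaped M \<beta>" "shaped M \<pi>" and len: "length x = levn M" "length y = levn M" and pq: "p \<le> q"
  shows "moveset (S p q) \<delta> c (\<beta> @ [x]) (\<pi> @ [y]) \<longleftrightarrow>
     (q < M \<and> moveset (S p q) \<delta> c \<beta> \<pi> \<and> x = y)
     \<or> (q = M \<and> (if p = M then \<beta> = \<pi> else moveset (S p (M - 1)) \<delta> c \<beta> \<pi>) \<and> f M < levn M
         \<and> int (x ! f M) = c \<and> int (y ! f M) = c + \<delta> \<and> (\<forall>i<levn M. i \<noteq> f M \<longrightarrow> x ! i = y ! i))"
proof -
  have ln: "length \<beta> = M" "length \<pi> = M" using sh by (auto simp: shaped_def)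
  have mem: "(i, j) \<in> S p q \<longleftrightarrow> p \<le> i \<and> i \<le> q \<and> j = f i" for i j p q by (auto simp: S_def)
  have B: "(\<forall>i j. (i, j) \<in> S p q \<longrightarrow> i \<le> M) \<longleftrightarrow> q \<le> M" unfolding mem using pq le_trans by blast
  note ms = moveset_snoc[OF ln, of "S p q" \<delta> c x y, unfolded B]
  have xy: "(\<forall>j<levn M. x ! j = y ! j) \<longleftrightarrow> x = y" using len by (metis nth_equalityI)
  consider "q < M" | "q > M" | "q = M" by linarith
  then show ?thesis
  proof cases
    case 1
    then have "{s \<in> S p q. fst s < M} = S p q" by (auto simp: S_def)
    moreover have "(M, j) \<notin> S p q" for j using 1 by (simp add: mem)
    ultimately have "moveset (S p q) \<delta> c (\<beta> @ [x]) (\<pi> @ [y]) \<longleftrightarrow> moveset (S p q) \<delta> c \<beta> \<pi> \<and> x = y"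
      unfolding ms len using 1 xy by simp
    then show ?thesis using 1 by simp
  next
    case 2
    then show ?thesis unfolding ms by simp
  next
    case 3
    have top: "(M, j) \<in> S p q \<longleftrightarrow> j = f M" for j using 3 pq by (simp add: mem)
    have low: "moveset {s \<in> S p q. fst s < M} \<delta> c \<beta> \<pi> \<longleftrightarrow>
        (if p = M then \<beta> = \<pi> else moveset (S p (M - 1)) \<delta> c \<beta> \<pi>)"
    proof (cases "p = M")
      case True
      then have S0: "{s \<in> S p q. fst s < M} = {}" by (auto simp: S_def)
      show ?thesis unfolding S0 using True moveset_empty[OF sh] by simp
    next
      case False
      then have "{s \<in> S p q. fst s < M} = S p (M - 1)" using 3 pq by (auto simp: S_def)
      then show ?thesis using False by simp
    qed
    have "\<not> q < M" "q \<le> M" using 3 by simp_all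
    then show ?thesis unfolding ms top low len using 3 by (simp only: simp_thms conj_assoc)
  qed
qed

lemma right_move_snoc:
  assumes sh: "shaped M \<beta>" "shaped M \<pi>" and len: "length x = levn M" "length y = levn M"
  shows "right_move p q j c (\<beta> @ [x]) (\<pi> @ [y]) \<longleftrightarrow>
     (q < M \<and> right_move p q j c \<beta> \<pi> \<and> x = y)
     \<or> (q = M \<and> (if p = M then \<beta> = \<pi> else right_move p (M - 1) j c \<beta> \<pi>) \<and> p \<le> M \<and> j < levn p
         \<and> int (x ! j) = c \<and> y = up x j)"
proof (cases "p \<le> q \<and> j < levn p")
  case True
  let ?S = "\<lambda>q. {(i, j) | i. p \<le> i \<and> i \<le> q}"
  have rm: "right_move p q j c L L' \<longleftrightarrow> moveset (?S q) 1 c L L'" if "p \<le> q" for q L L'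
    using True that unfolding right_move_def by blast
  have pq: "p \<le> q" using True by simp
  note chain = moveset_chain_snoc[OF sh len pq, of "\<lambda>_. j" 1 c]
  show ?thesis
  proof (cases "q = M")
    case qM: True
    have jl: "j < levn M" using True qM levn_mono[of p M] by simp
    have e: "int (x ! j) = c \<and> int (y ! j) = c + 1 \<and> (\<forall>i<levn M. i \<noteq> j \<longrightarrow> x ! i = y ! i) \<longleftrightarrow>
        int (x ! j) = c \<and> y = up x j"
      unfolding eq_up_iff[OF len jl] by auto
    have low: "right_move p (M - 1) j c \<beta> \<pi> \<longleftrightarrow> moveset (?S (M - 1)) 1 c \<beta> \<pi>" if "p \<noteq> M"
      using that pq qM by (intro rm) simp
    show ?thesis unfolding rm[OF pq] chain e using True qM jl low by (cases "p = M") simp_all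
  next
    case False
    then show ?thesis unfolding rm[OF pq] chain by (simp only: simp_thms)
  qed
qed (auto simp: right_move_def)

lemma left_move_snoc:
  assumes sh: "shaped M \<beta>" "shaped M \<pi>" and len: "length x = levn M" "length y = levn M"
  shows "left_move p q j c (\<beta> @ [x]) (\<pi> @ [y]) \<longleftrightarrow>
     (q < M \<and> left_move p q j c \<beta> \<pi> \<and> x = y)
     \<or> (q = M \<and> (if p = M then \<beta> = \<pi> else left_move p (M - 1) j c \<beta> \<pi>) \<and> p \<le> M \<and> j < levn p
         \<and> j + (M - p) < levn M \<and> int (x ! (j + (M - p))) = c \<and> 0 < c \<and> y = dn x (j + (M - p)))"
proof (cases "p \<le> q \<and> j < levn p")
  case True
  let ?S = "\<lambda>q. {(i, j + (i - p)) | i. p \<le> i \<and> i \<le> q}"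
  have lm: "left_move p q j c L L' \<longleftrightarrow> moveset (?S q) (-1) c L L'" if "p \<le> q" for q L L'
    using True that unfolding left_move_def by blast
  have pq: "p \<le> q" using True by simp
  note chain = moveset_chain_snoc[OF sh len pq, of "\<lambda>i. j + (i - p)" "-1" c]
  show ?thesis
  proof (cases "q = M")
    case qM: True
    let ?k = "j + (M - p)"
    \<comment> \<open>Entries are natural numbers, so the target value c - 1 forces
      \<open>0 < c\<close>.\<close>
    have e: "?k < levn M \<and> int (x ! ?k) = c \<and> int (y ! ?k) = c + - 1 \<and> (\<forall>i<levn M. i \<noteq> ?k \<longrightarrow> x ! i = y ! i) \<longleftrightarrow>
        ?k < levn M \<and> int (x ! ?k) = c \<and> 0 < c \<and> y = dn x ?k"
    proof (cases "?k < levn M")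
      case k: True
      show ?thesis
      proof (cases "0 < x ! ?k")
        case True
        show ?thesis unfolding eq_dn_iff[OF len k True] using k True by auto
      next
        case False
        then have "int (x ! ?k) = 0" "0 \<le> int (y ! ?k)" by simp_all
        then show ?thesis by linarith
      qed
    qed simp
    have low: "left_move p (M - 1) j c \<beta> \<pi> \<longleftrightarrow> moveset (?S (M - 1)) (-1) c \<beta> \<pi>" if "p \<noteq> M"
      using that pq qM by (intro lm) simp
    show ?thesis unfolding lm[OF pq] chain e using True qM low by (cases "p = M") simp_all
  next
    case False
    then show ?thesis unfolding lm[OF pq] chain by (simp only: simp_thms)
  qed
qed (auto simp: left_move_def)

text \<open>Rates of jumps confined to the level with index M. Blocking by the level below is not
  part of it; it enters through the restriction to interlacing configurations.\<close>

definition top_jump :: "nat \<Rightarrow> nat list \<Rightarrow> nat list \<Rightarrow> real" where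
  "top_jump M x y =
    (if \<exists>k<levn M. y = up x k \<and> even M \<and> k = levn M - 1 \<and> x ! k = 0 then 1
     else if (\<exists>k<levn M. y = up x k) \<or> (\<exists>k<levn M. 0 < x ! k \<and> y = dn x k) then 1/2 else 0)"

text \<open>\<open>pushed M z b x y\<close>: when the particles of level \<open>M\<close> move from \<open>z\<close> to \<open>b\<close>, the particle of
  level \<open>M + 1\<close> that is in contact with the moving one is pushed, which turns \<open>x\<close> into \<open>y\<close>.\<close>

definition pushed :: "nat \<Rightarrow> nat list \<Rightarrow> nat list \<Rightarrow> nat list \<Rightarrow> nat list \<Rightarrow> bool" where
  "pushed M z b x y \<longleftrightarrow>
     (\<exists>k<levn M. b = up z k \<and> x ! k = z ! k \<and> y = up x k)
     \<or> (\<exists>k<levn M. Suc k < levn (Suc M) \<and> 0 < z ! k \<and> b = dn z k \<and> x ! Suc k = z ! k \<and> y = dn x (Suc k))"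

lemma levb_even: "levb p = -1/2 \<longleftrightarrow> even p"
  by (simp add: levb_def)

text \<open>A chain passing through lower levels would change them, so a move that leaves them fixed
  starts at the top.\<close>

lemma jump_snoc_same:
  assumes sh: "shaped M \<pi>" and len: "length x = levn M" "length y = levn M"
  shows "jump (Suc M) (\<pi> @ [x]) (\<pi> @ [y]) = (if x = y then 0 else top_jump M x y)"
proof -
  have nr: "\<not> right_move p q j c \<pi> \<pi>" and nl: "\<not> left_move p q j c \<pi> \<pi>" for p q j c
    by (auto simp: right_move_def left_move_def moveset_iff)
  have up: "up x j \<noteq> x" if "j < levn M" for j using that len by (auto dest!: arg_cong[of _ _ "\<lambda>z. z ! j"] simp: nth_up)
  have dn: "dn x j \<noteq> x" if "j < levn M" "0 < x ! j" for j
    using that len by (auto dest!: arg_cong[of _ _ "\<lambda>z. z ! j"] simp: nth_dn)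
  have r: "q < Suc M \<and> right_move p q j c (\<pi> @ [x]) (\<pi> @ [y]) \<longleftrightarrow>
      q = M \<and> p = M \<and> j < levn M \<and> int (x ! j) = c \<and> y = up x j" for p q j c
    unfolding right_move_snoc[OF sh sh len] using nr by auto
  have l: "q < Suc M \<and> left_move p q j c (\<pi> @ [x]) (\<pi> @ [y]) \<longleftrightarrow>
      q = M \<and> p = M \<and> j < levn M \<and> int (x ! j) = c \<and> 0 < x ! j \<and> y = dn x j" for p q j c
    unfolding left_move_snoc[OF sh sh len] using nl by auto
  have w: "(\<exists>p q j c. (q < Suc M \<and> right_move p q j c (\<pi> @ [x]) (\<pi> @ [y])) \<and> wall_move p j c) \<longleftrightarrow>
     (\<exists>k<levn M. y = up x k \<and> even M \<and> k = levn M - 1 \<and> x ! k = 0)"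
    unfolding r wall_move_def levb_even by auto
  have "jump (Suc M) (\<pi> @ [x]) (\<pi> @ [y]) = top_jump M x y"
    unfolding jump_def top_jump_def w[unfolded conj_assoc] r l by auto
  moreover have "top_jump M x y = 0" if "x = y"
    unfolding top_jump_def using that up dn by metis
  ultimately show ?thesis by simp
qed

lemma right_move_last:
  assumes "shaped (Suc M) \<beta>" "shaped (Suc M) \<pi>" "right_move p q j c \<beta> \<pi>" "q < Suc M"
  shows "(q < M \<and> last \<pi> = last \<beta>) \<or> (q = M \<and> j < levn M \<and> int (last \<beta> ! j) = c \<and> last \<pi> = up (last \<beta>) j)"
proof -
  have "\<beta> \<noteq> []" "\<pi> \<noteq> []" using assms by (auto simp: shaped_def)
  then obtain \<beta>' x \<pi>' y where e: "\<beta> = \<beta>' @ [x]" "\<pi> = \<pi>' @ [y]" by (metis append_butlast_last_id)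
  have sh: "shaped M \<beta>'" "shaped M \<pi>'" and len: "length x = levn M" "length y = levn M"
    using assms(1,2) unfolding e shaped_snoc by auto
  note m = assms(3)[unfolded e right_move_snoc[OF sh len]]
  show ?thesis
  proof (cases "q = M")
    case True
    with m have m: "p \<le> M" "j < levn p" "int (x ! j) = c \<and> y = up x j" by simp_all
    have "j < levn M" using m levn_mono[of p M] by simp
    with m True show ?thesis by (simp add: e)
  next
    case False
    with m have "x = y" by simp
    with False assms(4) show ?thesis by (simp add: e)
  qed
qed

lemma left_move_last:
  assumes "shaped (Suc M) \<beta>" "shaped (Suc M) \<pi>" "left_move p q j c \<beta> \<pi>" "q < Suc M"
  shows "(q < M \<and> last \<pi> = last \<beta>) \<or>
    (q = M \<and> p \<le> M \<and> j + (M - p) < levn M \<and> int (last \<beta> ! (j + (M - p))) = c \<and> 0 < c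
      \<and> last \<pi> = dn (last \<beta>) (j + (M - p)))"
proof -
  have "\<beta> \<noteq> []" "\<pi> \<noteq> []" using assms by (auto simp: shaped_def)
  then obtain \<beta>' x \<pi>' y where e: "\<beta> = \<beta>' @ [x]" "\<pi> = \<pi>' @ [y]" by (metis append_butlast_last_id)
  have sh: "shaped M \<beta>'" "shaped M \<pi>'" and len: "length x = levn M" "length y = levn M"
    using assms(1,2) unfolding e shaped_snoc by auto
  note m = assms(3)[unfolded e left_move_snoc[OF sh len]]
  show ?thesis
  proof (cases "q = M")
    case True
    with m True show ?thesis unfolding e last_snoc by blast
  next
    case False
    with m have "x = y" by simp
    with False assms(4) show ?thesis by (simp add: e)
  qed
qed

lemma up_inject: "k < length z \<Longrightarrow> k' < length z \<Longrightarrow> up z k = up z k' \<longleftrightarrow> k = k'"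
  by (auto dest!: arg_cong[of _ _ "\<lambda>x. x ! k"] simp: nth_up split: if_splits)

lemma dn_inject: "k < length z \<Longrightarrow> k' < length z \<Longrightarrow> 0 < z ! k \<Longrightarrow> dn z k = dn z k' \<longleftrightarrow> k = k'"
  by (auto dest!: arg_cong[of _ _ "\<lambda>x. x ! k"] simp: nth_dn split: if_splits)

lemma up_neq_dn: "k < length z \<Longrightarrow> up z k \<noteq> dn z k'"
  by (auto dest!: arg_cong[of _ _ "\<lambda>x. x ! k"] simp: nth_up nth_dn split: if_splits)

lemma up_neq_self: "k < length z \<Longrightarrow> up z k \<noteq> z"
  by (auto dest!: arg_cong[of _ _ "\<lambda>x. x ! k"] simp: nth_up)

lemma dn_neq_self: "k < length z \<Longrightarrow> 0 < z ! k \<Longrightarrow> dn z k \<noteq> z"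
  by (auto dest!: arg_cong[of _ _ "\<lambda>x. x ! k"] simp: nth_dn)

lemma jump_snoc_eq:
  assumes sh: "shaped M \<beta>" "shaped M \<pi>" and len: "length x = levn M" and ne: "\<beta> \<noteq> \<pi>"
  shows "jump (Suc M) (\<beta> @ [x]) (\<pi> @ [x]) = jump M \<beta> \<pi>"
proof -
  have r: "q < Suc M \<and> right_move p q j c (\<beta> @ [x]) (\<pi> @ [x]) \<longleftrightarrow> q < M \<and> right_move p q j c \<beta> \<pi>" for p q j c
    unfolding right_move_snoc[OF sh len len] using ne up_neq_self[of j x, symmetric] levn_mono[of p M] len by auto
  have l: "q < Suc M \<and> left_move p q j c (\<beta> @ [x]) (\<pi> @ [x]) \<longleftrightarrow> q < M \<and> left_move p q j c \<beta> \<pi>" for p q j c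
    unfolding left_move_snoc[OF sh len len] using ne dn_neq_self[of "j + (M - p)" x, symmetric] len by auto
  show ?thesis unfolding jump_def conj_assoc[symmetric] r l ..
qed

text \<open>If both the lower path and the new level change, a single chain runs through both: the
  lower chain ends at its top level and is extended by one particle, which is what
  \<open>pushed\<close> expresses. The rate is unchanged, since \<open>wall_move\<close> depends
  only on the start of the chain.\<close>

lemma jump_snoc_neq:
  assumes sh: "shaped (Suc M) \<beta>" "shaped (Suc M) \<pi>"
    and len: "length x = levn (Suc M)" "length y = levn (Suc M)" and ne: "\<beta> \<noteq> \<pi>" "x \<noteq> y"
  shows "jump (Suc (Suc M)) (\<beta> @ [x]) (\<pi> @ [y]) =
    (if pushed M (last \<beta>) (last \<pi>) x y then jump (Suc M) \<beta> \<pi> else 0)"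
proof -
  let ?z = "last \<beta>" and ?b = "last \<pi>"
  have lz: "length ?z = levn M" using shaped_last[OF sh(1)] .
  have lm: "levn M \<le> levn (Suc M)" by (rule levn_mono) simp
  let ?P = "pushed M ?z ?b x y"
  have r: "(\<exists>q. q < Suc (Suc M) \<and> right_move p q j c (\<beta> @ [x]) (\<pi> @ [y])) \<longleftrightarrow>
      ?P \<and> (\<exists>q. q < Suc M \<and> right_move p q j c \<beta> \<pi>)" (is "?L \<longleftrightarrow> ?R") for p j c
  proof
    assume ?L
    then have p: "p \<le> M" and m: "right_move p M j c \<beta> \<pi>" and j: "j < levn p" and x: "int (x ! j) = c" "y = up x j"
      unfolding right_move_snoc[OF sh len] using ne by (auto split: if_splits)
    have "j < levn M" "int (?z ! j) = c" "?b = up ?z j" using right_move_last[OF sh m] by auto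
    then have ?P unfolding pushed_def using x by auto
    then show ?R using m by auto
  next
    assume R: ?R
    then obtain q where q: "q < Suc M" "right_move p q j c \<beta> \<pi>" by auto
    have lr: "(q < M \<and> ?b = ?z) \<or> (q = M \<and> j < levn M \<and> int (?z ! j) = c \<and> ?b = up ?z j)"
      using right_move_last[OF sh q(2,1)] .
    from R have ?P ..
    then show ?L unfolding pushed_def
    proof (elim disjE exE conjE)
      fix k assume k: "k < levn M" "?b = up ?z k" "x ! k = ?z ! k" "y = up x k"
      then have "q = M" "j = k" "int (?z ! j) = c"
        using lr up_neq_self[of k ?z] up_inject[of k ?z j] lz by auto
      then have "right_move p (Suc M) j c (\<beta> @ [x]) (\<pi> @ [y])"
        unfolding right_move_snoc[OF sh len] using k q by (auto simp: right_move_def)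
      then show ?thesis by blast
    next
      fix k assume k: "k < levn M" "0 < ?z ! k" "?b = dn ?z k"
      then show ?thesis
        using lr dn_neq_self[of k ?z] up_neq_dn[of j ?z k] lz by auto
    qed
  qed
  have l: "(\<exists>q. q < Suc (Suc M) \<and> left_move p q j c (\<beta> @ [x]) (\<pi> @ [y])) \<longleftrightarrow>
      ?P \<and> (\<exists>q. q < Suc M \<and> left_move p q j c \<beta> \<pi>)" (is "?L \<longleftrightarrow> ?R") for p j c
  proof
    assume ?L
    then have p: "p \<le> M" and m: "left_move p M j c \<beta> \<pi>" and j: "j < levn p"
      and x: "int (x ! (j + (Suc M - p))) = c" "0 < c" "y = dn x (j + (Suc M - p))" "j + (Suc M - p) < levn (Suc M)"
      unfolding left_move_snoc[OF sh len] using ne by (auto split: if_splits)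
    have "j + (M - p) < levn M" "int (?z ! (j + (M - p))) = c" "?b = dn ?z (j + (M - p))"
      using left_move_last[OF sh m] by auto
    \<comment> \<open>The index of a particle moving left grows by one with each level.\<close>
    moreover have "j + (Suc M - p) = Suc (j + (M - p))" using p by simp
    ultimately have ?P unfolding pushed_def using x by (intro disjI2 exI[of _ "j + (M - p)"]) auto
    then show ?R using m by auto
  next
    assume R: ?R
    then obtain q where q: "q < Suc M" "left_move p q j c \<beta> \<pi>" by auto
    have lr: "(q < M \<and> ?b = ?z) \<or>
      (q = M \<and> p \<le> M \<and> j + (M - p) < levn M \<and> int (?z ! (j + (M - p))) = c \<and> 0 < c
      \<and> ?b = dn ?z (j + (M - p)))"
      using left_move_last[OF sh q(2,1)] .
    from R have ?P ..
    then show ?L unfolding pushed_def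
    proof (elim disjE exE conjE)
      fix k assume k: "k < levn M" "?b = up ?z k"
      then show ?thesis
        using lr up_neq_self[of k ?z] up_neq_dn[of k ?z "j + (M - p)"] lz by auto
    next
      fix k assume k: "k < levn M" "Suc k < levn (Suc M)" "0 < ?z ! k" "?b = dn ?z k"
        "x ! Suc k = ?z ! k" "y = dn x (Suc k)"
      then have a: "q = M" "p \<le> M" "j + (M - p) = k" "int (?z ! k) = c"
        using lr dn_neq_self[of k ?z] dn_inject[of k ?z "j + (M - p)"] lz by auto
      then have b: "j + (Suc M - p) = Suc k" by simp
      have "left_move p (Suc M) j c (\<beta> @ [x]) (\<pi> @ [y])"
        unfolding left_move_snoc[OF sh len] b using k q a by (auto simp: left_move_def)
      then show ?thesis by blast
    qed
  qed
  have "(\<exists>p q j c. q < Suc (Suc M) \<and> right_move p q j c (\<beta> @ [x]) (\<pi> @ [y]) \<and> wall_move p j c) \<longleftrightarrow>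
      ?P \<and> (\<exists>p q j c. q < Suc M \<and> right_move p q j c \<beta> \<pi> \<and> wall_move p j c)"
    using r by blast
  moreover have "(\<exists>p q j c. q < Suc (Suc M) \<and> right_move p q j c (\<beta> @ [x]) (\<pi> @ [y])) \<longleftrightarrow>
      ?P \<and> (\<exists>p q j c. q < Suc M \<and> right_move p q j c \<beta> \<pi>)"
    using r by blast
  moreover have "(\<exists>p q j c. q < Suc (Suc M) \<and> left_move p q j c (\<beta> @ [x]) (\<pi> @ [y])) \<longleftrightarrow>
      ?P \<and> (\<exists>p q j c. q < Suc M \<and> left_move p q j c \<beta> \<pi>)"
    using l by blast
  ultimately show ?thesis unfolding jump_def by auto
qed

lemma jump_self: "jump M \<pi> \<pi> = 0"
  by (auto simp: jump_def right_move_def left_move_def moveset_iff)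

lemma jump_nonneg: "0 \<le> jump M \<beta> \<pi>"
  by (simp add: jump_def)

lemma jump_last:
  assumes sh: "shaped (Suc M) \<beta>" "shaped (Suc M) \<pi>" and j: "jump (Suc M) \<beta> \<pi> \<noteq> 0"
  shows "last \<pi> = last \<beta> \<or> (\<exists>k<levn M. last \<pi> = up (last \<beta>) k)
    \<or> (\<exists>k<levn M. 0 < last \<beta> ! k \<and> last \<pi> = dn (last \<beta>) k)"
proof -
  have "(\<exists>p q j c. q < Suc M \<and> right_move p q j c \<beta> \<pi>) \<or> (\<exists>p q j c. q < Suc M \<and> left_move p q j c \<beta> \<pi>)"
    using j by (auto simp: jump_def split: if_splits)
  then show ?thesis
    using right_move_last[OF sh] left_move_last[OF sh] by (metis of_nat_0_less_iff)
qed

section \<open>Pushing and blocking between consecutive levels\<close>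

lemma levn_Suc: "levn (Suc m) = (if even m then levn m else Suc (levn m))"
  by (auto simp: levn_def elim!: evenE oddE)

lemma levn_pos: "0 < levn m"
  by (simp add: levn_def)

lemma levb_neq_half: "levb m \<noteq> 1/2 \<longleftrightarrow> even m"
  by (simp add: levb_def)

text \<open>Both kinds of interlacing in one formula: for even m the levels have equally many
  particles and the guard drops the last inequality, for odd m the guard always holds.\<close>

lemma prec_iff:
  "prec m z x \<longleftrightarrow> (\<forall>k<levn m. z ! k \<le> x ! k) \<and> (\<forall>k<levn m. Suc k < levn (Suc m) \<longrightarrow> x ! Suc k \<le> z ! k)"
  by (auto simp: prec_def levn_Suc)

text \<open>Interlacing already forces the order of the entries, so after a move of one particle
  only \<open>prec\<close> has to be checked.\<close>

lemma prec_Jset_lower: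
  assumes "length z = levn m" "x \<in> Jset (levn (Suc m))" "prec m z x"
  shows "z \<in> Jset (levn m)"
  unfolding Jset_iff
proof (intro conjI allI impI)
  fix k assume k: "Suc k < levn m"
  then have "z ! Suc k \<le> x ! Suc k" using assms(3) by (simp add: prec_iff)
  also have "\<dots> \<le> z ! k" using assms(3) k by (simp add: prec_iff levn_Suc)
  finally show "z ! Suc k \<le> z ! k" .
qed fact

lemma prec_Jset_upper:
  assumes "length x = levn (Suc m)" "prec m z x"
  shows "x \<in> Jset (levn (Suc m))"
  unfolding Jset_iff
proof (intro conjI allI impI)
  fix k assume k: "Suc k < levn (Suc m)"
  then have k': "k < levn m" by (simp add: levn_Suc split: if_splits)
  then have "x ! Suc k \<le> z ! k" using assms(2) k by (simp add: prec_iff)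
  also have "\<dots> \<le> x ! k" using assms(2) k' by (simp add: prec_iff)
  finally show "x ! Suc k \<le> x ! k" .
qed fact

context
  fixes m :: nat and b y :: "nat list"
  assumes len: "length b = levn m" "length y = levn (Suc m)" and prc: "prec m b y"
begin

lemma prec_up_lower: "k < levn m \<Longrightarrow> prec m (up b k) y \<longleftrightarrow> b ! k < y ! k"
  using prc len unfolding prec_iff by (auto simp: nth_up Suc_le_eq le_SucI)

lemma prec_dn_lower:
  "k < levn m \<Longrightarrow> 0 < b ! k \<Longrightarrow> prec m (dn b k) y \<longleftrightarrow> (Suc k < levn (Suc m) \<longrightarrow> y ! Suc k < b ! k)"
  using prc len unfolding prec_iff by (auto simp: nth_dn le_diff_conv intro: order.trans[OF diff_le_self])

lemma prec_up_upper:
  assumes k: "k < levn (Suc m)"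
  shows "prec m b (up y k) \<longleftrightarrow> k = 0 \<or> y ! k < b ! (k - 1)"
proof (cases k)
  case 0
  then show ?thesis using prc len k unfolding prec_iff by (auto simp: nth_up le_SucI levn_Suc split: if_splits)
next
  case (Suc j)
  then have j: "j < levn m" using k by (simp add: levn_Suc split: if_splits)
  have lm: "i < levn (Suc m)" if "i < levn m" for i using that by (simp add: levn_Suc)
  show ?thesis using prc len k j Suc unfolding prec_iff
    by (auto simp: nth_up lm le_SucI Suc_le_eq)
qed

lemma prec_dn_upper:
  assumes k: "k < levn (Suc m)" "0 < y ! k"
  shows "prec m b (dn y k) \<longleftrightarrow> (k < levn m \<longrightarrow> b ! k < y ! k)"
proof -
  have lm: "i < levn (Suc m)" if "i < levn m" for i using that by (simp add: levn_Suc)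
  have e: "b ! k \<le> y ! k - 1 \<longleftrightarrow> b ! k < y ! k" using k by auto
  have u: "(\<forall>i<levn m. b ! i \<le> dn y k ! i) \<longleftrightarrow> (k < levn m \<longrightarrow> b ! k < y ! k)"
    using prc len k e lm unfolding prec_iff by (auto simp: nth_dn)
  have "dn y k ! Suc i \<le> b ! i" if "i < levn m" "Suc i < levn (Suc m)" for i
  proof -
    have "dn y k ! Suc i \<le> y ! Suc i" using that len by (simp add: nth_dn)
    also have "\<dots> \<le> b ! i" using prc that by (simp add: prec_iff)
    finally show ?thesis .
  qed
  then show ?thesis unfolding prec_iff u by auto
qed

end

definition link_weight :: "nat \<Rightarrow> nat list \<Rightarrow> real" where
  "link_weight m z = (if even m \<and> 0 < z ! (levn m - 1) then 2 else 1)"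

lemma link_Suc: "link (Suc m) x z = (if prec m z x then link_weight m z else 0)"
  by (simp add: link_def link_weight_def)

definition gen :: "nat \<Rightarrow> nat list \<Rightarrow> nat list \<Rightarrow> real" where
  "gen m = level_gen (levn m) (levb m)"

lemma level_gen_up: "length y = n \<Longrightarrow> k < n \<Longrightarrow> level_gen n b (up y k) y = 1/2"
proof -
  assume a: "length y = n" "k < n"
  have "(\<Sum>k'<n. if up y k = up y k' then 1/2 else 0 :: real) = (\<Sum>k'<n. if k' = k then 1/2 else 0)"
    using a by (intro sum.cong refl) (auto simp: up_inject)
  moreover have "(\<Sum>k'<n. if 0 < y ! k' \<and> up y k = dn y k' then down_rate b (pos n y k') else 0) = 0"
    using a by (intro sum.neutral) (auto simp: up_neq_dn)
  ultimately show ?thesis using a up_neq_self[of k y] by (simp add: level_gen_def)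
qed

lemma level_gen_dn: "length y = n \<Longrightarrow> k < n \<Longrightarrow> 0 < y ! k \<Longrightarrow> level_gen n b (dn y k) y = down_rate b (pos n y k)"
proof -
  assume a: "length y = n" "k < n" "0 < y ! k"
  have "(\<Sum>k'<n. if 0 < y ! k' \<and> dn y k = dn y k' then down_rate b (pos n y k') else 0)
     = (\<Sum>k'<n. if k' = k then down_rate b (pos n y k) else 0)"
    using a by (intro sum.cong refl) (auto simp: dn_inject)
  moreover have "(\<Sum>k'<n. if dn y k = up y k' then 1/2 else 0 :: real) = 0"
    using a up_neq_dn[of _ y k, symmetric] by (intro sum.neutral) auto
  ultimately show ?thesis using a dn_neq_self[of k y] by (simp add: level_gen_def)
qed

lemma level_gen_diag: "length y = n \<Longrightarrow> level_gen n b y y = - (\<Sum>k<n. exit_rate b (pos n y k))"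
proof -
  assume a: "length y = n"
  have "(\<Sum>k<n. if y = up y k then 1/2 else 0 :: real) = 0"
    using a up_neq_self[of _ y, symmetric] by (intro sum.neutral) auto
  moreover have "(\<Sum>k<n. if 0 < y ! k \<and> y = dn y k then down_rate b (pos n y k) else 0) = 0"
    using a dn_neq_self[of _ y, symmetric] by (intro sum.neutral) auto
  ultimately show ?thesis by (simp add: level_gen_def)
qed

lemma down_rate_level:
  assumes k: "k < levn m" "0 < y ! k"
  shows "down_rate (levb m) (pos (levn m) y k) = (if even m \<and> k = levn m - 1 \<and> y ! k = 1 then 1 else 1/2)"
proof -
  have "pos (levn m) y k = 1 \<longleftrightarrow> k = levn m - 1 \<and> y ! k = 1" "pos (levn m) y k \<noteq> 0"
    unfolding pos_def using k by arith+
  then show ?thesis unfolding down_rate_def using levb_neq_half[of m] by auto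
qed

lemma exit_rate_level:
  assumes k: "k < levn m"
  shows "exit_rate (levb m) (pos (levn m) y k) = (if odd m \<and> k = levn m - 1 \<and> y ! k = 0 then 3/2 else 1)"
proof -
  have "pos (levn m) y k = 0 \<longleftrightarrow> k = levn m - 1 \<and> y ! k = 0"
    unfolding pos_def using k by arith
  then show ?thesis by (simp add: exit_rate_def levb_def)
qed

lemma top_jump_up:
  "length x = levn m \<Longrightarrow> k < levn m \<Longrightarrow>
    top_jump m x (up x k) = (if even m \<and> k = levn m - 1 \<and> x ! k = 0 then 1 else 1/2)"
  by (auto simp: top_jump_def up_inject)

lemma top_jump_dn:
  "length x = levn m \<Longrightarrow> k < levn m \<Longrightarrow> 0 < x ! k \<Longrightarrow> top_jump m x (dn x k) = 1/2"
  using up_neq_dn[of _ x k, symmetric] by (auto simp: top_jump_def)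

definition below :: "nat \<Rightarrow> nat list \<Rightarrow> nat list set" where
  "below m x = {z \<in> Jset (levn m). prec m z x}"

lemma finite_below:
  "finite (below m x)"
proof (rule finite_subset)
  show "below m x \<subseteq> {z. set z \<subseteq> {..Max (insert 0 ((!) x ` {..<levn m}))} \<and> length z = levn m}"
  proof
    fix z assume z: "z \<in> below m x"
    then have l: "length z = levn m" by (simp add: below_def Jset_length)
    have "z ! k \<le> Max (insert 0 ((!) x ` {..<levn m}))" if "k < levn m" for k
    proof -
      have "z ! k \<le> x ! k" using z that by (simp add: below_def prec_iff)
      also have "\<dots> \<le> Max (insert 0 ((!) x ` {..<levn m}))" using that by (intro Max_ge) auto
      finally show ?thesis .
    qed
    then show "z \<in> {z. set z \<subseteq> {..Max (insert 0 ((!) x ` {..<levn m}))} \<and> length z = levn m}"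
      using l by (auto simp: set_conv_nth)
  qed
qed (rule finite_lists_length_eq, simp)

text \<open>A rise of the k-th upper particle can only be a right push by the lower particle of the
  same index.\<close>

lemma pushed_dn:
  assumes len: "length z = levn m" "length y = levn (Suc m)" and k: "k < levn (Suc m)" "0 < y ! k"
  shows "pushed m z b (dn y k) y \<longleftrightarrow> k < levn m \<and> b = up z k \<and> y ! k = Suc (z ! k)"
proof -
  let ?x = "dn y k"
  have y: "y = up ?x k" using k len by (simp add: up_dn)
  have "y = up ?x j \<longleftrightarrow> j = k" if "j < levn m" for j
    using that up_inject[of k ?x j] k len y by (metis length_dn levn_Suc less_SucI)
  moreover have "y \<noteq> dn ?x j" for j using up_neq_dn[of k ?x j] y k len by simp
  moreover have "?x ! k = z ! k \<longleftrightarrow> y ! k = Suc (z ! k)" using k len by (auto simp: nth_dn)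
  ultimately show ?thesis unfolding pushed_def by auto
qed

text \<open>A fall of the k-th upper particle can only be a left push by the lower particle of index
  k - 1.\<close>

lemma pushed_up:
  assumes len: "length z = levn m" "length y = levn (Suc m)" and k: "k < levn (Suc m)"
  shows "pushed m z b (up y k) y \<longleftrightarrow> (\<exists>j<levn m. k = Suc j \<and> 0 < z ! j \<and> b = dn z j \<and> Suc (y ! k) = z ! j)"
proof -
  let ?x = "up y k"
  have y: "y = dn ?x k" using k len by (simp add: dn_up)
  have xk: "?x ! k = Suc (y ! k)" using k len by (simp add: nth_up)
  have "y = dn ?x j \<longleftrightarrow> j = k" if "j < levn (Suc m)" for j
    using that dn_inject[of k ?x j] k len y xk by (metis length_up zero_less_Suc)
  moreover have "y \<noteq> up ?x j" if "j < levn m" for j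
    using up_neq_dn[of j ?x k] y k len that by (simp add: levn_Suc split: if_splits)
  ultimately show ?thesis unfolding pushed_def using xk k by auto
qed

text \<open>Off-diagonal part of the intertwining between adjacent levels. A change of the upper
  level from x to y while the lower one ends in b has one cause only: if b interlaces with x, the
  upper particle jumps by itself; otherwise exactly one lower configuration pushes it on moving to
  b.\<close>

lemma link_push:
  assumes b: "b \<in> Jset (levn m)" and y: "y \<in> Jset (levn (Suc m))" and prc: "prec m b y"
    and x: "x \<in> Jset (levn (Suc m))" and xy: "x \<noteq> y"
  shows "link (Suc m) x b * top_jump (Suc m) x y
     + (\<Sum>z\<in>below m x - {b}. link (Suc m) x z * gen m z b * (if pushed m z b x y then 1 else 0))
     = gen (Suc m) x y * link (Suc m) y b"
proof -
  let ?n = "levn m" and ?n' = "levn (Suc m)"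
  let ?sum = "\<Sum>z\<in>below m x - {b}. link (Suc m) x z * gen m z b * (if pushed m z b x y then 1 else 0)"
  have len: "length b = ?n" "length y = ?n'" "length x = ?n'" using b y x by (auto intro: Jset_length)
  have lm: "?n \<le> ?n'" "?n' \<le> Suc ?n" by (simp_all add: levn_Suc)
  have lz: "length z = ?n" if "z \<in> below m x" for z using that by (simp add: below_def Jset_length)
  have single: "?sum = link (Suc m) x z0 * gen m z0 b"
    if "z0 \<in> below m x" "z0 \<noteq> b" "\<And>z. z \<in> below m x \<Longrightarrow> pushed m z b x y \<longleftrightarrow> z = z0" for z0
  proof -
    have "?sum = (\<Sum>z\<in>{z0}. link (Suc m) x z * gen m z b * (if pushed m z b x y then 1 else 0))"
      using that finite_below by (intro sum.mono_neutral_right) auto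
    then show ?thesis using that by simp
  qed
  have none: "?sum = 0" if "\<And>z. z \<in> below m x \<Longrightarrow> \<not> pushed m z b x y"
    using that by (intro sum.neutral) auto
  have lb: "link (Suc m) y b = link_weight m b" using prc by (simp add: link_Suc)
  consider (dn) k where "k < ?n'" "0 < y ! k" "x = dn y k" | (up) k where "k < ?n'" "x = up y k"
    | (far) "\<And>k. k < ?n' \<Longrightarrow> x \<noteq> up y k" "\<And>k. k < ?n' \<Longrightarrow> 0 < y ! k \<Longrightarrow> x \<noteq> dn y k" by blast
  then show ?thesis
  proof cases
    case (dn k)
    have yx: "y = up x k" using dn len by (simp add: up_dn)
    have xk: "x ! k = y ! k - 1" using dn len by (simp add: nth_dn)
    have tj: "top_jump (Suc m) x y = (if odd m \<and> k = ?n' - 1 \<and> y ! k = 1 then 1 else 1/2)"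
      unfolding yx using top_jump_up[OF len(3) dn(1)] xk dn(2) nth_up[of k x k] dn(1) len by auto
    have G: "gen (Suc m) x y = (if odd m \<and> k = ?n' - 1 \<and> y ! k = 1 then 1 else 1/2)"
      unfolding gen_def dn(3) using level_gen_dn[OF len(2) dn(1,2)] down_rate_level[OF dn(1,2)] by simp
    have px: "prec m b x \<longleftrightarrow> (k < ?n \<longrightarrow> b ! k < y ! k)"
      unfolding dn(3) by (rule prec_dn_upper[OF len(1,2) prc dn(1,2)])
    have pushed: "pushed m z b x y \<longleftrightarrow> k < ?n \<and> b = up z k \<and> y ! k = Suc (z ! k)" if "z \<in> below m x" for z
      unfolding dn(3) by (rule pushed_dn[OF lz[OF that] len(2) dn(1,2)])
    show ?thesis
    proof (cases "k < ?n \<longrightarrow> b ! k < y ! k")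
      case True
      have "\<not> pushed m z b x y" if "z \<in> below m x" for z
        using pushed[OF that] True lz[OF that] by (auto simp: nth_up)
      then show ?thesis using none True px tj G lb by (simp add: link_Suc)
    next
      case False
      then have k: "k < ?n" "b ! k = y ! k" using prc by (auto simp: prec_iff)
      have bk: "0 < b ! k" using k dn by simp
      \<comment> \<open>The k-th particle of b sits exactly at \<open>y ! k\<close>, so the pushing
        configuration is b with this particle one step back.\<close>
      let ?z = "dn b k"
      have bz: "b = up ?z k" using k bk len by (simp add: up_dn)
      have zx: "prec m ?z x" unfolding prec_iff
      proof (intro conjI allI impI)
        fix i assume i: "i < ?n"
        show "?z ! i \<le> x ! i" using prc i k xk len lm dn by (auto simp: prec_iff nth_dn)
        assume i': "Suc i < ?n'"
        show "x ! Suc i \<le> ?z ! i"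
        proof (cases "i = k")
          case True
          then show ?thesis using Jset_mono[OF x, of k "Suc k"] i' xk k len by (simp add: nth_dn)
        next
          case False
          have "x ! Suc i \<le> y ! Suc i" using i' dn len by (simp add: nth_dn)
          also have "\<dots> \<le> b ! i" using prc i i' by (simp add: prec_iff)
          finally show ?thesis using False i len by (simp add: nth_dn)
        qed
      qed
      have z: "?z \<in> below m x" using prec_Jset_lower[OF _ x zx] zx len by (simp add: below_def)
      have "pushed m z b x y \<longleftrightarrow> z = ?z" if zb: "z \<in> below m x" for z
      proof -
        have "z = ?z" if "b = up z k" using that dn_up[of k z] lz[OF zb] k by simp
        moreover have "y ! k = Suc (?z ! k)" using k bk len by (simp add: nth_dn)
        ultimately show ?thesis using pushed[OF zb] bz k by auto
      qed
      then have "?sum = link (Suc m) x ?z * gen m ?z b"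
        using z dn_neq_self[of k b] k bk len by (intro single) auto
      moreover have "gen m ?z b = (if even m \<and> k = ?n - 1 \<and> b ! k = 1 then 1 else 1/2)"
        unfolding gen_def level_gen_dn[OF len(1) k(1) bk] by (rule down_rate_level[OF k(1) bk])
      \<comment> \<open>When the lower particle leaves the wall, its rate is 1 instead of 1/2, but
        the weight of its old configuration is 1 instead of 2; the product is the same as
        elsewhere.\<close>
      moreover have "link_weight m ?z = (if even m \<and> k = ?n - 1 \<and> b ! k = 1 then link_weight m b / 2 else link_weight m b)"
        using k bk len levn_pos[of m] by (auto simp: link_weight_def nth_dn)
      moreover have "\<not> (odd m \<and> k = ?n' - 1)" using k(1) by (auto simp: levn_Suc)
      ultimately show ?thesis using zx px False G lb by (auto simp: link_Suc)
    qed
  next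
    case (up k)
    have xk: "x ! k = Suc (y ! k)" using up len by (simp add: nth_up)
    have yx: "y = dn x k" using up len by (simp add: dn_up)
    have tj: "top_jump (Suc m) x y = 1/2" unfolding yx using top_jump_dn[OF len(3) up(1)] xk by simp
    have G: "gen (Suc m) x y = 1/2" unfolding gen_def up(2) using level_gen_up[OF len(2) up(1)] by simp
    have px: "prec m b x \<longleftrightarrow> k = 0 \<or> y ! k < b ! (k - 1)"
      unfolding up(2) by (rule prec_up_upper[OF len(1,2) prc up(1)])
    have pushed: "pushed m z b x y \<longleftrightarrow> (\<exists>j<?n. k = Suc j \<and> 0 < z ! j \<and> b = dn z j \<and> Suc (y ! k) = z ! j)"
      if "z \<in> below m x" for z
      unfolding up(2) by (rule pushed_up[OF lz[OF that] len(2) up(1)])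
    show ?thesis
    proof (cases "k = 0 \<or> y ! k < b ! (k - 1)")
      case True
      have "\<not> pushed m z b x y" if "z \<in> below m x" for z
        using pushed[OF that] True lz[OF that] by (auto simp: nth_dn)
      then show ?thesis using none True px tj G lb by (simp add: link_Suc)
    next
      case False
      then obtain j where j: "k = Suc j" by (cases k) auto
      then have jn: "j < ?n" using up(1) lm by simp
      then have bj: "b ! j = y ! k" using False prc up(1) j by (force simp: prec_iff)
      \<comment> \<open>Mirror image of the right push, performed by the particle of index j = k -
        1.\<close>
      let ?z = "up b j"
      have bz: "b = dn ?z j" using jn len by (simp add: dn_up)
      have zj: "?z ! j = Suc (y ! k)" using jn bj len by (simp add: nth_up)
      have zx: "prec m ?z x" unfolding prec_iff
      proof (intro conjI allI impI)
        fix i assume i: "i < ?n"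
        show "?z ! i \<le> x ! i"
        proof (cases "i = j")
          case True
          have "x ! k \<le> x ! j" using Jset_mono[OF x, of j k] j up(1) by simp
          then show ?thesis using True zj xk by simp
        next
          case False
          have "b ! i \<le> y ! i" using prc i by (simp add: prec_iff)
          also have "\<dots> \<le> x ! i" using up i lm len by (simp add: nth_up)
          finally show ?thesis using False i len by (simp add: nth_up)
        qed
        assume i': "Suc i < ?n'"
        show "x ! Suc i \<le> ?z ! i"
        proof (cases "i = j")
          case True
          then show ?thesis using zj xk j by simp
        next
          case False
          then show ?thesis using prc i i' j up len by (simp add: nth_up prec_iff)
        qed
      qed
      have z: "?z \<in> below m x" using prec_Jset_lower[OF _ x zx] zx len by (simp add: below_def)
      have "pushed m z b x y \<longleftrightarrow> z = ?z" if zb: "z \<in> below m x" for z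
      proof -
        have "z = ?z" if "b = dn z j" "0 < z ! j" using that up_dn[of j z] lz[OF zb] jn by simp
        then show ?thesis using pushed[OF zb] bz jn j zj by auto
      qed
      then have "?sum = link (Suc m) x ?z * gen m ?z b"
        using z up_neq_self[of j b] jn len by (intro single) auto
      moreover have "gen m ?z b = 1/2"
        unfolding gen_def by (rule level_gen_up[OF len(1) jn])
      moreover have "link_weight m ?z = link_weight m b"
        using jn j up(1) len by (auto simp: link_weight_def nth_up levn_Suc)
      ultimately have s: "?sum = link_weight m b * (1/2)" using zx by (simp only: link_Suc if_True)
      show ?thesis unfolding s G lb using px False by (simp add: link_Suc)
    qed
  next
    case far
    have "(\<Sum>k<?n'. if x = up y k then 1/2 else 0 :: real) = 0"
      by (rule sum.neutral) (use far(1) in auto)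
    moreover have "(\<Sum>k<?n'. if 0 < y ! k \<and> x = dn y k then down_rate (levb (Suc m)) (pos ?n' y k) else 0) = 0"
      by (rule sum.neutral, rule ballI, rule if_not_P) (use far(2) in blast)
    ultimately have "gen (Suc m) x y = 0" unfolding gen_def level_gen_def using xy by simp
    moreover have t: "y \<noteq> up x k" if "k < ?n'" for k
    proof
      assume a: "y = up x k"
      then have "0 < y ! k" "x = dn y k" using that len by (simp_all add: nth_up dn_up)
      then show False using far(2)[OF that] by simp
    qed
    moreover have d: "y \<noteq> dn x k" if "k < ?n'" "0 < x ! k" for k
    proof
      assume a: "y = dn x k"
      then have "x = up y k" using that len by (simp add: up_dn)
      then show False using far(1)[OF that(1)] by simp
    qed
    moreover have "top_jump (Suc m) x y = 0" unfolding top_jump_def using t d by auto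
    moreover have "?sum = 0"
    proof (rule none)
      fix z assume "z \<in> below m x"
      show "\<not> pushed m z b x y"
      proof
        assume "pushed m z b x y"
        then show False unfolding pushed_def
        proof (elim disjE exE conjE)
          fix k assume "k < ?n" "y = up x k"
          then show False using t[of k] lm by simp
        next
          fix k assume "Suc k < ?n'" "0 < z ! k" "x ! Suc k = z ! k" "y = dn x (Suc k)"
          then show False using d[of "Suc k"] by simp
        qed
      qed
    qed
    ultimately show ?thesis by simp
  qed
qed

text \<open>Total rate of the jumps of the upper level alone that the lower configuration b does not
  block.\<close>

definition outflow :: "nat \<Rightarrow> nat list \<Rightarrow> nat list \<Rightarrow> real" where
  "outflow m b y = (\<Sum>v\<in>{v \<in> neighbours (levn (Suc m)) y. v \<noteq> y \<and> prec m b v}. top_jump (Suc m) y v)"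

lemma outflow_eq:
  assumes len: "length b = levn m" "length y = levn (Suc m)" and prc: "prec m b y"
  shows "outflow m b y =
     (\<Sum>k<levn (Suc m). if k = 0 \<or> y ! k < b ! (k - 1)
        then if odd m \<and> k = levn (Suc m) - 1 \<and> y ! k = 0 then 1 else 1/2 else 0)
     + (\<Sum>k<levn (Suc m). if 0 < y ! k \<and> (k < levn m \<longrightarrow> b ! k < y ! k) then 1/2 else 0)"
proof -
  let ?n = "levn (Suc m)"
  define U where "U = {k. k < ?n \<and> (k = 0 \<or> y ! k < b ! (k - 1))}"
  define D where "D = {k. k < ?n \<and> 0 < y ! k \<and> (k < levn m \<longrightarrow> b ! k < y ! k)}"
  note up = prec_up_upper[OF len prc] and dn = prec_dn_upper[OF len prc]
  have set: "{v \<in> neighbours ?n y. v \<noteq> y \<and> prec m b v} = up y ` U \<union> dn y ` D"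
  proof (intro equalityI subsetI)
    fix v assume "v \<in> {v \<in> neighbours ?n y. v \<noteq> y \<and> prec m b v}"
    then have v: "v \<noteq> y" "prec m b v" and cs: "(\<exists>k<?n. v = up y k) \<or> (\<exists>k<?n. v = dn y k)"
      unfolding neighbours_def by blast+
    from cs show "v \<in> up y ` U \<union> dn y ` D"
    proof (elim disjE exE conjE)
      fix k assume k: "k < ?n" "v = up y k"
      then have "k \<in> U" using up[OF k(1)] v unfolding U_def by simp
      then show ?thesis using k by blast
    next
      fix k assume k: "k < ?n" "v = dn y k"
      have "0 < y ! k"
      proof (rule ccontr)
        assume "\<not> 0 < y ! k"
        then have "v = y" using k len by (intro nth_equalityI) (auto simp: nth_dn)
        then show False using v by simp
      qed
      then have "k \<in> D" using dn[OF k(1)] v k unfolding D_def by simp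
      then show ?thesis using k by blast
    qed
  next
    fix v assume "v \<in> up y ` U \<union> dn y ` D"
    then show "v \<in> {v \<in> neighbours ?n y. v \<noteq> y \<and> prec m b v}"
    proof
      assume "v \<in> up y ` U"
      then obtain k where k: "k < ?n" "k = 0 \<or> y ! k < b ! (k - 1)" "v = up y k" unfolding U_def by blast
      then show ?thesis using up[OF k(1)] up_neq_self[of k y] len by (simp add: neighbours_def)
    next
      assume "v \<in> dn y ` D"
      then obtain k where k: "k < ?n" "0 < y ! k" "k < levn m \<longrightarrow> b ! k < y ! k" "v = dn y k" unfolding D_def by blast
      then show ?thesis using dn[OF k(1,2)] dn_neq_self[of k y] len by (simp add: neighbours_def)
    qed
  qed
  have U: "finite U" "inj_on (up y) U" "\<And>k. k \<in> U \<Longrightarrow> k < ?n"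
    and D: "finite D" "inj_on (dn y) D" "\<And>k. k \<in> D \<Longrightarrow> k < ?n \<and> 0 < y ! k"
    using len by (auto simp: U_def D_def inj_on_def up_inject dn_inject)
  have disj: "up y ` U \<inter> dn y ` D = {}"
  proof (rule equals0I)
    fix v assume "v \<in> up y ` U \<inter> dn y ` D"
    then obtain k k' where "k \<in> U" "up y k = dn y k'" by fastforce
    then show False using up_neq_dn[of k y k'] U(3) len by simp
  qed
  have "outflow m b y = (\<Sum>k\<in>U. top_jump (Suc m) y (up y k)) + (\<Sum>k\<in>D. top_jump (Suc m) y (dn y k))"
    unfolding outflow_def set using U D disj by (simp add: sum.union_disjoint sum.reindex)
  also have "(\<Sum>k\<in>U. top_jump (Suc m) y (up y k)) =
      (\<Sum>k\<in>U. if odd m \<and> k = ?n - 1 \<and> y ! k = 0 then 1 else 1/2)"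
    using U(3) by (intro sum.cong refl) (simp add: top_jump_up len)
  also have "\<dots> = (\<Sum>k<?n. if k = 0 \<or> y ! k < b ! (k - 1)
        then if odd m \<and> k = ?n - 1 \<and> y ! k = 0 then 1 else 1/2 else 0)"
    unfolding U_def by (rule sum.mono_neutral_cong_left) auto
  also have "(\<Sum>k\<in>D. top_jump (Suc m) y (dn y k)) = (\<Sum>k\<in>D. 1/2)"
    using D(3) by (intro sum.cong refl) (simp add: top_jump_dn len)
  also have "\<dots> = (\<Sum>k<?n. if 0 < y ! k \<and> (k < levn m \<longrightarrow> b ! k < y ! k) then 1/2 else 0)"
    unfolding D_def by (rule sum.mono_neutral_cong_left) auto
  finally show ?thesis .
qed

text \<open>Diagonal part of the intertwining between adjacent levels. A strict inequality between b
  and y is a gap that permits two moves, one of b on the left and one of y in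
  \<open>outflow\<close>: \<open>?B k\<close> permits \<open>up b k\<close> and
  \<open>dn y k\<close>, while \<open>?C k\<close> permits \<open>dn b k\<close> and
  \<open>up y (Suc k)\<close>. The sums over gaps therefore agree, and only the wall and the
  outermost particle remain to be checked.\<close>

lemma link_row_act:
  assumes b: "b \<in> Jset (levn m)" and y: "y \<in> Jset (levn (Suc m))" and prc: "prec m b y"
  shows "row_act (Jset (levn m)) (gen m) (link (Suc m) y) b
     = link (Suc m) y b * (gen (Suc m) y y + outflow m b y)"
proof -
  have len: "length b = levn m" "length y = levn (Suc m)" using b y by (auto intro: Jset_length)
  obtain N where N: "levn m = Suc N" using levn_pos[of m] by (cases "levn m") auto
  define w where "w = link_weight m b"
  let ?B = "\<lambda>k. b ! k < y ! k" and ?C = "\<lambda>k. y ! Suc k < b ! k"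
  have up: "(if up b k \<in> Jset (levn m) then 1/2 * link (Suc m) y (up b k) else 0)
      = (if ?B k then 1/2 * link_weight m (up b k) else 0)" if "k < levn m" for k
    using prec_Jset_lower[OF _ y, of "up b k"] prec_up_lower[OF len prc that] len by (simp add: link_Suc)
  have dn: "(if 0 < b ! k \<and> dn b k \<in> Jset (levn m)
        then down_rate (levb m) (pos (levn m) b k) * link (Suc m) y (dn b k) else 0)
      = (if 0 < b ! k \<and> (Suc k < levn (Suc m) \<longrightarrow> ?C k)
         then (if even m \<and> k = N \<and> b ! k = 1 then 1 else 1/2) * link_weight m (dn b k) else 0)"
    if "k < levn m" for k
    using prec_Jset_lower[OF _ y, of "dn b k"] prec_dn_lower[OF len prc that] len down_rate_level[OF that, of b] N
    by (simp add: link_Suc)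
  have L: "row_act (Jset (levn m)) (gen m) (link (Suc m) y) b =
     (\<Sum>k<Suc N. if ?B k then 1/2 * link_weight m (up b k) else 0)
     + (\<Sum>k<Suc N. if 0 < b ! k \<and> (Suc k < levn (Suc m) \<longrightarrow> ?C k)
         then (if even m \<and> k = N \<and> b ! k = 1 then 1 else 1/2) * link_weight m (dn b k) else 0)
     - (\<Sum>k<Suc N. if odd m \<and> k = N \<and> b ! k = 0 then 3/2 else 1) * w"
  proof -
    have "(\<Sum>k<levn m. if up b k \<in> Jset (levn m) then 1/2 * link (Suc m) y (up b k) else 0)
      = (\<Sum>k<levn m. if ?B k then 1/2 * link_weight m (up b k) else 0)"
      by (rule sum.cong[OF refl], rule up) simp
    moreover have "(\<Sum>k<levn m. if 0 < b ! k \<and> dn b k \<in> Jset (levn m)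
        then down_rate (levb m) (pos (levn m) b k) * link (Suc m) y (dn b k) else 0)
      = (\<Sum>k<levn m. if 0 < b ! k \<and> (Suc k < levn (Suc m) \<longrightarrow> ?C k)
         then (if even m \<and> k = N \<and> b ! k = 1 then 1 else 1/2) * link_weight m (dn b k) else 0)"
      by (rule sum.cong[OF refl], rule dn) simp
    moreover have "(\<Sum>k<levn m. exit_rate (levb m) (pos (levn m) b k))
      = (\<Sum>k<levn m. if odd m \<and> k = N \<and> b ! k = 0 then 3/2 else 1)"
      by (rule sum.cong[OF refl]) (simp add: exit_rate_level[where m = m, unfolded N] N)
    moreover have "link (Suc m) y b = w" using prc by (simp add: link_Suc w_def)
    ultimately show ?thesis unfolding gen_def row_act_level_gen[OF b] N[symmetric] by simp
  qed
  have R: "gen (Suc m) y y = - (\<Sum>k<levn (Suc m). if even m \<and> k = levn (Suc m) - 1 \<and> y ! k = 0 then 3/2 else 1)"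
    unfolding gen_def level_gen_diag[OF len(2)] by (simp add: exit_rate_level)
  have lk: "link (Suc m) y b = w" using prc by (simp add: link_Suc w_def)
  have low: "link_weight m (up b k) = w \<and> link_weight m (dn b k) = w" if "k < N" for k
    using that len N by (simp add: w_def link_weight_def nth_up nth_dn)
  have BC: "b ! k \<le> y ! k" if "k < levn m" for k using prc that by (simp add: prec_iff)
  show ?thesis
  proof (cases "even m")
    case True
    then have n': "levn (Suc m) = Suc N" by (simp add: levn_Suc N)
    \<comment> \<open>The index N is kept out of both sums: whether the N-th particle of b is at 0
      determines \<open>link_weight\<close> and the rate of its jump off the wall.\<close>
    define SB SC where "SB = (\<Sum>k<N. if ?B k then 1 else 0 :: real)"
      and "SC = (\<Sum>k<N. if ?C k then 1 else 0 :: real)"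
    have 1: "(\<Sum>k<N. if ?B k then 1/2 * link_weight m (up b k) else 0) = w / 2 * SB"
      unfolding SB_def sum_distrib_left by (rule sum.cong) (use low in auto)
    have 2: "(\<Sum>k<N. if 0 < b ! k \<and> (Suc k < levn (Suc m) \<longrightarrow> ?C k)
         then (if even m \<and> k = N \<and> b ! k = 1 then 1 else 1/2) * link_weight m (dn b k) else 0) = w / 2 * SC"
      unfolding SC_def sum_distrib_left by (rule sum.cong) (use low n' in auto)
    have 3: "(\<Sum>k<Suc N. if k = 0 \<or> y ! k < b ! (k - 1)
        then if odd m \<and> k = Suc N - 1 \<and> y ! k = 0 then 1 else 1/2 else 0) = 1/2 + 1/2 * SC"
      unfolding SC_def sum_distrib_left sum.lessThan_Suc_shift
      using True by (auto intro!: sum.cong)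
    have 4: "(\<Sum>k<N. if 0 < y ! k \<and> (k < Suc N \<longrightarrow> ?B k) then 1/2 else 0) = 1/2 * SB"
      unfolding SB_def sum_distrib_left by (rule sum.cong) auto
    have 5: "(\<Sum>k<N. if even m \<and> k = Suc N - 1 \<and> y ! k = 0 then 3/2 else 1 :: real) = N"
      "(\<Sum>k<N. if odd m \<and> k = N \<and> b ! k = 0 then 3/2 else 1 :: real) = N" by simp_all
    have wN: "link_weight m (up b N) = 2" "w = (if 0 < b ! N then 2 else 1)"
      "link_weight m (dn b N) = (if 1 < b ! N then 2 else 1)"
      using True N len by (auto simp: link_weight_def w_def nth_up nth_dn)
    show ?thesis
      unfolding L R lk outflow_eq[OF len prc]
      unfolding n' N 3
      unfolding sum.lessThan_Suc 1 2[unfolded n'] 4 5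
      using True BC[of N] N wN
      by (cases "b ! N = 0"; cases "b ! N = 1"; cases "y ! N = b ! N") (auto simp: field_simps)
  next
    case False
    then have n': "levn (Suc m) = Suc (Suc N)" by (simp add: levn_Suc N)
    have w1: "link_weight m z = 1" for z using False by (simp add: link_weight_def)
    then have w: "w = 1" by (simp add: w_def)
    \<comment> \<open>Here y has one particle more; its gap \<open>?C N\<close> is kept apart
      because its rate doubles at 0.\<close>
    define SB SC where "SB = (\<Sum>k<Suc N. if ?B k then 1 else 0 :: real)"
      and "SC = (\<Sum>k<N. if ?C k then 1 else 0 :: real)"
    have 1: "(\<Sum>k<Suc N. if ?B k then 1/2 * link_weight m (up b k) else 0) = 1 / 2 * SB"
      unfolding SB_def sum_distrib_left by (rule sum.cong) (use w1 in auto)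
    have SC_last: "SC + (if ?C N then 1 else 0) = (\<Sum>k<Suc N. if ?C k then 1 else 0)" by (simp add: SC_def)
    have 2: "(\<Sum>k<Suc N. if 0 < b ! k \<and> (Suc k < levn (Suc m) \<longrightarrow> ?C k)
         then (if even m \<and> k = N \<and> b ! k = 1 then 1 else 1/2) * link_weight m (dn b k) else 0)
        = 1 / 2 * (SC + (if ?C N then 1 else 0))"
      unfolding SC_last sum_distrib_left by (rule sum.cong) (use w1 n' False in auto)
    have 3: "(\<Sum>k<Suc (Suc N). if k = 0 \<or> y ! k < b ! (k - 1)
        then if odd m \<and> k = Suc (Suc N) - 1 \<and> y ! k = 0 then 1 else 1/2 else 0)
        = 1/2 + (1/2 * SC + (if ?C N then if y ! Suc N = 0 then 1 else 1/2 else 0))"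
      unfolding sum.lessThan_Suc_shift[of _ "Suc N"] sum.lessThan_Suc[of _ N] SC_def sum_distrib_left
      using False by (auto intro!: sum.cong)
    have 4: "(\<Sum>k<Suc N. if 0 < y ! k \<and> (k < Suc N \<longrightarrow> ?B k) then 1/2 else 0) = 1/2 * SB"
      unfolding SB_def sum_distrib_left by (rule sum.cong) auto
    have 5: "(\<Sum>k<Suc (Suc N). if even m \<and> k = Suc (Suc N) - 1 \<and> y ! k = 0 then 3/2 else 1 :: real) = Suc (Suc N)"
      using False by simp
    have 6: "(\<Sum>k<Suc N. if odd m \<and> k = N \<and> b ! k = 0 then 3/2 else 1 :: real) = N + (if b ! N = 0 then 3/2 else 1)"
      using False by simp
    have CN: "y ! Suc N \<le> b ! N" using prc N n' by (simp add: prec_iff)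
    show ?thesis
      unfolding L R lk outflow_eq[OF len prc]
      unfolding n' N 3 5 6 1 2[unfolded n'] w sum.lessThan_Suc[of _ "Suc N"] 4
      using CN by (cases "b ! N = 0"; cases "y ! Suc N = 0"; cases "y ! Suc N = b ! N") (auto simp: field_simps)
  qed
qed

section \<open>Intertwining with the path generator\<close>

definition fiber :: "nat \<Rightarrow> nat list \<Rightarrow> nat list list set" where
  "fiber m x = {\<beta> \<in> paths (Suc m). last \<beta> = x}"

definition path_weight :: "nat list list \<Rightarrow> real" where
  "path_weight ls = (\<Prod>i\<in>{1..<length ls}. link i (ls ! i) (ls ! (i - 1)))"

lemma paths_length: "\<beta> \<in> paths M \<Longrightarrow> length \<beta> = M"
  by (simp add: paths_def)

lemma paths_last: "\<beta> \<in> paths (Suc m) \<Longrightarrow> last \<beta> \<in> Jset (levn m)"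
  by (cases "\<beta> = []") (auto simp: paths_def last_conv_nth)

lemma paths_snoc:
  "\<beta> @ [x] \<in> paths (Suc (Suc m)) \<longleftrightarrow> \<beta> \<in> paths (Suc m) \<and> x \<in> Jset (levn (Suc m)) \<and> prec m (last \<beta>) x"
proof (cases "length \<beta> = Suc m")
  case True
  then have ne: "\<beta> \<noteq> []" by auto
  have 1: "(\<forall>i<Suc (Suc m). (\<beta> @ [x]) ! i \<in> Jset (levn i)) \<longleftrightarrow>
      (\<forall>i<Suc m. \<beta> ! i \<in> Jset (levn i)) \<and> x \<in> Jset (levn (Suc m))"
    using True by (auto simp: nth_append less_Suc_eq)
  have l: "last \<beta> = \<beta> ! m" using True ne by (simp add: last_conv_nth)
  have 2: "(\<forall>i. i + 1 < Suc (Suc m) \<longrightarrow> prec i ((\<beta> @ [x]) ! i) ((\<beta> @ [x]) ! (i + 1))) \<longleftrightarrow>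
      (\<forall>i. i + 1 < Suc m \<longrightarrow> prec i (\<beta> ! i) (\<beta> ! (i + 1))) \<and> prec m (last \<beta>) x"
    using True by (auto simp: nth_append less_Suc_eq l)
  show ?thesis unfolding paths_def mem_Collect_eq 1 2 using True by auto
qed (auto simp: paths_def)

lemma paths_Suc_cases:
  assumes "\<beta> \<in> paths (Suc (Suc m))"
  obtains \<beta>' x where "\<beta> = \<beta>' @ [x]" "\<beta>' \<in> paths (Suc m)" "x \<in> Jset (levn (Suc m))" "prec m (last \<beta>') x"
proof -
  have "\<beta> \<noteq> []" using assms by (auto simp: paths_def)
  then have "\<beta> = butlast \<beta> @ [last \<beta>]" by simp
  then show thesis using assms that paths_snoc by metis
qed

lemma paths_1: "paths (Suc 0) = (\<lambda>x. [x]) ` Jset (levn 0)"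
proof (intro equalityI subsetI)
  fix ls assume "ls \<in> paths (Suc 0)"
  then have "length ls = Suc 0" "ls ! 0 \<in> Jset (levn 0)" by (auto simp: paths_def)
  then show "ls \<in> (\<lambda>x. [x]) ` Jset (levn 0)" by (cases ls) auto
qed (auto simp: paths_def)

lemma fiber_0: "x \<in> Jset (levn 0) \<Longrightarrow> fiber 0 x = {[x]}"
  by (auto simp: fiber_def paths_1)

lemma fiber_Suc:
  "x \<in> Jset (levn (Suc m)) \<Longrightarrow> fiber (Suc m) x = (\<lambda>\<beta>. \<beta> @ [x]) ` (\<Union>z\<in>below m x. fiber m z)"
proof (intro equalityI subsetI)
  fix \<beta> assume "\<beta> \<in> fiber (Suc m) x"
  then have "\<beta> \<in> paths (Suc (Suc m))" "last \<beta> = x" by (auto simp: fiber_def)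
  then obtain \<beta>' where \<beta>: "\<beta> = \<beta>' @ [x]" "\<beta>' \<in> paths (Suc m)" "prec m (last \<beta>') x"
    by (metis paths_Suc_cases last_snoc)
  then have "last \<beta>' \<in> below m x" "\<beta>' \<in> fiber m (last \<beta>')"
    using paths_last by (auto simp: below_def fiber_def)
  then show "\<beta> \<in> (\<lambda>\<beta>. \<beta> @ [x]) ` (\<Union>z\<in>below m x. fiber m z)" using \<beta> by auto
next
  fix \<beta> assume x: "x \<in> Jset (levn (Suc m))" and "\<beta> \<in> (\<lambda>\<beta>. \<beta> @ [x]) ` (\<Union>z\<in>below m x. fiber m z)"
  then show "\<beta> \<in> fiber (Suc m) x" by (auto simp: fiber_def paths_snoc below_def)
qed

lemma finite_fiber: "x \<in> Jset (levn m) \<Longrightarrow> finite (fiber m x)"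
proof (induction m arbitrary: x)
  case 0
  then show ?case by (simp add: fiber_0)
next
  case (Suc m)
  then show ?case unfolding fiber_Suc[OF Suc.prems]
    by (intro finite_imageI finite_UN_I finite_below) (auto simp: below_def)
qed

lemma sum_fiber_Suc:
  assumes x: "x \<in> Jset (levn (Suc m))"
  shows "sum F (fiber (Suc m) x) = (\<Sum>z\<in>below m x. \<Sum>\<beta>\<in>fiber m z. F (\<beta> @ [x]))"
proof -
  have "sum F (fiber (Suc m) x) = (\<Sum>\<beta>\<in>(\<Union>z\<in>below m x. fiber m z). F (\<beta> @ [x]))"
    unfolding fiber_Suc[OF x] by (subst sum.reindex) (auto simp: inj_on_def)
  also have "\<dots> = (\<Sum>z\<in>below m x. \<Sum>\<beta>\<in>fiber m z. F (\<beta> @ [x]))"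
    by (rule sum.UNION_disjoint[OF finite_below]) (auto simp: below_def finite_fiber, auto simp: fiber_def)
  finally show ?thesis .
qed

lemma path_weight_single: "path_weight [x] = 1"
  by (simp add: path_weight_def)

lemma path_weight_snoc:
  assumes "length \<beta> = Suc m"
  shows "path_weight (\<beta> @ [x]) = path_weight \<beta> * link (Suc m) x (last \<beta>)"
proof -
  have ne: "\<beta> \<noteq> []" using assms by auto
  have "path_weight (\<beta> @ [x]) = (\<Prod>i\<in>insert (Suc m) {1..<Suc m}. link i ((\<beta> @ [x]) ! i) ((\<beta> @ [x]) ! (i - 1)))"
    unfolding path_weight_def using assms by (intro prod.cong) auto
  also have "\<dots> = link (Suc m) x (last \<beta>) * (\<Prod>i\<in>{1..<Suc m}. link i (\<beta> ! i) (\<beta> ! (i - 1)))"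
  proof -
    have "(\<Prod>i\<in>{1..<Suc m}. link i ((\<beta> @ [x]) ! i) ((\<beta> @ [x]) ! (i - 1))) = (\<Prod>i\<in>{1..<Suc m}. link i (\<beta> ! i) (\<beta> ! (i - 1)))"
      using assms by (intro prod.cong) (auto simp: nth_append)
    moreover have "(\<beta> @ [x]) ! Suc m = x" "(\<beta> @ [x]) ! m = last \<beta>"
      using assms ne by (auto simp: nth_append last_conv_nth)
    ultimately show ?thesis by simp
  qed
  finally show ?thesis using assms by (simp add: path_weight_def)
qed

text \<open>Along a path every link is 1 or 2. The lower bound is what later controls the columns of
  the path generator.\<close>

lemma path_weight_bounds: "\<beta> \<in> paths (Suc m) \<Longrightarrow> 1 \<le> path_weight \<beta> \<and> path_weight \<beta> \<le> 2 ^ m"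
proof (induction m arbitrary: \<beta>)
  case 0
  then show ?case by (auto simp: paths_1 path_weight_single)
next
  case (Suc m)
  then obtain \<beta>' x where \<beta>: "\<beta> = \<beta>' @ [x]" "\<beta>' \<in> paths (Suc m)" "prec m (last \<beta>') x"
    by (metis paths_Suc_cases)
  have l: "1 \<le> link (Suc m) x (last \<beta>')" "link (Suc m) x (last \<beta>') \<le> 2"
    using \<beta>(3) by (auto simp: link_Suc link_weight_def)
  have IH: "1 \<le> path_weight \<beta>'" "path_weight \<beta>' \<le> 2 ^ m" using Suc.IH[OF \<beta>(2)] by auto
  have "1 * 1 \<le> path_weight \<beta>' * link (Suc m) x (last \<beta>')" using l IH by (intro mult_mono) auto
  moreover have "path_weight \<beta>' * link (Suc m) x (last \<beta>') \<le> 2 ^ m * 2" using l IH by (intro mult_mono) auto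
  ultimately show ?case unfolding \<beta>(1) path_weight_snoc[OF paths_length[OF \<beta>(2)]] by simp
qed

section \<open>Exit rates of paths and the path generator\<close>

definition exit_sum :: "nat \<Rightarrow> nat list list \<Rightarrow> real" where
  "exit_sum m \<pi> = (\<Sum>\<^sub>\<infinity>\<nu>\<in>paths (Suc m). jump (Suc m) \<pi> \<nu>)"

definition path_gen :: "nat \<Rightarrow> nat list list \<Rightarrow> nat list list \<Rightarrow> real" where
  "path_gen m lam mu = (if lam = mu then - exit_sum m lam else jump (Suc m) lam mu)"

lemma Qgen_eq_path_gen:
  assumes "Mlen N a = Suc m"
  shows "Qgen N a = path_gen m"
proof (intro ext)
  fix lam mu
  have "(\<Sum>\<^sub>\<infinity>\<nu>\<in>paths (Suc m) - {lam}. jump (Suc m) lam \<nu>) = exit_sum m lam"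
    unfolding exit_sum_def by (rule infsum_cong_neutral) (auto simp: jump_self)
  then show "Qgen N a lam mu = path_gen m lam mu"
    unfolding Qgen_def path_gen_def Qoff_eq_jump Paths_eq assms by auto
qed

lemma jump_neighbours:
  assumes \<beta>: "\<beta> \<in> paths (Suc m)" and \<pi>: "\<pi> \<in> paths (Suc m)" and j: "jump (Suc m) \<beta> \<pi> \<noteq> 0"
  shows "last \<pi> \<in> neighbours (levn m) (last \<beta>)" and "last \<beta> \<in> neighbours (levn m) (last \<pi>)"
proof -
  have l: "length (last \<beta>) = levn m" using paths_last[OF \<beta>] by (rule Jset_length)
  note c = jump_last[OF paths_shaped[OF \<beta>] paths_shaped[OF \<pi>] j]
  then show "last \<pi> \<in> neighbours (levn m) (last \<beta>)" unfolding neighbours_def by blast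
  show "last \<beta> \<in> neighbours (levn m) (last \<pi>)"
    using c
  proof (elim disjE exE conjE)
    fix k assume k: "k < levn m" "last \<pi> = up (last \<beta>) k"
    then have "last \<beta> = dn (last \<pi>) k" using l by (simp add: dn_up)
    then show ?thesis using k unfolding neighbours_def by blast
  next
    fix k assume k: "k < levn m" "0 < last \<beta> ! k" "last \<pi> = dn (last \<beta>) k"
    then have "last \<beta> = up (last \<pi>) k" using l by (simp add: up_dn)
    then show ?thesis using k unfolding neighbours_def by blast
  qed (simp add: neighbours_def)
qed

lemma finite_fiber_union: "finite (\<Union>x\<in>neighbours n y \<inter> Jset (levn m). fiber m x)"
  by (intro finite_UN_I finite_Int disjI1 finite_neighbours finite_fiber) auto

lemma finite_jump_targets: "\<pi> \<in> paths (Suc m) \<Longrightarrow> finite {\<nu> \<in> paths (Suc m). jump (Suc m) \<pi> \<nu> \<noteq> 0}"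
  by (rule finite_subset[OF _ finite_fiber_union[where n = "levn m" and y = "last \<pi>" and m = m]])
     (use jump_neighbours(1) paths_last in \<open>auto simp: fiber_def\<close>)

lemma not_pushed_self:
  assumes len: "length b = levn m"
  shows "\<not> pushed m b b x y"
proof -
  have "b \<noteq> up b k" if "k < levn m" for k using up_neq_self[of k b] that len by metis
  moreover have "b \<noteq> dn b k" if "k < levn m" "0 < b ! k" for k using dn_neq_self[of k b] that len by metis
  ultimately show ?thesis unfolding pushed_def by (simp cong: conj_cong)
qed

text \<open>A lower move leaves the level above no choice: y stays if it still interlaces with c;
  otherwise exactly one particle of y is pushed, and this restores the interlacing. So each lower
  jump has exactly one extension to the longer path.\<close>

lemma push_unique:
  assumes b: "b \<in> Jset (levn m)" and y: "y \<in> Jset (levn (Suc m))" and prc: "prec m b y"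
    and c: "c \<in> Jset (levn m)"
    and bc: "c = b \<or> (\<exists>k<levn m. c = up b k) \<or> (\<exists>k<levn m. 0 < b ! k \<and> c = dn b k)"
  obtains v0 where "v0 \<in> neighbours (levn (Suc m)) y" "prec m c v0" "length v0 = levn (Suc m)"
    "\<And>v. prec m c v \<Longrightarrow> (v = y \<or> pushed m b c y v) \<longleftrightarrow> v = v0"
proof -
  let ?n = "levn m" and ?n' = "levn (Suc m)"
  have len: "length b = ?n" "length y = ?n'" using b y by (auto intro: Jset_length)
  have lm: "?n \<le> ?n'" by (simp add: levn_Suc)
  have above: "b ! i \<le> y ! i" if "i < ?n" for i using prc that by (simp add: prec_iff)
  have lower: "y ! Suc i \<le> b ! i" if "i < ?n" "Suc i < ?n'" for i using prc that by (simp add: prec_iff)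
  from bc consider (eq) "c = b" | (up) k where "k < ?n" "c = up b k"
    | (dn) k where "k < ?n" "0 < b ! k" "c = dn b k" by blast
  then show thesis
  proof cases
    case eq
    have "\<not> pushed m b c y v" for v unfolding eq using not_pushed_self[OF len(1)] .
    then show thesis using prc len by (intro that[of y]) (simp_all add: neighbours_def eq)
  next
    case (up k)
    have pushed: "pushed m b c y v \<longleftrightarrow> y ! k = b ! k \<and> v = up y k" for v
    proof -
      have "c = up b k' \<longleftrightarrow> k' = k" if "k' < ?n" for k' using up up_inject[of k b k'] len that by auto
      moreover have "c \<noteq> dn b k'" for k' using up up_neq_dn[of k b k'] len by simp
      ultimately show ?thesis unfolding pushed_def using up(1) by (simp cong: conj_cong)
    qed
    have bk: "b ! k \<le> y ! k" using prc up by (simp add: prec_iff)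
    have cy: "prec m c y \<longleftrightarrow> b ! k < y ! k" unfolding up(2) by (rule prec_up_lower[OF len prc up(1)])
    show thesis
    proof (cases "b ! k < y ! k")
      case True
      show thesis
      proof (rule that[of y])
        show "y \<in> neighbours ?n' y" by (simp add: neighbours_def)
        show "prec m c y" using cy True by simp
        show "(v = y \<or> pushed m b c y v) \<longleftrightarrow> v = y" for v unfolding pushed using True by auto
      qed (rule len)
    next
      case False
      then have e: "y ! k = b ! k" using bk by simp
      have ce: "c ! i = (if i = k then Suc (b ! k) else b ! i)" if "i < ?n" for i
        unfolding up(2) using that len by (simp add: nth_up)
      have ve: "up y k ! i = (if i = k then Suc (y ! k) else y ! i)" if "i < ?n'" for i
        using that len by (simp add: nth_up)
      have "prec m c (up y k)" unfolding prec_iff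
      proof (intro conjI allI impI)
        fix i assume i: "i < ?n"
        show "c ! i \<le> up y k ! i" using above[OF i] ce[OF i] ve[of i] e i lm by simp
        assume i': "Suc i < ?n'"
        show "up y k ! Suc i \<le> c ! i"
        proof (cases "Suc i = k")
          case True
          then have "c ! k \<le> c ! i" using Jset_mono[OF c, of i k] up(1) by simp
          then show ?thesis using ve[OF i'] ce[OF up(1)] True e by simp
        next
          case False
          then have "up y k ! Suc i = y ! Suc i" using ve[OF i'] by simp
          moreover have "b ! i \<le> c ! i" using ce[OF i] by simp
          ultimately show ?thesis using lower[OF i i'] by simp
        qed
      qed
      show thesis
      proof (rule that[of "up y k"])
        show "up y k \<in> neighbours ?n' y" unfolding neighbours_def using up(1) lm by simp
        show "prec m c (up y k)" by fact
        show "length (up y k) = ?n'" using len by simp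
        fix v assume "prec m c v"
        then have "v \<noteq> y" using cy False by metis
        then show "(v = y \<or> pushed m b c y v) \<longleftrightarrow> v = up y k" unfolding pushed using e  by simp
      qed
    qed
  next
    case (dn k)
    have pushed: "pushed m b c y v \<longleftrightarrow> Suc k < ?n' \<and> y ! Suc k = b ! k \<and> v = dn y (Suc k)" for v
    proof -
      have "c = dn b k' \<longleftrightarrow> k' = k" if "k' < ?n" for k' using dn dn_inject[of k b k'] len that by auto
      moreover have "c \<noteq> up b k'" if "k' < ?n" for k' using dn up_neq_dn[of k' b k] len that by simp
      ultimately show ?thesis unfolding pushed_def using dn(1,2) by (simp cong: conj_cong)
    qed
    have cy: "prec m c y \<longleftrightarrow> (Suc k < ?n' \<longrightarrow> y ! Suc k < b ! k)"
      unfolding dn(3) by (rule prec_dn_lower[OF len prc dn(1,2)])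
    show thesis
    proof (cases "Suc k < ?n' \<longrightarrow> y ! Suc k < b ! k")
      case True
      show thesis
      proof (rule that[of y])
        show "y \<in> neighbours ?n' y" by (simp add: neighbours_def)
        show "prec m c y" using cy True by simp
        show "(v = y \<or> pushed m b c y v) \<longleftrightarrow> v = y" for v unfolding pushed using True by auto
      qed (rule len)
    next
      case False
      then have k': "Suc k < ?n'" and "b ! k \<le> y ! Suc k" by auto
      moreover have "y ! Suc k \<le> b ! k" using prc dn(1) k' by (simp add: prec_iff)
      ultimately have e: "y ! Suc k = b ! k" by simp
      have ce: "c ! i = (if i = k then b ! k - 1 else b ! i)" if "i < ?n" for i
        unfolding dn(3) using that len by (simp add: nth_dn)
      have ve: "dn y (Suc k) ! i = (if i = Suc k then y ! Suc k - 1 else y ! i)" if "i < ?n'" for i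
        using that len by (simp add: nth_dn)
      have "prec m c (dn y (Suc k))" unfolding prec_iff
      proof (intro conjI allI impI)
        fix i assume i: "i < ?n"
        show "c ! i \<le> dn y (Suc k) ! i"
        proof (cases "i = Suc k")
          case True
          then have "c ! Suc k \<le> c ! k" using Jset_mono[OF c, of k "Suc k"] i by simp
          then show ?thesis using ve[OF k'] ce[OF dn(1)] True e by simp
        next
          case False
          then have "dn y (Suc k) ! i = y ! i" using ve[of i] i lm by simp
          moreover have "c ! i \<le> b ! i" using ce[OF i] by simp
          ultimately show ?thesis using above[OF i] by simp
        qed
        assume i': "Suc i < ?n'"
        show "dn y (Suc k) ! Suc i \<le> c ! i" using lower[OF i i'] ce[OF i] ve[OF i'] e by simp
      qed
      show thesis
      proof (rule that[of "dn y (Suc k)"])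
        show "dn y (Suc k) \<in> neighbours ?n' y" unfolding neighbours_def using k' by simp
        show "prec m c (dn y (Suc k))" by fact
        show "length (dn y (Suc k)) = ?n'" using len by simp
        fix v assume "prec m c v"
        then have "v \<noteq> y" using cy False by metis
        then show "(v = y \<or> pushed m b c y v) \<longleftrightarrow> v = dn y (Suc k)" unfolding pushed using e k' by simp
      qed
    qed
  qed
qed

text \<open>A jump of the longer path is either a jump of the lower path with its forced reaction
  above, which keeps the rate, or a jump of the new level alone.\<close>

lemma exit_sum_snoc:
  assumes \<pi>: "\<pi> \<in> paths (Suc m)" and y: "y \<in> Jset (levn (Suc m))" and prc: "prec m (last \<pi>) y"
  shows "exit_sum (Suc m) (\<pi> @ [y]) = exit_sum m \<pi> + outflow m (last \<pi>) y"
proof -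
  let ?n' = "levn (Suc m)" and ?b = "last \<pi>"
  let ?J = "\<lambda>\<nu> v. jump (Suc (Suc m)) (\<pi> @ [y]) (\<nu> @ [v])"
  \<comment> \<open>A contains the lower paths reachable by a jump, and V the candidates for the new
    level above each of them; \<pi> itself is added to A for the jumps of the new level
    alone.\<close>
  define A where "A = {\<nu> \<in> paths (Suc m). jump (Suc m) \<pi> \<nu> \<noteq> 0}"
  define V where "V \<nu> = {v \<in> neighbours ?n' y. prec m (last \<nu>) v}" for \<nu>
  have finA: "finite A" unfolding A_def by (rule finite_jump_targets[OF \<pi>])
  have piA: "\<pi> \<notin> A" by (simp add: A_def jump_self)
  have finV: "finite (V \<nu>)" for \<nu> unfolding V_def using finite_neighbours by auto
  have leny: "length y = ?n'" using y by (rule Jset_length)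
  have b: "?b \<in> Jset (levn m)" using \<pi> by (rule paths_last)
  have lenV: "length v = ?n'" if "v \<in> V \<nu>" for v \<nu> using that leny by (auto simp: V_def neighbours_def)
  have VJ: "v \<in> Jset ?n'" if "v \<in> V \<nu>" for v \<nu>
    using prec_Jset_upper[of v m "last \<nu>"] lenV[OF that] that by (auto simp: V_def)
  note sh = paths_shaped[OF \<pi>]
  have J: "?J \<nu> v = (if \<nu> = \<pi> then if y = v then 0 else top_jump (Suc m) y v
      else if v = y \<or> pushed m ?b (last \<nu>) y v then jump (Suc m) \<pi> \<nu> else 0)"
    if \<nu>: "\<nu> \<in> paths (Suc m)" and v: "length v = ?n'" for \<nu> v
  proof (cases "\<nu> = \<pi>")
    case True
    then show ?thesis using jump_snoc_same[OF sh leny v] by simp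
  next
    case ne: False
    then have ne': "\<pi> \<noteq> \<nu>" by simp
    show ?thesis
    proof (cases "y = v")
      case True
      show ?thesis using jump_snoc_eq[OF sh paths_shaped[OF \<nu>] leny ne'] ne unfolding True by simp
    next
      case False
      show ?thesis unfolding jump_snoc_neq[OF sh paths_shaped[OF \<nu>] leny v ne' False] using ne False by simp
    qed
  qed
  define S where "S = Sigma (insert \<pi> A) V"
  have finS: "finite S" unfolding S_def using finA finV by (intro finite_SigmaI) auto
  let ?g = "\<lambda>(\<nu>, v). \<nu> @ [v :: nat list]"
  have "exit_sum (Suc m) (\<pi> @ [y]) = sum (jump (Suc (Suc m)) (\<pi> @ [y])) (?g ` S)"
    unfolding exit_sum_def
  proof (rule infsum_eq_sum_support)
    show "finite (?g ` S)" using finS by simp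
    show "?g ` S \<subseteq> paths (Suc (Suc m))"
    proof
      fix \<rho> assume "\<rho> \<in> ?g ` S"
      then obtain \<nu> v where r: "\<rho> = \<nu> @ [v]" "\<nu> \<in> insert \<pi> A" "v \<in> V \<nu>" by (auto simp: S_def)
      then have "\<nu> \<in> paths (Suc m)" using \<pi> by (auto simp: A_def)
      then show "\<rho> \<in> paths (Suc (Suc m))"
        unfolding r(1) paths_snoc using r(3) VJ[OF r(3)] by (simp add: V_def)
    qed
    fix \<rho> assume \<rho>: "\<rho> \<in> paths (Suc (Suc m))" "\<rho> \<notin> ?g ` S"
    obtain \<nu> v where r: "\<rho> = \<nu> @ [v]" "\<nu> \<in> paths (Suc m)" "v \<in> Jset ?n'" "prec m (last \<nu>) v"
      by (rule paths_Suc_cases[OF \<rho>(1)])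
    have py: "\<pi> @ [y] \<in> paths (Suc (Suc m))" using \<pi> y prc by (simp add: paths_snoc)
    show "jump (Suc (Suc m)) (\<pi> @ [y]) \<rho> = 0"
    proof (rule ccontr)
      assume nz: "jump (Suc (Suc m)) (\<pi> @ [y]) \<rho> \<noteq> 0"
      then have "v \<in> neighbours ?n' y" using jump_neighbours(1)[OF py \<rho>(1) nz] r by simp
      then have "v \<in> V \<nu>" using r by (simp add: V_def)
      moreover have "\<nu> \<in> insert \<pi> A"
      proof (rule ccontr)
        assume "\<nu> \<notin> insert \<pi> A"
        then have "\<nu> \<noteq> \<pi>" "jump (Suc m) \<pi> \<nu> = 0" using r(2) by (auto simp: A_def)
        then have "?J \<nu> v = 0" unfolding J[OF r(2) Jset_length[OF r(3)]] by simp
        then show False using nz r(1) by simp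
      qed
      ultimately show False using \<rho>(2) r(1) by (auto simp: S_def)
    qed
  qed
  also have "\<dots> = (\<Sum>(\<nu>, v)\<in>S. ?J \<nu> v)"
    by (subst sum.reindex) (auto simp: inj_on_def case_prod_unfold)
  also have "\<dots> = (\<Sum>\<nu>\<in>insert \<pi> A. \<Sum>v\<in>V \<nu>. ?J \<nu> v)"
    unfolding S_def using finA finV by (subst sum.Sigma) auto
  also have "\<dots> = (\<Sum>v\<in>V \<pi>. ?J \<pi> v) + (\<Sum>\<nu>\<in>A. \<Sum>v\<in>V \<nu>. ?J \<nu> v)"
    using finA piA by simp
  also have "(\<Sum>v\<in>V \<pi>. ?J \<pi> v) = outflow m ?b y"
  proof -
    have "(\<Sum>v\<in>V \<pi>. ?J \<pi> v) = (\<Sum>v\<in>{v \<in> V \<pi>. v \<noteq> y}. top_jump (Suc m) y v)"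
      using finV[of \<pi>] J[OF \<pi> lenV] by (intro sum.mono_neutral_cong_right) auto
    also have "{v \<in> V \<pi>. v \<noteq> y} = {v \<in> neighbours ?n' y. v \<noteq> y \<and> prec m ?b v}" by (auto simp: V_def)
    finally show ?thesis by (simp add: outflow_def)
  qed
  also have "(\<Sum>\<nu>\<in>A. \<Sum>v\<in>V \<nu>. ?J \<nu> v) = (\<Sum>\<nu>\<in>A. jump (Suc m) \<pi> \<nu>)"
  proof (rule sum.cong[OF refl])
    fix \<nu> assume \<nu>: "\<nu> \<in> A"
    then have \<nu>p: "\<nu> \<in> paths (Suc m)" "jump (Suc m) \<pi> \<nu> \<noteq> 0" by (auto simp: A_def)
    obtain v0 where v0: "v0 \<in> neighbours ?n' y" "prec m (last \<nu>) v0" "length v0 = ?n'"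
      "\<And>v. prec m (last \<nu>) v \<Longrightarrow> (v = y \<or> pushed m ?b (last \<nu>) y v) \<longleftrightarrow> v = v0"
      using push_unique[OF b y prc paths_last[OF \<nu>p(1)] jump_last[OF sh paths_shaped[OF \<nu>p(1)] \<nu>p(2)]]
      by blast
    have ne: "\<nu> \<noteq> \<pi>" using \<nu> piA by auto
    have "(\<Sum>v\<in>V \<nu>. ?J \<nu> v) = (\<Sum>v\<in>V \<nu>. if v = v0 then jump (Suc m) \<pi> \<nu> else 0)"
    proof (rule sum.cong[OF refl])
      fix v assume v: "v \<in> V \<nu>"
      then have "(v = y \<or> pushed m ?b (last \<nu>) y v) \<longleftrightarrow> v = v0" using v0(4)[of v] by (simp add: V_def)
      then show "?J \<nu> v = (if v = v0 then jump (Suc m) \<pi> \<nu> else 0)"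
        unfolding J[OF \<nu>p(1) lenV[OF v]] using ne by simp
    qed
    also have "\<dots> = jump (Suc m) \<pi> \<nu>" using finV[of \<nu>] v0 by (simp add: V_def)
    finally show "(\<Sum>v\<in>V \<nu>. ?J \<nu> v) = jump (Suc m) \<pi> \<nu>" .
  qed
  also have "(\<Sum>\<nu>\<in>A. jump (Suc m) \<pi> \<nu>) = exit_sum m \<pi>"
    unfolding exit_sum_def by (rule infsum_eq_sum_support[symmetric]) (use finA in \<open>auto simp: A_def\<close>)
  finally show ?thesis by simp
qed

lemma level_0_jump:
  assumes x: "x \<in> Jset (levn 0)" and y: "y \<in> Jset (levn 0)" and ne: "x \<noteq> y"
  shows "top_jump 0 x y = gen 0 x y"
proof -
  have l: "levn 0 = 1" by (simp add: levn_def)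
  have len: "length x = 1" "length y = 1" using x y l by (auto dest: Jset_length)
  consider (dn) "0 < y ! 0" "x = dn y 0" | (up) "x = up y 0" | (far) "x \<noteq> up y 0" "\<not> (0 < y ! 0 \<and> x = dn y 0)"
    by (cases "x = up y 0"; cases "0 < y ! 0 \<and> x = dn y 0") auto
  then show ?thesis
  proof cases
    case dn
    then have yx: "y = up x 0" and x0: "x ! 0 = y ! 0 - 1" using len by (simp_all add: up_dn nth_dn)
    have "top_jump 0 x y = (if x ! 0 = 0 then 1 else 1/2)"
      unfolding yx using top_jump_up[of x 0 0] len l by simp
    moreover have "gen 0 x y = (if y ! 0 = 1 then 1 else 1/2)"
      unfolding gen_def l dn(2) using level_gen_dn[OF len(2), of 0 "levb 0"] down_rate_level[of 0 0 y] dn(1) l by simp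
    ultimately show ?thesis using x0 dn(1) by auto
  next
    case up
    then have yx: "y = dn x 0" and x0: "0 < x ! 0" using len by (simp_all add: dn_up nth_up)
    have "top_jump 0 x y = 1/2" unfolding yx using top_jump_dn[of x 0 0] len l x0 by simp
    moreover have "gen 0 x y = 1/2" unfolding gen_def l up using level_gen_up[OF len(2), of 0] by simp
    ultimately show ?thesis by simp
  next
    case far
    have "gen 0 x y = 0" unfolding gen_def l level_gen_def One_nat_def using far ne by auto
    moreover have "y \<noteq> up x 0"
    proof
      assume a: "y = up x 0"
      then have "0 < y ! 0" "x = dn y 0" using len by (simp_all add: nth_up dn_up)
      then show False using far by simp
    qed
    moreover have "y \<noteq> dn x 0" if "0 < x ! 0"
    proof
      assume a: "y = dn x 0"
      then have "x = up y 0" using that len by (simp add: up_dn)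
      then show False using far by simp
    qed
    ultimately show ?thesis by (auto simp: top_jump_def l)
  qed
qed

text \<open>A single particle has total rate 1 everywhere: 1 to the right at the wall, 1/2 in each
  direction elsewhere.\<close>

lemma exit_sum_0:
  assumes y: "y \<in> Jset (levn 0)"
  shows "exit_sum 0 [y] = 1" and "gen 0 y y = -1"
proof -
  have l: "levn 0 = 1" by (simp add: levn_def)
  have len: "length y = 1" using y l by (auto dest: Jset_length)
  have "gen 0 y y = - (\<Sum>k<levn 0. exit_rate (levb 0) (pos (levn 0) y k))"
    unfolding gen_def by (rule level_gen_diag) (use len l in simp)
  then show "gen 0 y y = -1" using exit_rate_level[of 0 0 y] l by simp
  have sh: "shaped 0 []" by (simp add: shaped_def)
  have J: "z \<in> Jset (levn 0)" if "length z = 1" for z using that by (simp add: Jset_iff l)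
  have j: "jump (Suc 0) [y] [v] = (if y = v then 0 else top_jump 0 y v)" if "length v = 1" for v
    using jump_snoc_same[OF sh, of y v] that len l by simp
  define T where "T = insert (up y 0) (if 0 < y ! 0 then {dn y 0} else {})"
  have "exit_sum 0 [y] = (\<Sum>\<nu>\<in>(\<lambda>x. [x]) ` T. jump (Suc 0) [y] \<nu>)"
    unfolding exit_sum_def
  proof (rule infsum_eq_sum_support)
    show "(\<lambda>x. [x]) ` T \<subseteq> paths (Suc 0)" unfolding paths_1 T_def using J len by auto
    fix \<nu> assume \<nu>: "\<nu> \<in> paths (Suc 0)" "\<nu> \<notin> (\<lambda>x. [x]) ` T"
    then obtain v where v: "\<nu> = [v]" "v \<in> Jset (levn 0)" "v \<notin> T" by (auto simp: paths_1)
    then have "length v = 1" using l by (auto dest: Jset_length)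
    then show "jump (Suc 0) [y] \<nu> = 0"
      using v j[of v] by (auto simp: T_def top_jump_def l split: if_splits)
  qed (simp add: T_def)
  also have "\<dots> = (\<Sum>v\<in>T. jump (Suc 0) [y] [v])" by (subst sum.reindex) (auto simp: inj_on_def)
  also have "\<dots> = (\<Sum>v\<in>T. top_jump 0 y v)"
    using j len up_neq_self[of 0 y] dn_neq_self[of 0 y] by (intro sum.cong) (auto simp: T_def split: if_splits)
  also have "\<dots> = 1"
    using top_jump_up[of y 0 0] top_jump_dn[of y 0 0] up_neq_dn[of 0 y 0] len l by (auto simp: T_def)
  finally show "exit_sum 0 [y] = 1" .
qed

text \<open>Read as a kernel from tops x to paths ending in x, \<open>path_weight\<close>
  intertwines the generator of the top level with that of the paths. Peeling off the top turns the
  sum into one over the configuration z below it; the induction hypothesis evaluates the inner sums,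
  and what remains concerns two adjacent levels: \<open>link_push\<close> if the tops differ,
  \<open>link_row_act\<close> if they agree.\<close>

theorem path_intertwining:
  assumes "\<pi> \<in> paths (Suc m)" and "x \<in> Jset (levn m)"
  shows "(\<Sum>\<beta>\<in>fiber m x. path_weight \<beta> * path_gen m \<beta> \<pi>) = gen m x (last \<pi>) * path_weight \<pi>"
  using assms
proof (induction m arbitrary: \<pi> x)
  case 0
  then obtain y where y: "\<pi> = [y]" "y \<in> Jset (levn 0)" by (auto simp: paths_1)
  have sh: "shaped 0 []" by (simp add: shaped_def)
  have "path_gen 0 [x] [y] = gen 0 x y"
  proof (cases "x = y")
    case True
    then show ?thesis using exit_sum_0[OF y(2)] by (simp add: path_gen_def)
  next
    case False
    then show ?thesis
      using jump_snoc_same[OF sh Jset_length[OF 0(2)] Jset_length[OF y(2)]] level_0_jump[OF 0(2) y(2)]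
      by (simp add: path_gen_def)
  qed
  then show ?case using 0 y by (simp add: fiber_0 path_weight_single)
next
  case (Suc m)
  obtain \<pi>' y where p: "\<pi> = \<pi>' @ [y]" "\<pi>' \<in> paths (Suc m)" "y \<in> Jset (levn (Suc m))" "prec m (last \<pi>') y"
    using Suc.prems(1) by (metis paths_Suc_cases)
  let ?b = "last \<pi>'"
  have b: "?b \<in> Jset (levn m)" using p(2) by (rule paths_last)
  have x: "x \<in> Jset (levn (Suc m))" by fact
  have len: "length x = levn (Suc m)" "length y = levn (Suc m)" using x p by (auto intro: Jset_length)
  have pif: "\<pi>' \<in> fiber m ?b" using p by (simp add: fiber_def)
  have W: "path_weight (\<beta> @ [x]) = path_weight \<beta> * link (Suc m) x z" if "\<beta> \<in> fiber m z" for \<beta> z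
    using that path_weight_snoc[of \<beta> m x] by (auto simp: fiber_def paths_length)
  have Wp: "path_weight \<pi> = path_weight \<pi>' * link (Suc m) y ?b"
    unfolding p(1) using p(2) by (simp add: path_weight_snoc paths_length)
  have IH: "(\<Sum>\<beta>\<in>fiber m z. path_weight \<beta> * path_gen m \<beta> \<pi>') = gen m z ?b * path_weight \<pi>'"
    if "z \<in> below m x" for z x using Suc.IH[OF p(2), of z] that by (auto simp: below_def)
  have jump: "path_gen m \<beta> \<pi>' = jump (Suc m) \<beta> \<pi>'" if "\<beta> \<in> fiber m z" "z \<noteq> ?b" for \<beta> z
    using that by (auto simp: path_gen_def fiber_def)
  have shp: "shaped (Suc m) \<pi>'" using p by (intro paths_shaped)
  have shb: "shaped (Suc m) \<beta>" if "\<beta> \<in> fiber m z" for \<beta> z using that by (auto simp: fiber_def intro: paths_shaped)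
  have finb: "finite (fiber m ?b)" using b by (rule finite_fiber)
  have "(\<Sum>\<beta>\<in>fiber (Suc m) x. path_weight \<beta> * path_gen (Suc m) \<beta> \<pi>) =
     (\<Sum>z\<in>below m x. \<Sum>\<beta>\<in>fiber m z. path_weight (\<beta> @ [x]) * path_gen (Suc m) (\<beta> @ [x]) \<pi>)"
    by (rule sum_fiber_Suc[OF x])
  also have "\<dots> = (\<Sum>z\<in>below m x. link (Suc m) x z * (\<Sum>\<beta>\<in>fiber m z. path_weight \<beta> * path_gen (Suc m) (\<beta> @ [x]) (\<pi>' @ [y])))"
    by (intro sum.cong refl) (simp add: sum_distrib_left W p(1) mult_ac)
  also have "\<dots> = gen (Suc m) x y * path_weight \<pi>"
  proof (cases "x = y")
    case False
    \<comment> \<open>Either the lower path rests and the top jumps alone, or the lower path jumps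
      and pushes the top.\<close>
    have pg: "path_gen (Suc m) (\<beta> @ [x]) (\<pi>' @ [y]) =
       (if \<beta> = \<pi>' then top_jump (Suc m) x y else if pushed m z ?b x y then jump (Suc m) \<beta> \<pi>' else 0)"
      if "\<beta> \<in> fiber m z" for \<beta> z
      using jump_snoc_same[OF shp len] jump_snoc_neq[OF shb[OF that] shp len _ False] False that
      by (auto simp: path_gen_def fiber_def)
    have np: "\<not> pushed m ?b ?b x y" by (rule not_pushed_self) (use b in \<open>rule Jset_length\<close>)
    have inb: "(\<Sum>\<beta>\<in>fiber m ?b. path_weight \<beta> * path_gen (Suc m) (\<beta> @ [x]) (\<pi>' @ [y])) = path_weight \<pi>' * top_jump (Suc m) x y"
    proof -
      have "(\<Sum>\<beta>\<in>fiber m ?b. path_weight \<beta> * path_gen (Suc m) (\<beta> @ [x]) (\<pi>' @ [y]))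
         = (\<Sum>\<beta>\<in>fiber m ?b. if \<beta> = \<pi>' then path_weight \<pi>' * top_jump (Suc m) x y else 0)"
      proof (rule sum.cong[OF refl])
        fix \<beta> assume "\<beta> \<in> fiber m ?b"
        then show "path_weight \<beta> * path_gen (Suc m) (\<beta> @ [x]) (\<pi>' @ [y]) = (if \<beta> = \<pi>' then path_weight \<pi>' * top_jump (Suc m) x y else 0)"
          unfolding pg[OF \<open>\<beta> \<in> fiber m ?b\<close>] using np by simp
      qed
      then show ?thesis using finb pif by simp
    qed
    have ino: "(\<Sum>\<beta>\<in>fiber m z. path_weight \<beta> * path_gen (Suc m) (\<beta> @ [x]) (\<pi>' @ [y]))
       = (if pushed m z ?b x y then 1 else 0) * (gen m z ?b * path_weight \<pi>')" if z: "z \<in> below m x" "z \<noteq> ?b" for z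
    proof -
      have "(\<Sum>\<beta>\<in>fiber m z. path_weight \<beta> * path_gen (Suc m) (\<beta> @ [x]) (\<pi>' @ [y]))
        = (\<Sum>\<beta>\<in>fiber m z. (if pushed m z ?b x y then 1 else 0) * (path_weight \<beta> * path_gen m \<beta> \<pi>'))"
      proof (rule sum.cong[OF refl])
        fix \<beta> assume \<beta>: "\<beta> \<in> fiber m z"
        then have "\<beta> \<noteq> \<pi>'" using z(2) by (auto simp: fiber_def)
        then show "path_weight \<beta> * path_gen (Suc m) (\<beta> @ [x]) (\<pi>' @ [y])
            = (if pushed m z ?b x y then 1 else 0) * (path_weight \<beta> * path_gen m \<beta> \<pi>')"
          unfolding pg[OF \<beta>] jump[OF \<beta> z(2)] by simp
      qed
      then show ?thesis using IH[OF z(1)] by (simp add: sum_distrib_left[symmetric])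
    qed
    let ?f = "\<lambda>z. link (Suc m) x z * (\<Sum>\<beta>\<in>fiber m z. path_weight \<beta> * path_gen (Suc m) (\<beta> @ [x]) (\<pi>' @ [y]))"
    have "sum ?f (below m x) = ?f ?b + sum ?f (below m x - {?b})"
    \<comment> \<open>If \<open>?b\<close> does not interlace with x, its link is 0 and it can be
      split off all the same.\<close>
    proof (cases "?b \<in> below m x")
      case True
      then show ?thesis by (rule sum.remove[OF finite_below])
    next
      case False
      then have "link (Suc m) x ?b = 0" using b by (auto simp: below_def link_Suc)
      then show ?thesis using False by simp
    qed
    also have "sum ?f (below m x - {?b}) =
      (\<Sum>z\<in>below m x - {?b}. link (Suc m) x z * gen m z ?b * (if pushed m z ?b x y then 1 else 0)) * path_weight \<pi>'"
      unfolding sum_distrib_right using ino by (intro sum.cong refl) (simp add: mult_ac)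
    finally have "sum ?f (below m x) = (link (Suc m) x ?b * top_jump (Suc m) x y +
        (\<Sum>z\<in>below m x - {?b}. link (Suc m) x z * gen m z ?b * (if pushed m z ?b x y then 1 else 0))) * path_weight \<pi>'"
      unfolding inb by (simp add: algebra_simps)
    then show ?thesis unfolding link_push[OF b p(3,4) x False] Wp by (simp add: mult_ac)
  next
    case True
    \<comment> \<open>With equal tops the appended level changes the generator only on the diagonal,
      where the exit rate grows by \<open>outflow\<close>.\<close>
    have pg: "path_gen (Suc m) (\<beta> @ [x]) (\<pi>' @ [y]) =
       path_gen m \<beta> \<pi>' - (if \<beta> = \<pi>' then outflow m ?b y else 0)" if "\<beta> \<in> fiber m z" for \<beta> z
      using jump_snoc_eq[OF shb[OF that] shp len(1)] exit_sum_snoc[OF p(2,3,4)] True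
      by (auto simp: path_gen_def)
    have inz: "(\<Sum>\<beta>\<in>fiber m z. path_weight \<beta> * path_gen (Suc m) (\<beta> @ [x]) (\<pi>' @ [y]))
       = gen m z ?b * path_weight \<pi>' - (if z = ?b then path_weight \<pi>' * outflow m ?b y else 0)"
      if z: "z \<in> below m x" for z
    proof -
      have "(\<Sum>\<beta>\<in>fiber m z. path_weight \<beta> * path_gen (Suc m) (\<beta> @ [x]) (\<pi>' @ [y]))
        = (\<Sum>\<beta>\<in>fiber m z. path_weight \<beta> * path_gen m \<beta> \<pi>' - (if \<beta> = \<pi>' then path_weight \<pi>' * outflow m ?b y else 0))"
        by (rule sum.cong[OF refl], subst pg) (auto simp: algebra_simps)
      moreover have "finite (fiber m z)" using z by (intro finite_fiber) (simp add: below_def)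
      moreover have "\<pi>' \<in> fiber m z \<longleftrightarrow> z = ?b" using p(2) by (auto simp: fiber_def)
      ultimately show ?thesis using IH[OF z] by (simp add: sum_subtractf)
    qed
    have bb: "?b \<in> below m x" using b p(4) True by (simp add: below_def)
    have "(\<Sum>z\<in>below m x. link (Suc m) x z * (\<Sum>\<beta>\<in>fiber m z. path_weight \<beta> * path_gen (Suc m) (\<beta> @ [x]) (\<pi>' @ [y])))
      = (\<Sum>z\<in>below m x. (link (Suc m) x z * gen m z ?b) * path_weight \<pi>'
          - (if z = ?b then link (Suc m) x ?b * path_weight \<pi>' * outflow m ?b y else 0))"
      by (rule sum.cong[OF refl], subst inz) (auto simp: algebra_simps)
    also have "\<dots> = (\<Sum>z\<in>below m x. link (Suc m) x z * gen m z ?b) * path_weight \<pi>'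
         - link (Suc m) x ?b * path_weight \<pi>' * outflow m ?b y"
      using bb by (simp add: sum_subtractf sum_distrib_right finite_below)
    also have "(\<Sum>z\<in>below m x. link (Suc m) x z * gen m z ?b) = row_act (Jset (levn m)) (gen m) (link (Suc m) y) ?b"
      unfolding row_act_def True
      by (rule infsum_eq_sum_support[symmetric, OF finite_below]) (auto simp: below_def link_Suc)
    also have "\<dots> = link (Suc m) y ?b * (gen (Suc m) y y + outflow m ?b y)"
      by (rule link_row_act[OF b p(3,4)])
    finally show ?thesis unfolding Wp True by (simp add: algebra_simps)
  qed
  finally show ?case by (simp add: p(1))
qed

section \<open>The evolution of the measure\<close>

lemma top_jump_bounds: "0 \<le> top_jump m x y" "top_jump m x y \<le> 1"
  by (simp_all add: top_jump_def)

lemma outflow_le: "outflow m b y \<le> 1 + 2 * real (levn (Suc m))"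
proof -
  let ?n = "levn (Suc m)"
  have "outflow m b y \<le> (\<Sum>v\<in>neighbours ?n y. 1)"
    unfolding outflow_def
    by (rule order.trans[OF sum_mono sum_mono2]) (auto simp: finite_neighbours top_jump_bounds)
  also have "\<dots> = real (card (neighbours ?n y))" by simp
  also have "card (neighbours ?n y) \<le> 1 + 2 * ?n"
  proof -
    have "card (neighbours ?n y) \<le> Suc (card (up y ` {..<?n} \<union> dn y ` {..<?n}))"
      unfolding neighbours_def by (rule card_insert_le_m1) simp_all
    also have "card (up y ` {..<?n} \<union> dn y ` {..<?n}) \<le> card (up y ` {..<?n}) + card (dn y ` {..<?n})"
      by (rule card_Un_le)
    also have "\<dots> \<le> ?n + ?n" by (intro add_mono) (metis card_image_le card_lessThan finite_lessThan)+
    finally show ?thesis by simp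
  qed
  finally show ?thesis by simp
qed

text \<open>Each level adds at most the number of \<open>neighbours\<close> of its configuration,
  and this number is bounded independently of the path.\<close>

lemma exit_sum_bounded: "\<exists>R. \<forall>\<pi>\<in>paths (Suc m). exit_sum m \<pi> \<le> R"
proof (induction m)
  case 0
  have "exit_sum 0 \<pi> \<le> 1" if "\<pi> \<in> paths (Suc 0)" for \<pi>
    using that exit_sum_0(1) by (auto simp: paths_1)
  then show ?case by blast
next
  case (Suc m)
  then obtain R where R: "\<And>\<pi>. \<pi> \<in> paths (Suc m) \<Longrightarrow> exit_sum m \<pi> \<le> R" by blast
  have "exit_sum (Suc m) \<pi> \<le> R + (1 + 2 * real (levn (Suc m)))" if \<pi>: "\<pi> \<in> paths (Suc (Suc m))" for \<pi>
  proof -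
    obtain \<beta> x where b: "\<pi> = \<beta> @ [x]" "\<beta> \<in> paths (Suc m)" "x \<in> Jset (levn (Suc m))" "prec m (last \<beta>) x"
      by (rule paths_Suc_cases[OF \<pi>])
    show ?thesis unfolding b(1) exit_sum_snoc[OF b(2-4)] by (intro add_mono R b(2) outflow_le)
  qed
  then show ?case by blast
qed

lemma exit_sum_nonneg: "0 \<le> exit_sum m \<pi>"
  unfolding exit_sum_def by (intro infsum_nonneg jump_nonneg)

definition source_tops :: "nat \<Rightarrow> nat list list \<Rightarrow> nat list set" where
  "source_tops m \<pi> = neighbours (levn m) (last \<pi>) \<inter> Jset (levn m)"

definition sources :: "nat \<Rightarrow> nat list list \<Rightarrow> nat list list set" where
  "sources m \<pi> = (\<Union>x\<in>source_tops m \<pi>. fiber m x)"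

lemma finite_source_tops: "finite (source_tops m \<pi>)"
  by (simp add: source_tops_def finite_neighbours)

lemma finite_sources: "finite (sources m \<pi>)"
  unfolding sources_def source_tops_def by (rule finite_fiber_union)

lemma sources_subset: "sources m \<pi> \<subseteq> paths (Suc m)"
  by (auto simp: sources_def fiber_def)

lemma self_source: "\<pi> \<in> paths (Suc m) \<Longrightarrow> \<pi> \<in> sources m \<pi>"
  using paths_last[of \<pi> m] by (auto simp: sources_def source_tops_def fiber_def neighbours_def)

lemma path_gen_outside:
  assumes \<pi>: "\<pi> \<in> paths (Suc m)" and \<beta>: "\<beta> \<in> paths (Suc m)" "\<beta> \<notin> sources m \<pi>"
  shows "path_gen m \<beta> \<pi> = 0"
proof (rule ccontr)
  assume "path_gen m \<beta> \<pi> \<noteq> 0"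
  moreover have "\<beta> \<noteq> \<pi>" using self_source[OF \<pi>] \<beta> by auto
  ultimately have "jump (Suc m) \<beta> \<pi> \<noteq> 0" by (simp add: path_gen_def)
  then have "last \<beta> \<in> source_tops m \<pi>"
    using jump_neighbours(2)[OF \<beta>(1) \<pi>] paths_last[OF \<beta>(1)] by (simp add: source_tops_def)
  then show False using \<beta> by (auto simp: sources_def fiber_def)
qed

lemma sum_sources: "sum F (sources m \<pi>) = (\<Sum>x\<in>source_tops m \<pi>. sum F (fiber m x))"
  unfolding sources_def
  by (rule sum.UNION_disjoint[OF finite_source_tops]) (auto simp: source_tops_def finite_fiber, auto simp: fiber_def)

lemma gen_outside: "x \<in> Jset (levn m) \<Longrightarrow> x \<notin> source_tops m \<pi> \<Longrightarrow> gen m x (last \<pi>) = 0"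
  unfolding gen_def source_tops_def by (rule level_gen_outside) auto

text \<open>Row vectors of the form h(top) times \<open>path_weight\<close> are preserved by the
  path generator, which acts on them as the one-level generator acts on h. Solutions of the
  top-level equation thus lift to paths.\<close>

lemma row_act_paths:
  assumes \<pi>: "\<pi> \<in> paths (Suc m)"
  shows "row_act (paths (Suc m)) (path_gen m) (\<lambda>\<beta>. h (last \<beta>) * path_weight \<beta>) \<pi>
     = row_act (Jset (levn m)) (gen m) h (last \<pi>) * path_weight \<pi>"
proof -
  have "row_act (paths (Suc m)) (path_gen m) (\<lambda>\<beta>. h (last \<beta>) * path_weight \<beta>) \<pi>
     = (\<Sum>\<beta>\<in>sources m \<pi>. h (last \<beta>) * path_weight \<beta> * path_gen m \<beta> \<pi>)"
    unfolding row_act_def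
    by (rule infsum_eq_sum_support[OF finite_sources sources_subset]) (simp add: path_gen_outside[OF \<pi>])
  also have "\<dots> = (\<Sum>x\<in>source_tops m \<pi>. \<Sum>\<beta>\<in>fiber m x. h x * (path_weight \<beta> * path_gen m \<beta> \<pi>))"
    unfolding sum_sources by (intro sum.cong refl) (auto simp: fiber_def)
  also have "\<dots> = (\<Sum>x\<in>source_tops m \<pi>. h x * (gen m x (last \<pi>) * path_weight \<pi>))"
  proof (rule sum.cong[OF refl])
    fix x assume "x \<in> source_tops m \<pi>"
    then have "x \<in> Jset (levn m)" by (simp add: source_tops_def)
    from path_intertwining[OF \<pi> this]
    show "(\<Sum>\<beta>\<in>fiber m x. h x * (path_weight \<beta> * path_gen m \<beta> \<pi>)) = h x * (gen m x (last \<pi>) * path_weight \<pi>)"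
      by (simp add: sum_distrib_left[symmetric])
  qed
  also have "\<dots> = (\<Sum>x\<in>source_tops m \<pi>. h x * gen m x (last \<pi>)) * path_weight \<pi>"
    by (simp add: sum_distrib_right mult.assoc)
  also have "(\<Sum>x\<in>source_tops m \<pi>. h x * gen m x (last \<pi>)) = row_act (Jset (levn m)) (gen m) h (last \<pi>)"
    unfolding row_act_def
    by (rule infsum_eq_sum_support[symmetric, OF finite_source_tops]) (auto simp: source_tops_def gen_outside)
  finally show ?thesis .
qed

text \<open>Exit rates control the diagonal. The rest of a column is compared with its sum weighted
  by \<open>path_weight\<close>, which the intertwining expresses through a column sum of
  \<open>gen m\<close> and the exit rate of \<pi>.\<close>

lemma column_bounded_path_gen: "\<exists>R. column_bounded (paths (Suc m)) (path_gen m) R"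
proof -
  obtain E where E: "\<And>\<pi>. \<pi> \<in> paths (Suc m) \<Longrightarrow> exit_sum m \<pi> \<le> E" using exit_sum_bounded by blast
  interpret L: column_bounded "Jset (levn m)" "gen m" "3 * real (levn m)"
    unfolding gen_def by (rule column_bounded_level_gen)
  have "column_bounded (paths (Suc m)) (path_gen m) (2 ^ m * (3 * real (levn m) + E) + E)"
  proof
    fix \<pi> assume \<pi>: "\<pi> \<in> paths (Suc m)"
    let ?F = "{\<beta> \<in> paths (Suc m). path_gen m \<beta> \<pi> \<noteq> 0}"
    let ?W = path_weight
    have sub: "?F \<subseteq> sources m \<pi>" using path_gen_outside[OF \<pi>] by blast
    then show "finite ?F" using finite_sources finite_subset by blast
    have last: "last \<pi> \<in> Jset (levn m)" using \<pi> by (rule paths_last)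
    have W: "1 \<le> ?W \<beta>" "?W \<beta> \<le> 2 ^ m" if "\<beta> \<in> paths (Suc m)" for \<beta> using path_weight_bounds[OF that] by auto
    have "(\<Sum>\<beta>\<in>?F. \<bar>path_gen m \<beta> \<pi>\<bar>) \<le> (\<Sum>\<beta>\<in>sources m \<pi>. \<bar>path_gen m \<beta> \<pi>\<bar>)"
      using sub finite_sources by (intro sum_mono2) auto
    also have "\<dots> = exit_sum m \<pi> + (\<Sum>\<beta>\<in>sources m \<pi> - {\<pi>}. jump (Suc m) \<beta> \<pi>)"
      unfolding sum.remove[OF finite_sources self_source[OF \<pi>]]
      by (simp add: path_gen_def exit_sum_nonneg jump_nonneg)
    \<comment> \<open>Jump rates are nonnegative and path weights at least 1, so inserting the
      weights only enlarges the sum.\<close>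
    also have "(\<Sum>\<beta>\<in>sources m \<pi> - {\<pi>}. jump (Suc m) \<beta> \<pi>) \<le> (\<Sum>\<beta>\<in>sources m \<pi> - {\<pi>}. ?W \<beta> * jump (Suc m) \<beta> \<pi>)"
    proof (rule sum_mono)
      fix \<beta> assume "\<beta> \<in> sources m \<pi> - {\<pi>}"
      then have "1 \<le> ?W \<beta>" using W(1) sources_subset[of m \<pi>] by auto
      then show "jump (Suc m) \<beta> \<pi> \<le> ?W \<beta> * jump (Suc m) \<beta> \<pi>"
        using mult_right_mono[OF _ jump_nonneg, of 1 "?W \<beta>" "Suc m" \<beta> \<pi>] by simp
    qed
    also have "\<dots> = (\<Sum>\<beta>\<in>sources m \<pi>. ?W \<beta> * path_gen m \<beta> \<pi>) + ?W \<pi> * exit_sum m \<pi>"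
      unfolding sum.remove[OF finite_sources self_source[OF \<pi>], of "\<lambda>\<beta>. ?W \<beta> * path_gen m \<beta> \<pi>"]
      by (simp add: path_gen_def)
    also have "(\<Sum>\<beta>\<in>sources m \<pi>. ?W \<beta> * path_gen m \<beta> \<pi>) = (\<Sum>x\<in>source_tops m \<pi>. gen m x (last \<pi>)) * ?W \<pi>"
      unfolding sum_sources sum_distrib_right
      by (intro sum.cong refl path_intertwining[OF \<pi>]) (simp add: source_tops_def)
    also have "(\<Sum>x\<in>source_tops m \<pi>. gen m x (last \<pi>)) \<le> 3 * real (levn m)"
    proof -
      have "(\<Sum>x\<in>source_tops m \<pi>. gen m x (last \<pi>)) = (\<Sum>x\<in>{x \<in> Jset (levn m). gen m x (last \<pi>) \<noteq> 0}. gen m x (last \<pi>))"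
        using gen_outside by (intro sum.mono_neutral_right finite_source_tops) (auto simp: source_tops_def)
      also have "\<dots> \<le> (\<Sum>x\<in>{x \<in> Jset (levn m). gen m x (last \<pi>) \<noteq> 0}. \<bar>gen m x (last \<pi>)\<bar>)"
        by (rule sum_mono) simp
      finally show ?thesis using L.column_sum_le[OF last] by linarith
    qed
    finally have "(\<Sum>\<beta>\<in>?F. \<bar>path_gen m \<beta> \<pi>\<bar>) \<le> exit_sum m \<pi> + (3 * real (levn m) + exit_sum m \<pi>) * ?W \<pi>"
      using W(1)[OF \<pi>] by (simp add: algebra_simps mult_right_mono)
    also have "\<dots> \<le> E + (3 * real (levn m) + E) * 2 ^ m"
      using E[OF \<pi>] exit_sum_nonneg[of m \<pi>] W[OF \<pi>] by (intro add_mono mult_mono) auto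
    finally show "(\<Sum>\<beta>\<in>?F. \<bar>path_gen m \<beta> \<pi>\<bar>) \<le> 2 ^ m * (3 * real (levn m) + E) + E"
      by (simp add: algebra_simps)
  qed
  then show ?thesis by blast
qed

theorem path_evolution:
  assumes u: "\<And>j. j < levn m \<Longrightarrow> continuous_on {0..pi} (u j)" and \<pi>: "\<pi> \<in> paths (Suc m)" and t: "t \<ge> 0"
  shows "((\<lambda>\<beta>. mdet (levn m) (levb m) u 0 (pos (levn m) (last \<beta>)) * path_weight \<beta>
      * mexp (paths (Suc m)) (path_gen m) t \<beta> \<pi>) has_sum
    mdet (levn m) (levb m) u t (pos (levn m) (last \<pi>)) * path_weight \<pi>) (paths (Suc m))"
proof -
  obtain R where "column_bounded (paths (Suc m)) (path_gen m) R" using column_bounded_path_gen by blast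
  then interpret column_bounded "paths (Suc m)" "path_gen m" R .
  obtain K where K: "\<And>t l. t \<ge> 0 \<Longrightarrow> \<bar>mdet (levn m) (levb m) u t l\<bar> \<le> K"
    using mdet_bounded[of "levn m" u "levb m"] u by blast
  have K0: "0 \<le> K" using K[of 0 "\<lambda>_. 0"] by simp
  let ?h = "\<lambda>t x. mdet (levn m) (levb m) u t (pos (levn m) x)"
  show ?thesis
  proof (rule forward_equation_solution[of "\<lambda>t \<beta>. ?h t (last \<beta>) * path_weight \<beta>" t "K * 2 ^ m" \<pi>])
    fix s \<rho> assume \<rho>: "\<rho> \<in> paths (Suc m)"
    show "((\<lambda>s. ?h s (last \<rho>) * path_weight \<rho>) has_real_derivative
        row_act (paths (Suc m)) (path_gen m) (\<lambda>\<beta>. ?h s (last \<beta>) * path_weight \<beta>) \<rho>) (at s)"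
      unfolding row_act_paths[OF \<rho>, of "?h s"] gen_def
      by (intro DERIV_cmult_right DERIV_mdet_level u paths_last[OF \<rho>])
  next
    fix s \<rho> assume s: "0 \<le> s" "s \<le> t" and \<rho>: "\<rho> \<in> paths (Suc m)"
    show "\<bar>?h s (last \<rho>) * path_weight \<rho>\<bar> \<le> K * 2 ^ m"
      unfolding abs_mult using K[OF s(1)] path_weight_bounds[OF \<rho>] K0 by (intro mult_mono) auto
  qed (use \<pi> t in auto)
qed

lemma Qpow_eq_mpow: "Qpow N a k lam mu = mpow (Paths N a) (Qgen N a) k lam mu"
  by (induction k arbitrary: mu) simp_all

lemma expQ_eq_mexp: "expQ N a t lam mu = mexp (Paths N a) (Qgen N a) t lam mu"
  by (simp add: expQ_def mexp_def Qpow_eq_mpow)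

section \<open>The multilevel kernel and its denominators\<close>

definition kern :: "real \<Rightarrow> nat \<Rightarrow> nat list \<Rightarrow> nat list \<Rightarrow> real" where
  "kern t i = level_kernel (levn i) (levb i) t"

lemma levb_cases: "levb i \<in> {-1/2, 1/2}"
  by (simp add: levb_def)

lemma kern_0: "x \<in> Jset (levn i) \<Longrightarrow> y \<in> Jset (levn i) \<Longrightarrow> kern 0 i x y = (if x = y then 1 else 0)"
  unfolding kern_def by (rule level_kernel_0[OF levb_cases])

lemma kern_pos: "x \<in> Jset (levn i) \<Longrightarrow> y \<in> Jset (levn i) \<Longrightarrow> t > 0 \<Longrightarrow> 0 < kern t i x y"
  unfolding kern_def by (rule level_kernel_pos[OF levb_cases])

lemma kern_nonneg: "x \<in> Jset (levn i) \<Longrightarrow> y \<in> Jset (levn i) \<Longrightarrow> t \<ge> 0 \<Longrightarrow> 0 \<le> kern t i x y"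
  using kern_0[of x i y] kern_pos[of x i y t] by (cases "t = 0") auto

text \<open>\<open>Delta\<close> without dimensions and constants, as \<open>Delta_eq_bridge\<close>
  shows.\<close>

definition bridge :: "real \<Rightarrow> nat \<Rightarrow> nat list \<Rightarrow> nat list \<Rightarrow> real" where
  "bridge t m x y = (\<Sum>z\<in>below m x. link (Suc m) x z * kern t m z y)"

lemma below_nonempty: "x \<in> Jset (levn (Suc m)) \<Longrightarrow> take (levn m) x \<in> below m x"
proof -
  assume x: "x \<in> Jset (levn (Suc m))"
  have l: "levn m \<le> levn (Suc m)" by (simp add: levn_Suc)
  have "prec m (take (levn m) x) x"
    unfolding prec_iff using x by (auto simp: Jset_iff)
  then show ?thesis
    using prec_Jset_lower[of "take (levn m) x" m x] x l by (simp add: below_def Jset_length)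
qed

lemma link_nonneg: "0 \<le> link i x z"
  by (simp add: link_def)

lemma link_pos: "prec m z x \<Longrightarrow> 0 < link (Suc m) x z"
  by (simp add: link_def)

lemma bridge_nonneg: "y \<in> Jset (levn m) \<Longrightarrow> t \<ge> 0 \<Longrightarrow> 0 \<le> bridge t m x y"
  unfolding bridge_def by (intro sum_nonneg mult_nonneg_nonneg link_nonneg kern_nonneg) (auto simp: below_def)

text \<open>Makes the cancellation of a denominator harmless. For t > 0 it is positive. At t = 0 the
  kernels are identity matrices, so a zero denominator means that b does not interlace with x; since
  it does with y, the two differ.\<close>

lemma bridge_eq_0:
  assumes b: "b \<in> Jset (levn m)" and x: "x \<in> Jset (levn (Suc m))" and y: "y \<in> Jset (levn (Suc m))"
    and prc: "prec m b y" and t: "t \<ge> 0" and z: "bridge t m x b = 0"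
  shows "kern t (Suc m) x y = 0"
proof (cases "t = 0")
  case True
  have "bridge t m x b = (\<Sum>z\<in>below m x. if z = b then link (Suc m) x b else 0)"
    unfolding bridge_def True by (intro sum.cong refl) (use b in \<open>auto simp: kern_0 below_def\<close>)
  then have "b \<notin> below m x" using z link_pos[of m b x] finite_below[of m x] by (auto simp: below_def)
  then have "x \<noteq> y" using b prc by (auto simp: below_def)
  then show ?thesis using kern_0[OF x y] True by simp
next
  case False
  then have t: "t > 0" using t by simp
  \<comment> \<open>The truncation of x interlaces with x, so the sum has a positive term.\<close>
  have "0 < link (Suc m) x (take (levn m) x) * kern t m (take (levn m) x) b"
    using below_nonempty[OF x] b t by (intro mult_pos_pos link_pos kern_pos) (auto simp: below_def)
  also have "\<dots> \<le> bridge t m x b"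
    unfolding bridge_def
    by (rule member_le_sum[OF below_nonempty[OF x] _ finite_below])
       (use b t in \<open>auto simp: below_def intro!: mult_nonneg_nonneg link_nonneg kern_nonneg\<close>)
  finally show ?thesis using z by simp
qed

text \<open>The dimension factors of \<open>Amat\<close> cancel. Where the paper sets the matrix to 0 because some
  \<open>\<Delta>\<close> vanishes, the product is 0 anyway by the convention \<open>x / 0 = 0\<close>.\<close>

definition multi_kernel :: "real \<Rightarrow> nat list list \<Rightarrow> nat list list \<Rightarrow> real" where
  "multi_kernel t lam mu = kern t 0 (lam ! 0) (mu ! 0) *
     (\<Prod>i\<in>{1..<length lam}. kern t i (lam ! i) (mu ! i) * link i (mu ! i) (mu ! (i - 1))
        / bridge t (i - 1) (lam ! i) (mu ! (i - 1)))"

lemma level_dim_pos: "x \<in> Jset (levn i) \<Longrightarrow> 0 < level_dim i x"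
  unfolding level_dim_def by (rule dimSO_pos)

lemma link_const_pos: "0 < link_const i"
  by (simp add: link_const_def)

lemma Tlev_eq_kern: "Tlev (\<lambda>x. exp (t * (x - 1))) i x y = kern t i x y * level_dim i y / level_dim i x"
  by (simp add: Tlev_def Tpsi_def kern_def level_kernel_def pos_def level_dim_def)

text \<open>The dimension of the intermediate configuration z cancels between link and kernel, so
  the remaining ratio leaves the sum.\<close>

lemma Delta_eq_bridge:
  assumes x: "x \<in> Jset (levn (Suc m))"
  shows "Delta (\<lambda>x. exp (t * (x - 1))) (Suc m) x y =
    link_const (Suc m) * (level_dim m y / level_dim (Suc m) x) * bridge t m x y"
proof -
  let ?\<psi> = "\<lambda>x :: real. exp (t * (x - 1))"
  have eq: "Lam (Suc m) x z * Tlev ?\<psi> m z y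
      = link_const (Suc m) * (level_dim m y / level_dim (Suc m) x) * (link (Suc m) x z * kern t m z y)"
    if z: "z \<in> Jset (levn m)" for z
  proof -
    have L: "Lam (Suc m) x z = link_const (Suc m) * (level_dim m z / level_dim (Suc m) x) * link (Suc m) x z"
      using Lam_eq_link[of "Suc m" x z] x z by simp
    show ?thesis unfolding L Tlev_eq_kern using level_dim_pos[OF z] by (simp add: field_simps)
  qed
  have "Delta ?\<psi> (Suc m) x y = (\<Sum>z\<in>below m x. Lam (Suc m) x z * Tlev ?\<psi> m z y)"
    unfolding Delta_def diff_Suc_1
    by (rule infsum_eq_sum_support[OF finite_below]) (auto simp: below_def eq link_Suc)
  also have "\<dots> = (\<Sum>z\<in>below m x. link_const (Suc m) * (level_dim m y / level_dim (Suc m) x) * (link (Suc m) x z * kern t m z y))"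
    by (intro sum.cong refl eq) (simp add: below_def)
  finally show ?thesis by (simp add: bridge_def sum_distrib_left)
qed

text \<open>Within each factor the dimension ratios of \<open>Tlev\<close>, \<open>Lam\<close> and
  \<open>Delta\<close> cancel, and so do the two link constants; at level 0 the dimensions are
  1.\<close>

lemma Amat_eq_multi_kernel:
  assumes M: "Mlen N a = Suc m" and lam: "lam \<in> paths (Suc m)" and mu: "mu \<in> paths (Suc m)"
  shows "Amat (\<lambda>x. exp (t * (x - 1))) N a lam mu = multi_kernel t lam mu"
proof -
  let ?\<psi> = "\<lambda>x :: real. exp (t * (x - 1))"
  have J: "lam ! i \<in> Jset (levn i)" "mu ! i \<in> Jset (levn i)" if "i < Suc m" for i
    using lam mu that by (auto simp: paths_def)
  have factor: "Tlev ?\<psi> i (lam ! i) (mu ! i) * Lam i (mu ! i) (mu ! (i - 1)) / Delta ?\<psi> i (lam ! i) (mu ! (i - 1))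
    = kern t i (lam ! i) (mu ! i) * link i (mu ! i) (mu ! (i - 1)) / bridge t (i - 1) (lam ! i) (mu ! (i - 1))"
    if i: "i \<in> {1..<Suc m}" for i
  proof -
    obtain k where k: "i = Suc k" using i by (cases i) auto
    have Jk: "lam ! Suc k \<in> Jset (levn (Suc k))" "mu ! Suc k \<in> Jset (levn (Suc k))" "mu ! k \<in> Jset (levn k)"
      using J i k by auto
    have L: "Lam (Suc k) (mu ! Suc k) (mu ! k) = link_const (Suc k)
        * (level_dim k (mu ! k) / level_dim (Suc k) (mu ! Suc k)) * link (Suc k) (mu ! Suc k) (mu ! k)"
      using Lam_eq_link[of "Suc k" "mu ! Suc k" "mu ! k"] Jk by simp
    show ?thesis
      unfolding k diff_Suc_1 Tlev_eq_kern Delta_eq_bridge[OF Jk(1)] L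
      using level_dim_pos[OF Jk(1)] level_dim_pos[OF Jk(2)] level_dim_pos[OF Jk(3)] link_const_pos[of "Suc k"]
      by (cases "bridge t k (lam ! Suc k) (mu ! k) = 0") (simp_all add: field_simps)
  qed
  let ?g = "\<lambda>i. Tlev ?\<psi> i (lam ! i) (mu ! i) * Lam i (mu ! i) (mu ! (i - 1)) / Delta ?\<psi> i (lam ! i) (mu ! (i - 1))"
  have "Amat ?\<psi> N a lam mu = Tlev ?\<psi> 0 (lam ! 0) (mu ! 0) * (\<Prod>i\<in>{1..<Suc m}. ?g i)"
  proof (cases "\<forall>i\<in>{1..<Suc m}. Delta ?\<psi> i (lam ! i) (mu ! (i - 1)) \<noteq> 0")
    case True
    show ?thesis unfolding Amat_def M Let_def if_P[OF True] by (rule refl)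
  next
    case False
    then obtain i where "i \<in> {1..<Suc m}" "?g i = 0" by fastforce
    then have "(\<Prod>i\<in>{1..<Suc m}. ?g i) = 0" by (intro prod_zero) auto
    then show ?thesis unfolding Amat_def M Let_def if_not_P[OF False] by simp
  qed
  also have "\<dots> = multi_kernel t lam mu"
    unfolding multi_kernel_def paths_length[OF lam]
    by (intro arg_cong2[where f = times] prod.cong refl factor) (simp add: Tlev_eq_kern level_dim_0)
  finally show ?thesis .
qed

lemma multi_kernel_nonneg:
  assumes lam: "lam \<in> paths (Suc m)" and mu: "mu \<in> paths (Suc m)" and t: "t \<ge> 0"
  shows "0 \<le> multi_kernel t lam mu"
proof -
  have J: "lam ! i \<in> Jset (levn i)" "mu ! i \<in> Jset (levn i)" if "i < Suc m" for i
    using lam mu that by (auto simp: paths_def)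
  show ?thesis
    unfolding multi_kernel_def paths_length[OF lam]
    by (intro mult_nonneg_nonneg prod_nonneg divide_nonneg_nonneg kern_nonneg link_nonneg bridge_nonneg t ballI) (auto intro: J)
qed

lemma multi_kernel_snoc:
  assumes "length \<beta> = Suc m" "length \<pi> = Suc m"
  shows "multi_kernel t (\<beta> @ [x]) (\<pi> @ [y]) = multi_kernel t \<beta> \<pi> *
    (kern t (Suc m) x y * link (Suc m) y (last \<pi>) / bridge t m x (last \<pi>))"
proof -
  have ne: "\<pi> \<noteq> []" using assms by auto
  have s: "{1..<Suc (Suc m)} = insert (Suc m) {1..<Suc m}" by auto
  let ?g = "\<lambda>lam mu i. kern t i (lam ! i) (mu ! i) * link i (mu ! i) (mu ! (i - 1))
        / bridge t (i - 1) (lam ! i) (mu ! (i - 1))"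
  have low: "(\<Prod>i\<in>{1..<Suc m}. ?g (\<beta> @ [x]) (\<pi> @ [y]) i) = (\<Prod>i\<in>{1..<Suc m}. ?g \<beta> \<pi> i)"
    using assms by (intro prod.cong) (auto simp: nth_append)
  have top: "?g (\<beta> @ [x]) (\<pi> @ [y]) (Suc m) = kern t (Suc m) x y * link (Suc m) y (last \<pi>) / bridge t m x (last \<pi>)"
    using assms ne by (simp add: nth_append last_conv_nth)
  have bot: "(\<beta> @ [x]) ! 0 = \<beta> ! 0" "(\<pi> @ [y]) ! 0 = \<pi> ! 0" using assms by (simp_all add: nth_append)
  have "multi_kernel t (\<beta> @ [x]) (\<pi> @ [y]) = kern t 0 (\<beta> ! 0) (\<pi> ! 0) *
      (?g (\<beta> @ [x]) (\<pi> @ [y]) (Suc m) * (\<Prod>i\<in>{1..<Suc m}. ?g (\<beta> @ [x]) (\<pi> @ [y]) i))"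
    unfolding multi_kernel_def bot length_append assms by (simp add: s)
  then show ?thesis unfolding low top multi_kernel_def assms by (simp add: mult_ac)
qed

text \<open>The factor of the top level does not see the levels of \<beta> below x. Summing the
  remaining kernel over the configurations z below x, with weights \<open>link\<close>, reproduces
  exactly the denominator \<open>bridge\<close>.\<close>

lemma multi_kernel_fiber_sum:
  assumes "\<pi> \<in> paths (Suc m)" and "x \<in> Jset (levn m)" and t: "t \<ge> 0"
  shows "(\<Sum>\<beta>\<in>fiber m x. path_weight \<beta> * multi_kernel t \<beta> \<pi>) = kern t m x (last \<pi>) * path_weight \<pi>"
  using assms(1,2)
proof (induction m arbitrary: \<pi> x)
  case 0
  then obtain y where "\<pi> = [y]" by (auto simp: paths_1)
  then show ?case using 0 by (simp add: fiber_0 path_weight_single multi_kernel_def)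
next
  case (Suc m)
  obtain \<rho> y where p: "\<pi> = \<rho> @ [y]" "\<rho> \<in> paths (Suc m)" "y \<in> Jset (levn (Suc m))" "prec m (last \<rho>) y"
    by (rule paths_Suc_cases[OF Suc.prems(1)])
  note x = Suc.prems(2)
  let ?b = "last \<rho>" and ?c = "kern t (Suc m) x y * link (Suc m) y (last \<rho>)"
  have b: "?b \<in> Jset (levn m)" using p(2) by (rule paths_last)
  have "(\<Sum>\<beta>\<in>fiber (Suc m) x. path_weight \<beta> * multi_kernel t \<beta> \<pi>)
     = (\<Sum>z\<in>below m x. \<Sum>\<beta>\<in>fiber m z. path_weight (\<beta> @ [x]) * multi_kernel t (\<beta> @ [x]) \<pi>)"
    by (rule sum_fiber_Suc[OF x])
  also have "\<dots> = (\<Sum>z\<in>below m x. \<Sum>\<beta>\<in>fiber m z.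
       (link (Suc m) x z * (?c / bridge t m x ?b)) * (path_weight \<beta> * multi_kernel t \<beta> \<rho>))"
    unfolding p(1) using p(2)
    by (intro sum.cong refl) (simp add: fiber_def path_weight_snoc multi_kernel_snoc paths_length)
  also have "\<dots> = (\<Sum>z\<in>below m x. (link (Suc m) x z * (?c / bridge t m x ?b)) * (kern t m z ?b * path_weight \<rho>))"
    unfolding sum_distrib_left[symmetric]
    by (intro sum.cong refl arg_cong2[where f = times] Suc.IH[OF p(2)]) (simp add: below_def)
  also have "\<dots> = bridge t m x ?b * (?c / bridge t m x ?b) * path_weight \<rho>"
    unfolding bridge_def sum_distrib_right by (intro sum.cong refl) (simp add: mult_ac)
  also have "bridge t m x ?b * (?c / bridge t m x ?b) = ?c"
    using bridge_eq_0[OF b x p(3,4) t] by (cases "bridge t m x ?b = 0") auto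
  finally show ?case
    unfolding p(1) using p(2) by (simp add: path_weight_snoc paths_length mult_ac)
qed

text \<open>Counterpart of \<open>path_evolution\<close>, obtained by summing first over the finite
  fibers and then over the tops. The initial values may be signed, so the regrouping needs absolute
  summability.\<close>

theorem multi_kernel_evolution:
  assumes u: "\<And>j. j < levn m \<Longrightarrow> continuous_on {0..pi} (u j)" and \<pi>: "\<pi> \<in> paths (Suc m)" and t: "t \<ge> 0"
  shows "(\<Sum>\<^sub>\<infinity>\<beta>\<in>paths (Suc m). mdet (levn m) (levb m) u 0 (pos (levn m) (last \<beta>)) * path_weight \<beta>
      * multi_kernel t \<beta> \<pi>) = mdet (levn m) (levb m) u t (pos (levn m) (last \<pi>)) * path_weight \<pi>"
proof -
  let ?J = "Jset (levn m)"
  let ?h = "\<lambda>t x. mdet (levn m) (levb m) u t (pos (levn m) x)"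
  let ?f = "\<lambda>x \<beta>. ?h 0 x * path_weight \<beta> * multi_kernel t \<beta> \<pi>"
  have last: "last \<pi> \<in> ?J" using \<pi> by (rule paths_last)
  have me: "mexp ?J (level_gen (levn m) (levb m)) t x (last \<pi>) = kern t m x (last \<pi>)" if "x \<in> ?J" for x
    by (simp only: kern_def level_kernel_eq_mexp[OF levb_cases that last t])
  have ker: "((\<lambda>x. ?h 0 x * kern t m x (last \<pi>)) has_sum ?h t (last \<pi>)) ?J"
  proof (rule has_sum_cong[THEN iffD1])
    show "((\<lambda>x. ?h 0 x * mexp ?J (level_gen (levn m) (levb m)) t x (last \<pi>)) has_sum ?h t (last \<pi>)) ?J"
      by (rule mdet_evolution[OF u last t])
  qed (simp only: me)
  have pw: "0 \<le> path_weight \<beta>" if "\<beta> \<in> paths (Suc m)" for \<beta> using path_weight_bounds[OF that] by auto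
  have fs: "(\<Sum>\<beta>\<in>fiber m x. ?f x \<beta>) = ?h 0 x * kern t m x (last \<pi>) * path_weight \<pi>" if "x \<in> ?J" for x
    using multi_kernel_fiber_sum[OF \<pi> that t] by (simp add: sum_distrib_left[symmetric] mult.assoc)
  \<comment> \<open>Weights and kernels are nonnegative, so absolute values affect only
    \<open>?h\<close>, and summability reduces to that of the one-level sum.\<close>
  have fa: "(\<Sum>\<beta>\<in>fiber m x. norm (?f x \<beta>)) = norm (?h 0 x * kern t m x (last \<pi>)) * path_weight \<pi>" if x: "x \<in> ?J" for x
  proof -
    have "(\<Sum>\<beta>\<in>fiber m x. norm (?f x \<beta>)) = (\<Sum>\<beta>\<in>fiber m x. \<bar>?h 0 x\<bar> * (path_weight \<beta> * multi_kernel t \<beta> \<pi>))"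
      using pw multi_kernel_nonneg[OF _ \<pi> t] by (intro sum.cong refl) (auto simp: fiber_def abs_mult)
    also have "\<dots> = \<bar>?h 0 x\<bar> * (kern t m x (last \<pi>) * path_weight \<pi>)"
      unfolding sum_distrib_left[symmetric] multi_kernel_fiber_sum[OF \<pi> x t] ..
    finally show ?thesis using kern_nonneg[OF x last t] by (simp add: abs_mult)
  qed
  have "(\<lambda>x. ?h 0 x * kern t m x (last \<pi>)) summable_on ?J"
    using ker by (rule has_sum_imp_summable)
  then have "(\<lambda>x. norm (?h 0 x * kern t m x (last \<pi>))) summable_on ?J"
    by (rule summable_on_iff_abs_summable_on_real[THEN iffD1])
  then have "(\<lambda>x. norm (?h 0 x * kern t m x (last \<pi>)) * path_weight \<pi>) summable_on ?J"
    by (rule summable_on_cmult_left)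
  then have "(\<lambda>x. \<Sum>\<^sub>\<infinity>\<beta>\<in>fiber m x. norm (?f x \<beta>)) summable_on ?J"
    by (rule summable_on_cong[THEN iffD1, rotated]) (simp only: infsum_finite finite_fiber fa)
  have norm_id: "r = norm r" if "0 \<le> r" for r :: real using that by simp
  from \<open>(\<lambda>x. \<Sum>\<^sub>\<infinity>\<beta>\<in>fiber m x. norm (?f x \<beta>)) summable_on ?J\<close>
  have outer: "(\<lambda>x. norm (\<Sum>\<^sub>\<infinity>\<beta>\<in>fiber m x. norm (?f x \<beta>))) summable_on ?J"
    by (rule summable_on_cong[THEN iffD1, rotated]) (intro norm_id infsum_nonneg norm_ge_zero)
  have inner: "(\<lambda>\<beta>. norm (?f x \<beta>)) summable_on fiber m x" if "x \<in> ?J" for x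
    by (rule summable_on_finite[OF finite_fiber[OF that]])
  have "(\<lambda>p. norm (case p of (x, \<beta>) \<Rightarrow> ?f x \<beta>)) summable_on Sigma ?J (fiber m)"
    unfolding Infinite_Sum.abs_summable_on_Sigma_iff prod.case using inner outer by blast
  then have sm: "(\<lambda>(x, \<beta>). ?f x \<beta>) summable_on Sigma ?J (fiber m)"
    by (rule abs_summable_summable)
  have bij: "bij_betw snd (Sigma ?J (fiber m)) (paths (Suc m))"
    by (rule bij_betwI[where g = "\<lambda>\<beta>. (last \<beta>, \<beta>)"]) (auto simp: fiber_def paths_last)
  have "(\<Sum>\<^sub>\<infinity>\<beta>\<in>paths (Suc m). ?f (last \<beta>) \<beta>) = (\<Sum>\<^sub>\<infinity>p\<in>Sigma ?J (fiber m). ?f (last (snd p)) (snd p))"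
    by (rule infsum_reindex_bij_betw[OF bij, symmetric])
  also have "\<dots> = (\<Sum>\<^sub>\<infinity>(x, \<beta>)\<in>Sigma ?J (fiber m). ?f x \<beta>)"
    by (rule infsum_cong) (auto simp: fiber_def)
  also have "\<dots> = (\<Sum>\<^sub>\<infinity>x\<in>?J. \<Sum>\<^sub>\<infinity>\<beta>\<in>fiber m x. ?f x \<beta>)"
    by (rule infsum_Sigma'_banach[symmetric, OF sm])
  also have "\<dots> = (\<Sum>\<^sub>\<infinity>x\<in>?J. ?h 0 x * kern t m x (last \<pi>) * path_weight \<pi>)"
    by (rule infsum_cong) (simp only: infsum_finite finite_fiber fs)
  also have "\<dots> = ?h t (last \<pi>) * path_weight \<pi>"
    using ker by (intro infsumI has_sum_cmult_left)
  finally show ?thesis .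
qed

section \<open>The path measure as a determinant of moments\<close>

definition weight_fun :: "nat \<Rightarrow> real \<Rightarrow> (real \<Rightarrow> real) \<Rightarrow> nat \<Rightarrow> real \<Rightarrow> real" where
  "weight_fun N a E j \<theta> = cos \<theta> ^ (N - j - 1) * E (cos \<theta>) * (if a = 1/2 then 2 * sin (\<theta> / 2) else 1)"

lemma continuous_on_weight_fun:
  assumes E: "continuous_on {-1..1} E"
  shows "continuous_on {0..pi} (weight_fun N a E j)"
proof -
  have "continuous_on {0..pi} (\<lambda>\<theta>. E (cos \<theta>))"
    by (rule continuous_on_compose2[OF E]) (auto intro: continuous_intros)
  then show ?thesis
    unfolding weight_fun_def[abs_def] by (cases "a = 1/2") (auto intro!: continuous_intros)
qed

text \<open>The ratios telescope down to level 0, whose dimension is 1; the surviving inverse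
  cancels the dimension in \<open>Pmeas\<close>.\<close>

lemma prod_Lam:
  assumes "lam \<in> paths (Suc m)"
  shows "(\<Prod>i\<in>{1..<Suc m}. Lam i (lam ! i) (lam ! (i - 1))) =
    (\<Prod>i\<in>{1..<Suc m}. link_const i) / level_dim m (last lam) * path_weight lam"
  using assms
proof (induction m arbitrary: lam)
  case 0
  then show ?case by (auto simp: paths_1 path_weight_single level_dim_0)
next
  case (Suc m)
  obtain \<beta> x where b: "lam = \<beta> @ [x]" "\<beta> \<in> paths (Suc m)" "x \<in> Jset (levn (Suc m))" "prec m (last \<beta>) x"
    by (rule paths_Suc_cases[OF Suc.prems])
  have len: "length \<beta> = Suc m" using b(2) by (rule paths_length)
  then have ne: "\<beta> \<noteq> []" by auto
  have lb: "last \<beta> \<in> Jset (levn m)" using b(2) by (rule paths_last)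
  have s: "{1..<Suc (Suc m)} = insert (Suc m) {1..<Suc m}" by auto
  have "(\<Prod>i\<in>{1..<Suc m}. Lam i (lam ! i) (lam ! (i - 1))) = (\<Prod>i\<in>{1..<Suc m}. Lam i (\<beta> ! i) (\<beta> ! (i - 1)))"
    unfolding b(1) using len by (intro prod.cong) (auto simp: nth_append)
  moreover have "Lam (Suc m) (lam ! Suc m) (lam ! m) = Lam (Suc m) x (last \<beta>)"
    unfolding b(1) using len ne by (simp add: nth_append last_conv_nth)
  ultimately have "(\<Prod>i\<in>{1..<Suc (Suc m)}. Lam i (lam ! i) (lam ! (i - 1))) =
     Lam (Suc m) x (last \<beta>) * (\<Prod>i\<in>{1..<Suc m}. Lam i (\<beta> ! i) (\<beta> ! (i - 1)))"
    unfolding s by simp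
  also have "\<dots> = (link_const (Suc m) * (level_dim m (last \<beta>) / level_dim (Suc m) x) * link (Suc m) x (last \<beta>))
     * ((\<Prod>i\<in>{1..<Suc m}. link_const i) / level_dim m (last \<beta>) * path_weight \<beta>)"
    unfolding Suc.IH[OF b(2)] using Lam_eq_link[of "Suc m" x "last \<beta>"] b(3) lb by simp
  also have "\<dots> = (link_const (Suc m) * (\<Prod>i\<in>{1..<Suc m}. link_const i)) / level_dim (Suc m) x
      * (path_weight \<beta> * link (Suc m) x (last \<beta>))"
    using level_dim_pos[OF lb] by simp
  finally show ?case
    unfolding b(1) path_weight_snoc[OF len] s by simp
qed

lemma level_of_top:
  assumes "N \<ge> 1" and "a \<in> {-1/2, 1/2}"
  obtains m where "Mlen N a = Suc m" "levn m = N" "levb m = a"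
proof (cases "a = 1/2")
  case True
  obtain k where k: "N = Suc k" using assms by (cases N) auto
  have "Mlen N a = Suc (Suc (2 * k))" using True k by (simp add: Mlen_def)
  moreover have "levn (Suc (2 * k)) = N" "levb (Suc (2 * k)) = a" using levn_simps(2)[of k] levb_simps(2)[of k] unfolding True k by simp_all
  ultimately show thesis by (rule that)
next
  case False
  then have a: "a = -1/2" using assms by auto
  obtain k where k: "N = Suc k" using assms by (cases N) auto
  have "Mlen N a = Suc (2 * k)" using a k by (simp add: Mlen_def)
  moreover have "levn (2 * k) = N" "levb (2 * k) = a" using levn_simps(1)[of k] levb_simps(1)[of k] unfolding a k by simp_all
  ultimately show thesis by (rule that)
qed

lemma Ppath_eq_mdet:
  assumes m: "Mlen N a = Suc m" "levn m = N" "levb m = a" and a: "a \<in> {-1/2, 1/2}"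
    and E: "continuous_on {-1..1} E" and lam: "lam \<in> paths (Suc m)"
  shows "Ppath N a E lam = Cconst N a * inverse (E 1 ^ N) * (\<Prod>i\<in>{1..<Suc m}. link_const i)
    * (mdet N a (weight_fun N a E) 0 (pos N (last lam)) * path_weight lam)"
proof -
  have last: "last lam \<in> Jset (levn m)" using lam by (rule paths_last)
  have lm: "lam ! m = last lam" using paths_length[OF lam] by (metis diff_Suc_1 last_conv_nth list.size(3) nat.distinct(1))
  have "fcoef N a E j k = moment a (weight_fun N a E j) 0 k" for j k
    using fcoef_eq_moment[OF a E, of N 0 j k] by (simp add: weight_fun_def[abs_def])
  then have det: "ldet N (\<lambda>i j. fcoef N a E j (last lam ! i + (N - 1 - i))) = mdet N a (weight_fun N a E) 0 (pos N (last lam))"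
    by (simp add: mdet_def pos_def)
  have dim: "dimSO a N (last lam) = level_dim m (last lam)" by (simp add: level_dim_def m)
  show ?thesis
    unfolding Ppath_def Pmeas_def m(1) diff_Suc_1 lm det dim prod_Lam[OF lam]
    using level_dim_pos[OF last] by simp
qed

theorem theorem3p12:
  fixes N :: nat and a t :: real and E :: "real \<Rightarrow> real" and mu :: "nat list list"
  assumes "N \<ge> 1" and "a \<in> {-1/2, 1/2}"
    and "E C1_differentiable_on {-1..1}" and "E 1 \<noteq> 0"
    and "t \<ge> 0" and "mu \<in> Paths N a"
  shows "(\<Sum>\<^sub>\<infinity>lam\<in>Paths N a. Ppath N a E lam * expQ N a t lam mu)
       = (\<Sum>\<^sub>\<infinity>lam\<in>Paths N a. Ppath N a E lam * Amat (\<lambda>x. exp (t * (x - 1))) N a lam mu)"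
proof -
  obtain m where m: "Mlen N a = Suc m" "levn m = N" "levb m = a"
    using assms(1,2) by (rule level_of_top)
  have E: "continuous_on {-1..1} E"
    using assms(3) by (rule C1_differentiable_imp_continuous_on)
  have mu: "mu \<in> paths (Suc m)" using assms(6) by (simp add: Paths_eq m(1))
  \<comment> \<open>The normalisation of the measure and the link constants form one factor common
    to both sides.\<close>
  define C where "C = Cconst N a * inverse (E 1 ^ N) * (\<Prod>i\<in>{1..<Suc m}. link_const i)"
  let ?h = "\<lambda>t x. mdet (levn m) (levb m) (weight_fun N a E) t (pos (levn m) x)"
  have P: "Ppath N a E lam = C * (?h 0 (last lam) * path_weight lam)" if "lam \<in> paths (Suc m)" for lam
    unfolding C_def Ppath_eq_mdet[OF m assms(2) E that] m ..
  have "(\<Sum>\<^sub>\<infinity>lam\<in>paths (Suc m). Ppath N a E lam * mexp (paths (Suc m)) (path_gen m) t lam mu)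
     = (\<Sum>\<^sub>\<infinity>lam\<in>paths (Suc m). C * (?h 0 (last lam) * path_weight lam * mexp (paths (Suc m)) (path_gen m) t lam mu))"
    by (rule infsum_cong) (simp add: P mult.assoc)
  also have "\<dots> = C * (?h t (last mu) * path_weight mu)"
    using path_evolution[OF continuous_on_weight_fun[OF E] mu assms(5)]
    by (intro infsumI has_sum_cmult_right)
  also have "\<dots> = C * (\<Sum>\<^sub>\<infinity>lam\<in>paths (Suc m). ?h 0 (last lam) * path_weight lam * multi_kernel t lam mu)"
    by (simp only: multi_kernel_evolution[OF continuous_on_weight_fun[OF E] mu assms(5)])
  also have "\<dots> = (\<Sum>\<^sub>\<infinity>lam\<in>paths (Suc m). C * (?h 0 (last lam) * path_weight lam * multi_kernel t lam mu))"
    by (rule infsum_cmult_right'[symmetric])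
  also have "\<dots> = (\<Sum>\<^sub>\<infinity>lam\<in>paths (Suc m). Ppath N a E lam * Amat (\<lambda>x. exp (t * (x - 1))) N a lam mu)"
    by (rule infsum_cong) (simp add: P Amat_eq_multi_kernel[OF m(1) _ mu] mult.assoc)
  finally show ?thesis
    by (simp only: expQ_eq_mexp Paths_eq m(1) Qgen_eq_path_gen[OF m(1)])
qed

end
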